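(* Let $\mathcal{H}(\mathcal{F})$ denote the set of real numbers $r>0$ such that there exists a multi-map $F$ in the class $\mathcal{F}$ whose trajectory space $X$ satisfies $h_{top}(X,\sigma_X)=r$. Then $\mathcal{H}(\mathcal{F})$ is equal to the set of all positive rational multiples of logarithms of Perron numbers, i.e. $$\mathcal{H}(\mathcal{F})=\{q\log\lambda : q\in\mathbb{Q},\ q>0,\ \lambda>1 \text{ a Perron number}\}.$$
   Context: A *Perron number* is a real algebraic integer $\lambda\ge1$ that is strictly larger in absolute value than all of its other algebraic conjugates. $h_{top}$ denotes topological entropy. **Markov multi-maps.** A Markov multi-map $F$ of $[0,1]$ is defined by a tuple $(P,\mathcal{A}_0,\mathcal{A}_1,\mathcal{A}_2,D,R,\{f_a\}_{a\in\mathcal{A}_0})$ such that: (1) $P=\{p_0,\dots,p_r\}$ with $0=p_0<\dots<p_r=1$; (2) $\mathcal{A}=\mathcal{A}_0\sqcup\mathcal{A}_1\sqcup\mathcal{A}_2$ is a finite set; (3) $D$ assigns to each $a\in\mathcal{A}$ a closed set $D(a)$, where for some $i$, $D(a)=[p_i,p_{i+1}]$ if $a\in\mathcal{A}_0$ and $D(a)=\{p_i\}$ if $a\in\mathcal{A}_1\cup\mathcal{A}_2$; (4) $R$ assigns to each $a\in\mathcal{A}$ a set $R(a)=[u,v]$ with $u\le v$ in $P$, where $u<v$ if $a\in\mathcal{A}_0$; $u<v$ and $R(a)\cap P=\{u,v\}$ if $a\in\mathcal{A}_1$; $u=v$ if $a\in\mathcal{A}_2$; (5) for $a\in\mathcal{A}_0$,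 $f_a:D(a)\to R(a)$ is a homeomorphism; (6) $[0,1]\subset\bigcup_{a\in\mathcal{A}}D(a)$. **Graphs.** For $a\in\mathcal{A}_0$, $G(a)$ is the graph of $f_a$; for $a\in\mathcal{A}_1\cup\mathcal{A}_2$, $G(a)=D(a)\times R(a)$. $G(F)=\bigcup_{a\in\mathcal{A}}G(a)$ and $F(x)=\{y:(x,y)\in G(F)\}$. For $a\in\mathcal{A}_0$ with $D(a)=[p_i,p_{i+1}]$, $R(a)=[u,v]$: $D_0(a)=(p_i,p_{i+1})$, $R_0(a)=(u,v)$, and $G_0(a)$ is the graph of $f_a|_{D_0(a)}$. For $a\in\mathcal{A}_1$ with $D(a)=\{p\}$, $R(a)=[u,v]$: $D_0(a)=\{p\}$, $R_0(a)=(u,v)$, $G_0(a)=\{p\}\times(u,v)$. For $a\in\mathcal{A}_2$ with $D(a)=\{p\}$, $R(a)=\{q\}$: $D_0(a)=\{p\}$, $R_0(a)=\{q\}$, $G_0(a)=\{(p,q)\}$. $F$ is *properly parametrized* if the sets $G_0(a)$, $a\in\mathcal{A}$, form a partition of $G(F)$ (disjoint for distinct $a$, with union $G(F)$). **Trajectory space.** $X=\{(x_n)_{n\ge0}\in[0,1]^{\mathbb{Z}_+}: x_{n+1}\in F(x_n)\ \forall n\ge 0\}$ with the product topology; $\sigma_X$ is the left shift on $X$. **Associated SFT.** $M$ is the $0$-$1$ matrix indexed by $\mathcal{A}$ with $M(a,b)=1$ iff $D_0(b)\subset R_0(a)$. $\Sigma_M=\{\mathbf{a}\in\mathcal{A}^{\mathbb{Z}_+}: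 M(a_n,a_{n+1})=1\ \forall n\ge 0\}$, with left shift $\sigma_M$. $\mathcal{L}_n$ is the set of words $a_0\dots a_n\in\mathcal{A}^{n+1}$ with $M(a_i,a_{i+1})=1$ for $0\le i<n$; $\mathcal{L}=\bigcup_{n\ge0}\mathcal{L}_n$; $[u]$ denotes the set of points of $\Sigma_M$ beginning with the word $u$. The irreducible components $\mathcal{C}\subset\mathcal{A}$ are the vertex sets of the maximal strongly connected components of the directed graph with adjacency matrix $M$; $\Sigma_M(\mathcal{C})$ is the set of points of $\Sigma_M$ using only symbols of $\mathcal{C}$, $\mathcal{L}(\mathcal{C})$ is the set of words in $\mathcal{L}$ using only symbols of $\mathcal{C}$, and $\mathcal{C}$ has positive entropy if $\Sigma_M(\mathcal{C})$ has positive topological entropy. **Intervals.** For $a\in\mathcal{A}_0$, $f_a^{-1}:R(a)\to D(a)$ is the inverse of $f_a$; for $a\in\mathcal{A}_1\cup\mathcal{A}_2$, $f_a^{-1}:R(a)\to D(a)$ is the unique (constant) map. For $a_0\dots a_n\in\mathcal{L}_n$, $I_{a_0\dots a_n}=f_{a_0}^{-1}\circ\dots\circ f_{a_{n-1}}^{-1}(D(a_n))$; for $\mathbf{a}\in\Sigma_M$, $I_{\mathbf{a}}=\bigcap_{n\ge1}I_{a_0\dots a_n}$. **Class $\mathcal{F}$.** A *coding word* for a component $\mathcal{C}$ is $u\in\mathcal{L}(\mathcal{C})$ such that if $\mathbf{a}\in\Sigma_M(\mathcal{C})$ and $\{n\ge0:\sigma_M^n(\mathbf{a})\in[u]\}$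 is infinite, then $I_{\mathbf{a}}$ is a singleton. An *avoiding word* for $\mathcal{C}$ is $u\in\mathcal{L}(\mathcal{C})$ such that $\mathbf{a}\in[u]$ implies $I_{\mathbf{a}}\cap P=\varnothing$. $\mathcal{F}$ is the class of all properly parametrized Markov multi-maps such that every irreducible component with positive entropy has a coding word, every irreducible component with positive entropy contained in $\mathcal{A}_0$ has an avoiding word, and $\Sigma_M$ has positive topological entropy. *)

theory Defs
  imports
    "HOL-Analysis.Analysis"
    "HOL-Computational_Algebra.Computational_Algebra"
begin

section \<open>Topological entropy\<close>

text \<open>The definition by open covers (Adler, Konheim, McAndrew) of the topological entropy of a
  continuous self-map \<open>T\<close> of a compact space \<open>X\<close>; compactness makes the least cardinality below
  meaningful.\<close>

definition open_cover :: "'b topology \<Rightarrow> 'b set set \<Rightarrow> bool" where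
  "open_cover X \<U> \<longleftrightarrow> (\<forall>U\<in>\<U>. openin X U) \<and> \<Union>\<U> = topspace X"

definition cover_number :: "'b topology \<Rightarrow> 'b set set \<Rightarrow> nat" where
  "cover_number X \<U> =
     (LEAST k. \<exists>\<V>. \<V> \<subseteq> \<U> \<and> finite \<V> \<and> \<Union>\<V> = topspace X \<and> card \<V> = k)"

text \<open>\<open>iterated_join X T \<U> n\<close> is the common refinement of
  \<open>\<U>, T\<^sup>-\<^sup>1 \<U>, \<dots>, T\<^sup>-\<^sup>(\<^sup>n\<^sup>-\<^sup>1\<^sup>) \<U>\<close>.\<close>

definition iterated_join :: "'b topology \<Rightarrow> ('b \<Rightarrow> 'b) \<Rightarrow> 'b set set \<Rightarrow> nat \<Rightarrow> 'b set set" where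
  "iterated_join X T \<U> n =
     {topspace X \<inter> (\<Inter>i<n. (T ^^ i) -` U i) | U. \<forall>i<n. U i \<in> \<U>}"

text \<open>By subadditivity the upper limit below is a limit.\<close>

definition cover_entropy :: "'b topology \<Rightarrow> ('b \<Rightarrow> 'b) \<Rightarrow> 'b set set \<Rightarrow> ereal" where
  "cover_entropy X T \<U> =
     limsup (\<lambda>n. ereal (ln (real (cover_number X (iterated_join X T \<U> n))) / real n))"

definition top_entropy :: "'b topology \<Rightarrow> ('b \<Rightarrow> 'b) \<Rightarrow> ereal" where
  "top_entropy X T = (SUP \<U> \<in> Collect (open_cover X). cover_entropy X T \<U>)"

definition shift :: "(nat \<Rightarrow> 'b) \<Rightarrow> (nat \<Rightarrow> 'b)" where
  "shift x = (\<lambda>n. x (Suc n))"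


section \<open>Markov multi-maps\<close>

text \<open>The functions \<open>Dom\<close>, \<open>Ran\<close> matter only on the alphabet, and \<open>branch a\<close> only for
  \<open>a\<close> in \<open>alph0\<close>, and there only on \<open>Dom a\<close>.\<close>

record 'a multi_map =
  pts :: "real set"
  alph0 :: "'a set"
  alph1 :: "'a set"
  alph2 :: "'a set"
  Dom :: "'a \<Rightarrow> real set"
  Ran :: "'a \<Rightarrow> real set"
  branch :: "'a \<Rightarrow> real \<Rightarrow> real"

definition alph :: "'a multi_map \<Rightarrow> 'a set" where
  "alph F = alph0 F \<union> alph1 F \<union> alph2 F"

definition markov_multi_map :: "'a multi_map \<Rightarrow> bool" where
  "markov_multi_map F \<longleftrightarrow>
     (\<exists>(p :: nat \<Rightarrow> real) r.
        pts F = p ` {..r} \<and> strict_mono_on {..r} p \<and> p 0 = 0 \<and> p r = 1 \<and>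
        (\<forall>a\<in>alph0 F. \<exists>i<r. Dom F a = {p i..p (Suc i)}) \<and>
        (\<forall>a\<in>alph1 F \<union> alph2 F. \<exists>i\<le>r. Dom F a = {p i})) \<and>
     finite (alph F) \<and>
     alph0 F \<inter> alph1 F = {} \<and> alph0 F \<inter> alph2 F = {} \<and> alph1 F \<inter> alph2 F = {} \<and>
     (\<forall>a\<in>alph0 F. \<exists>u\<in>pts F. \<exists>v\<in>pts F. u < v \<and> Ran F a = {u..v}) \<and>
     (\<forall>a\<in>alph1 F. \<exists>u\<in>pts F. \<exists>v\<in>pts F. u < v \<and> Ran F a = {u..v} \<and> Ran F a \<inter> pts F = {u, v}) \<and>
     (\<forall>a\<in>alph2 F. \<exists>u\<in>pts F. Ran F a = {u}) \<and>
     (\<forall>a\<in>alph0 F. \<exists>g. homeomorphism (Dom F a) (Ran F a) (branch F a) g) \<and>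
     {0..1} \<subseteq> (\<Union>a\<in>alph F. Dom F a)"

definition graph_of :: "'a multi_map \<Rightarrow> 'a \<Rightarrow> (real \<times> real) set" where
  "graph_of F a =
     (if a \<in> alph0 F then {(x, branch F a x) | x. x \<in> Dom F a} else Dom F a \<times> Ran F a)"

definition graph :: "'a multi_map \<Rightarrow> (real \<times> real) set" where
  "graph F = (\<Union>a\<in>alph F. graph_of F a)"

definition values_at :: "'a multi_map \<Rightarrow> real \<Rightarrow> real set" where
  "values_at F x = {y. (x, y) \<in> graph F}"

text \<open>The interior of \<open>[u,v]\<close> in the real line is \<open>(u,v)\<close>.\<close>

definition Dom0 :: "'a multi_map \<Rightarrow> 'a \<Rightarrow> real set" where
  "Dom0 F a = (if a \<in> alph0 F then interior (Dom F a) else Dom F a)"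

definition Ran0 :: "'a multi_map \<Rightarrow> 'a \<Rightarrow> real set" where
  "Ran0 F a = (if a \<in> alph0 F \<union> alph1 F then interior (Ran F a) else Ran F a)"

definition graph0_of :: "'a multi_map \<Rightarrow> 'a \<Rightarrow> (real \<times> real) set" where
  "graph0_of F a =
     (if a \<in> alph0 F then {(x, branch F a x) | x. x \<in> Dom0 F a} else Dom0 F a \<times> Ran0 F a)"

definition properly_parametrized :: "'a multi_map \<Rightarrow> bool" where
  "properly_parametrized F \<longleftrightarrow>
     disjoint_family_on (graph0_of F) (alph F) \<and> (\<Union>a\<in>alph F. graph0_of F a) = graph F"

definition trajectories :: "'a multi_map \<Rightarrow> (nat \<Rightarrow> real) set" where
  "trajectories F = {x. (\<forall>n. x n \<in> {0..1}) \<and> (\<forall>n. x (Suc n) \<in> values_at F (x n))}"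

definition trajectory_space :: "'a multi_map \<Rightarrow> (nat \<Rightarrow> real) topology" where
  "trajectory_space F =
     subtopology (product_topology (\<lambda>_. top_of_set {0..1}) UNIV) (trajectories F)"


section \<open>The associated subshift of finite type\<close>

definition trans_matrix :: "'a multi_map \<Rightarrow> 'a \<Rightarrow> 'a \<Rightarrow> nat" where
  "trans_matrix F a b = (if Dom0 F b \<subseteq> Ran0 F a then 1 else 0)"

definition sft :: "'a multi_map \<Rightarrow> (nat \<Rightarrow> 'a) set" where
  "sft F = {s. (\<forall>n. s n \<in> alph F) \<and> (\<forall>n. trans_matrix F (s n) (s (Suc n)) = 1)}"

definition sft_on :: "'a multi_map \<Rightarrow> 'a set \<Rightarrow> (nat \<Rightarrow> 'a) set" where
  "sft_on F C = {s \<in> sft F. \<forall>n. s n \<in> C}"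

definition subshift_space :: "'a multi_map \<Rightarrow> (nat \<Rightarrow> 'a) set \<Rightarrow> (nat \<Rightarrow> 'a) topology" where
  "subshift_space F S = subtopology (product_topology (\<lambda>_. discrete_topology (alph F)) UNIV) S"

definition language :: "'a multi_map \<Rightarrow> 'a list set" where
  "language F =
     {w. w \<noteq> [] \<and> set w \<subseteq> alph F \<and>
         (\<forall>i. Suc i < length w \<longrightarrow> trans_matrix F (w ! i) (w ! Suc i) = 1)}"

definition language_on :: "'a multi_map \<Rightarrow> 'a set \<Rightarrow> 'a list set" where
  "language_on F C = {w \<in> language F. set w \<subseteq> C}"

definition cylinder :: "'a multi_map \<Rightarrow> 'a list \<Rightarrow> (nat \<Rightarrow> 'a) set" where
  "cylinder F u = {s \<in> sft F. \<forall>i<length u. s i = u ! i}"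

definition edges :: "'a multi_map \<Rightarrow> ('a \<times> 'a) set" where
  "edges F = {(a, b). a \<in> alph F \<and> b \<in> alph F \<and> trans_matrix F a b = 1}"

definition strongly_connected :: "'a multi_map \<Rightarrow> 'a set \<Rightarrow> bool" where
  "strongly_connected F C \<longleftrightarrow>
     C \<noteq> {} \<and> C \<subseteq> alph F \<and> (\<forall>a\<in>C. \<forall>b\<in>C. (a, b) \<in> (edges F \<inter> C \<times> C)\<^sup>*)"

text \<open>A vertex on no cycle forms a component by itself; its subshift is empty and has entropy 0.\<close>

definition irreducible_component :: "'a multi_map \<Rightarrow> 'a set \<Rightarrow> bool" where
  "irreducible_component F C \<longleftrightarrow>
     strongly_connected F C \<and> (\<forall>C'. strongly_connected F C' \<and> C \<subseteq> C' \<longrightarrow> C' = C)"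

definition positive_entropy_component :: "'a multi_map \<Rightarrow> 'a set \<Rightarrow> bool" where
  "positive_entropy_component F C \<longleftrightarrow>
     irreducible_component F C \<and> top_entropy (subshift_space F (sft_on F C)) shift > 0"


section \<open>The class of multi-maps\<close>

definition branch_inv :: "'a multi_map \<Rightarrow> 'a \<Rightarrow> real \<Rightarrow> real" where
  "branch_inv F a =
     (if a \<in> alph0 F then inv_into (Dom F a) (branch F a) else (\<lambda>_. the_elem (Dom F a)))"

text \<open>Only used for nonempty words.\<close>

definition word_interval :: "'a multi_map \<Rightarrow> 'a list \<Rightarrow> real set" where
  "word_interval F w = foldr (\<lambda>a S. branch_inv F a ` S) (butlast w) (Dom F (last w))"

definition seq_interval :: "'a multi_map \<Rightarrow> (nat \<Rightarrow> 'a) \<Rightarrow> real set" where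
  "seq_interval F s = (\<Inter>n\<in>{1..}. word_interval F (map s [0..<Suc n]))"

definition coding_word :: "'a multi_map \<Rightarrow> 'a set \<Rightarrow> 'a list \<Rightarrow> bool" where
  "coding_word F C u \<longleftrightarrow>
     u \<in> language_on F C \<and>
     (\<forall>s\<in>sft_on F C. infinite {n. (shift ^^ n) s \<in> cylinder F u} \<longrightarrow> is_singleton (seq_interval F s))"

definition avoiding_word :: "'a multi_map \<Rightarrow> 'a set \<Rightarrow> 'a list \<Rightarrow> bool" where
  "avoiding_word F C u \<longleftrightarrow>
     u \<in> language_on F C \<and> (\<forall>s\<in>cylinder F u. seq_interval F s \<inter> pts F = {})"

definition class_F :: "'a multi_map \<Rightarrow> bool" where
  "class_F F \<longleftrightarrow>
     markov_multi_map F \<and> properly_parametrized F \<and>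
     (\<forall>C. positive_entropy_component F C \<longrightarrow> (\<exists>u. coding_word F C u)) \<and>
     (\<forall>C. positive_entropy_component F C \<and> C \<subseteq> alph0 F \<longrightarrow> (\<exists>u. avoiding_word F C u)) \<and>
     top_entropy (subshift_space F (sft F)) shift > 0"

text \<open>Symbols are taken to be natural numbers; every finite alphabet can be so labelled.\<close>

definition entropies_F :: "real set" where
  "entropies_F =
     {r. r > 0 \<and> (\<exists>F :: nat multi_map. class_F F \<and> top_entropy (trajectory_space F) shift = ereal r)}"


section \<open>Perron numbers\<close>

definition is_minimal_poly :: "rat poly \<Rightarrow> complex \<Rightarrow> bool" where
  "is_minimal_poly m x \<longleftrightarrow> lead_coeff m = 1 \<and> irreducible m \<and> poly (map_poly of_rat m) x = 0"

definition algebraic_conjugate :: "complex \<Rightarrow> complex \<Rightarrow> bool" where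
  "algebraic_conjugate x z \<longleftrightarrow> (\<exists>m. is_minimal_poly m x \<and> poly (map_poly of_rat m) z = 0)"

definition perron_number :: "real \<Rightarrow> bool" where
  "perron_number l \<longleftrightarrow>
     algebraic_int l \<and> l \<ge> 1 \<and>
     (\<forall>z. algebraic_conjugate (of_real l) z \<and> z \<noteq> of_real l \<longrightarrow> cmod z < \<bar>l\<bar>)"

end

theory Submission
  imports Defs
    "HOL-Real_Asymp.Real_Asymp"
    "Jordan_Normal_Form.Char_Poly"
begin

text \<open>Every trajectory has a unique coding by a point of the subshift, and the trajectories following a
  given word form a one-parameter family in which every coordinate is monotone; hence
  \<open>h(X) \<le> h(\<Sigma>\<^sub>M)\<close>. Conversely let \<open>C\<close> be a component of maximal entropy. If \<open>C\<close> contains a symbol whose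
  domain is a point, the loops at this symbol are freely concatenated trajectory segments. Otherwise
  the orbits through an avoiding word stay off \<open>P\<close>, where the coding is unambiguous, so that loops
  through the avoiding word are separated from each other by compactness. Either way \<open>h(X)\<close> is the
  logarithm of the Perron eigenvalue of a strongly connected graph, some power of which is a Perron
  number. For the converse, Lind's theorem realizes a Perron number as the eigenvalue of a nonnegative
  integer matrix; powers and subdivisions give its rational powers, and every finite graph occurs as
  the dynamics on the partition points of a multi-map whose interval branches have entropy zero.\<close>


section \<open>Walks in finite graphs and the Perron--Frobenius theorem\<close>

definition adj_apply :: "('a \<times> 'a) set \<Rightarrow> 'a set \<Rightarrow> ('a \<Rightarrow> real) \<Rightarrow> 'a \<Rightarrow> real" where
  "adj_apply r C x i = (\<Sum>j\<in>{j\<in>C. (i, j) \<in> r}. x j)"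

primrec walks :: "('a \<times> 'a) set \<Rightarrow> 'a set \<Rightarrow> nat \<Rightarrow> 'a \<Rightarrow> 'a \<Rightarrow> 'a list set" where
  "walks r C 0 i j = (if i = j then {[i]} else {})"
| "walks r C (Suc n) i j = (\<Union>k\<in>{k\<in>C. (i, k) \<in> r}. (#) i ` walks r C n k j)"

primrec num_walks :: "('a \<times> 'a) set \<Rightarrow> 'a set \<Rightarrow> nat \<Rightarrow> 'a \<Rightarrow> 'a \<Rightarrow> nat" where
  "num_walks r C 0 i j = of_bool (i = j)"
| "num_walks r C (Suc n) i j = (\<Sum>k\<in>{k\<in>C. (i, k) \<in> r}. num_walks r C n k j)"

lemma walks_length: "w \<in> walks r C n i j \<Longrightarrow> length w = Suc n"
  by (induction n arbitrary: i w) (auto split: if_splits)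

lemma walks_first: "w \<in> walks r C n i j \<Longrightarrow> w ! 0 = i"
  by (cases n) (auto split: if_splits)

lemma walks_last: "w \<in> walks r C n i j \<Longrightarrow> w ! n = j"
  by (induction n arbitrary: i w) (auto split: if_splits)

lemma walks_edge: "w \<in> walks r C n i j \<Longrightarrow> k < n \<Longrightarrow> (w ! k, w ! Suc k) \<in> r"
proof (induction n arbitrary: i w k)
  case (Suc n)
  then obtain l v where l: "(i, l) \<in> r" "w = i # v" "v \<in> walks r C n l j" by auto
  then show ?case using Suc walks_first[OF l(3)] by (cases k) auto
qed simp

lemma walks_set: "w \<in> walks r C n i j \<Longrightarrow> i \<in> C \<Longrightarrow> set w \<subseteq> C"
proof (induction n arbitrary: i w)
  case (Suc n)
  then obtain l v where "l \<in> C" "w = i # v" "v \<in> walks r C n l j" by auto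
  then show ?case using Suc by auto
qed (auto split: if_splits)

lemma finite_walks: "finite C \<Longrightarrow> finite (walks r C n i j)"
  by (induction n arbitrary: i) auto

lemma card_walks: "finite C \<Longrightarrow> card (walks r C n i j) = num_walks r C n i j"
proof (induction n arbitrary: i)
  case (Suc n)
  have "card (walks r C (Suc n) i j) = (\<Sum>k\<in>{k\<in>C. (i, k) \<in> r}. card ((#) i ` walks r C n k j))"
    unfolding walks.simps
    by (rule card_UN_disjoint) (use Suc.prems in \<open>auto simp: finite_walks dest: walks_first\<close>)
  also have "\<dots> = num_walks r C (Suc n) i j"
    using Suc by (simp add: card_image)
  finally show ?case .
qed simp

lemma seq_in_walks:
  assumes "\<And>k. k < n \<Longrightarrow> (s k, s (Suc k)) \<in> r" "\<And>k. k \<le> n \<Longrightarrow> s k \<in> C"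
  shows "map s [0..<Suc n] \<in> walks r C n (s 0) (s n)"
  using assms
proof (induction n arbitrary: s)
  case (Suc n)
  have "map (\<lambda>k. s (Suc k)) [0..<Suc n] \<in> walks r C n (s (Suc 0)) (s (Suc n))"
    by (rule Suc.IH) (use Suc.prems in auto)
  moreover have "map s [0..<Suc (Suc n)] = s 0 # map (\<lambda>k. s (Suc k)) [0..<Suc n]"
    by (simp add: upt_conv_Cons del: upt_Suc flip: map_Suc_upt)
  ultimately show ?case using Suc.prems(1)[of 0] Suc.prems(2)[of 1] by (auto simp del: upt_Suc)
qed simp

lemma num_walks_add:
  assumes "finite C" "i \<in> C" "k \<in> C"
  shows "num_walks r C m i k * num_walks r C n k j \<le> num_walks r C (m + n) i j"
  using assms(2)
proof (induction m arbitrary: i)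
  case (Suc m)
  have "num_walks r C (Suc m) i k * num_walks r C n k j
      = (\<Sum>l\<in>{l\<in>C. (i, l) \<in> r}. num_walks r C m l k * num_walks r C n k j)"
    by (simp add: sum_distrib_right)
  also have "\<dots> \<le> (\<Sum>l\<in>{l\<in>C. (i, l) \<in> r}. num_walks r C (m + n) l j)"
    by (rule sum_mono) (use Suc in auto)
  finally show ?case by simp
qed auto

lemma rtrancl_num_walks:
  assumes "finite C" "i \<in> C" "(i, j) \<in> (r \<inter> C \<times> C)\<^sup>*"
  shows "\<exists>n. num_walks r C n i j \<ge> 1"
  using assms(3,2)
proof (induction rule: converse_rtrancl_induct)
  case base
  show ?case by (rule exI[of _ 0]) simp
next
  case (step i k)
  then obtain n where n: "num_walks r C n k j \<ge> 1" by auto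
  have "num_walks r C n k j \<le> num_walks r C (Suc n) i j"
    unfolding num_walks.simps
    by (rule member_le_sum) (use step assms in auto)
  with n show ?case by (intro exI[of _ "Suc n"]) simp
qed

lemma num_walks_linear:
  assumes "finite C" "i \<in> C"
  shows "((adj_apply r C) ^^ n) x i = (\<Sum>j\<in>C. real (num_walks r C n i j) * x j)"
  using assms(2)
proof (induction n arbitrary: i)
  case 0
  have "(\<Sum>j\<in>C. real (num_walks r C 0 i j) * x j) = (\<Sum>j\<in>C. if i = j then x j else 0)"
    by (rule sum.cong) auto
  then show ?case using assms 0 by simp
next
  case (Suc n)
  have "((adj_apply r C) ^^ Suc n) x i = (\<Sum>k\<in>{k\<in>C. (i, k) \<in> r}. \<Sum>j\<in>C. real (num_walks r C n k j) * x j)"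
    unfolding funpow.simps o_def adj_apply_def[of r C "(adj_apply r C ^^ n) x"]
    by (rule sum.cong) (use Suc in auto)
  also have "\<dots> = (\<Sum>j\<in>C. \<Sum>k\<in>{k\<in>C. (i, k) \<in> r}. real (num_walks r C n k j) * x j)"
    by (rule sum.swap)
  finally show ?case by (simp add: sum_distrib_right)
qed

lemma adj_apply_mono:
  "(\<And>j. j \<in> C \<Longrightarrow> x j \<le> y j) \<Longrightarrow> adj_apply r C x i \<le> adj_apply r C y i"
  unfolding adj_apply_def by (rule sum_mono) auto

lemma adj_apply_cong:
  "(\<And>j. j \<in> C \<Longrightarrow> x j = y j) \<Longrightarrow> adj_apply r C x i = adj_apply r C y i"
  unfolding adj_apply_def by (rule sum.cong) auto

lemma adj_apply_scale: "adj_apply r C (\<lambda>j. c * x j) i = c * adj_apply r C x i"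
  unfolding adj_apply_def by (simp add: sum_distrib_left)

lemma adj_apply_nonneg: "(\<And>j. j \<in> C \<Longrightarrow> x j \<ge> 0) \<Longrightarrow> adj_apply r C x i \<ge> 0"
  unfolding adj_apply_def by (rule sum_nonneg) auto

lemma adj_apply_supersolution_pow:
  assumes "\<And>i. i \<in> C \<Longrightarrow> adj_apply r C x i \<le> l * x i" "l \<ge> 0" "i \<in> C"
  shows "((adj_apply r C) ^^ n) x i \<le> l ^ n * x i"
  using assms(3)
proof (induction n arbitrary: i)
  case (Suc n)
  have "((adj_apply r C) ^^ Suc n) x i \<le> adj_apply r C (\<lambda>j. l ^ n * x j) i"
    using Suc by (auto intro!: adj_apply_mono)
  also have "\<dots> = l ^ n * adj_apply r C x i" by (rule adj_apply_scale)
  also have "\<dots> \<le> l ^ n * (l * x i)" using assms Suc by (intro mult_left_mono) auto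
  finally show ?case by (simp add: mult_ac)
qed simp

lemma adj_apply_eigen_pow:
  assumes "\<And>i. i \<in> C \<Longrightarrow> adj_apply r C x i = l * x i" "i \<in> C"
  shows "((adj_apply r C) ^^ n) x i = l ^ n * x i"
  using assms(2)
proof (induction n arbitrary: i)
  case (Suc n)
  have "((adj_apply r C) ^^ Suc n) x i = adj_apply r C (\<lambda>j. l ^ n * x j) i"
    using Suc by (auto intro!: adj_apply_cong)
  also have "\<dots> = l ^ n * (l * x i)" using assms Suc by (simp add: adj_apply_scale)
  finally show ?case by (simp add: mult_ac)
qed simp

lemma collatz_wielandt_max:
  fixes C :: "'a set"
  assumes C: "finite C" "C \<noteq> {}"
  obtains l x where "l \<ge> 0" "\<And>i. i \<in> C \<Longrightarrow> x i \<ge> 0" "(\<Sum>i\<in>C. x i) = 1"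
    "\<And>i. i \<in> C \<Longrightarrow> l * x i \<le> adj_apply r C x i"
    "\<And>t y. t \<ge> 0 \<Longrightarrow> (\<And>i. i \<in> C \<Longrightarrow> y i \<ge> 0) \<Longrightarrow> (\<Sum>i\<in>C. y i) > 0 \<Longrightarrow>
       (\<And>i. i \<in> C \<Longrightarrow> t * y i \<le> adj_apply r C y i) \<Longrightarrow> t \<le> l"
proof -
  define B where "B = (PiE UNIV (\<lambda>_::'a. {0..1::real}))"
  define K where "K = {(t, x). t \<in> {0..real (card C)} \<and> x \<in> B \<and> (\<Sum>i\<in>C. x i) = 1 \<and>
      (\<forall>i\<in>C. t * x i \<le> adj_apply r C x i)}"
  have "compactin (product_topology (\<lambda>_. euclidean) UNIV) B"
    unfolding B_def by (subst compactin_PiE) auto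
  then have "compact B" by (simp add: euclidean_product_topology)
  then have comp: "compact ({0..real (card C)} \<times> B)" by (intro compact_Times) auto
  have ev: "continuous_on UNIV (\<lambda>p::real \<times> ('a \<Rightarrow> real). snd p i)" for i
    by (rule continuous_on_compose2[OF continuous_on_product_coordinates continuous_on_snd[OF continuous_on_id]]) auto
  have "closed ({p::real \<times> ('a \<Rightarrow> real). (\<Sum>i\<in>C. snd p i) = 1} \<inter>
      (\<Inter>i\<in>C. {p. fst p * snd p i \<le> adj_apply r C (snd p) i}))"
    unfolding adj_apply_def
    by (intro closed_Int closed_INT ballI closed_Collect_eq closed_Collect_le
        continuous_on_mult continuous_on_const continuous_on_sum ev continuous_on_fst continuous_on_id)
  moreover have "K = ({0..real (card C)} \<times> B) \<inter> ({p. (\<Sum>i\<in>C. snd p i) = 1} \<inter>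
      (\<Inter>i\<in>C. {p. fst p * snd p i \<le> adj_apply r C (snd p) i}))"
    by (auto simp: K_def)
  ultimately have "compact K" using comp by (simp add: compact_Int_closed)
  define normal where "normal y = (\<lambda>i. if i \<in> C then y i / (\<Sum>i\<in>C. y i) else 0)" for y :: "'a \<Rightarrow> real"
  have normK: "(t, normal y) \<in> K" if t: "t \<ge> 0" and y: "\<And>i. i \<in> C \<Longrightarrow> y i \<ge> 0" "(\<Sum>i\<in>C. y i) > 0"
      and sub: "\<And>i. i \<in> C \<Longrightarrow> t * y i \<le> adj_apply r C y i" for t y
  proof -
    let ?S = "\<Sum>i\<in>C. y i"
    have le: "y i \<le> ?S" if "i \<in> C" for i using that C y by (intro member_le_sum) auto
    have B: "normal y \<in> B" using y le unfolding normal_def B_def by (auto simp: divide_le_eq)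
    have one: "(\<Sum>i\<in>C. normal y i) = 1" using y unfolding normal_def 
      by (simp flip: sum_divide_distrib)
    have ad: "adj_apply r C (normal y) i = adj_apply r C y i / ?S" for i
      unfolding normal_def adj_apply_def by (simp add: sum_divide_distrib)
    have sub': "t * normal y i \<le> adj_apply r C (normal y) i" if "i \<in> C" for i
      unfolding ad using sub[OF that] that y unfolding normal_def by (simp add: divide_right_mono)
    have "t = (\<Sum>i\<in>C. t * normal y i)" using one by (simp flip: sum_distrib_left)
    also have "\<dots> \<le> (\<Sum>i\<in>C. adj_apply r C (normal y) i)" by (rule sum_mono) (rule sub')
    also have "\<dots> \<le> (\<Sum>i\<in>C. 1)"
    proof (rule sum_mono)
      fix i
      have "adj_apply r C (normal y) i \<le> (\<Sum>i\<in>C. normal y i)"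
        unfolding adj_apply_def using C B by (intro sum_mono2) (auto simp: B_def PiE_iff)
      then show "adj_apply r C (normal y) i \<le> 1" using one by simp
    qed
    finally have "t \<le> card C" by simp
    then show ?thesis using t B one sub' by (auto simp: K_def)
  qed
  have "K \<noteq> {}"
    using normK[of 0 "\<lambda>_. 1"] C by (auto simp: adj_apply_def card_gt_0_iff)
  then obtain p where p: "p \<in> K" "\<And>q. q \<in> K \<Longrightarrow> fst q \<le> fst p"
    using continuous_attains_sup[OF \<open>compact K\<close> _ continuous_on_fst[OF continuous_on_id]] by blast
  show thesis
  proof (rule that[of "fst p" "snd p"])
    fix t :: real and y :: "'a \<Rightarrow> real" assume "t \<ge> 0" "\<And>i. i \<in> C \<Longrightarrow> y i \<ge> 0" "(\<Sum>i\<in>C. y i) > 0"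
       "\<And>i. i \<in> C \<Longrightarrow> t * y i \<le> adj_apply r C y i"
    from normK[OF this] p show "t \<le> fst p" by force
  qed (use p in \<open>auto simp: K_def B_def PiE_iff case_prod_unfold\<close>)
qed

lemma perron_frobenius:
  fixes C :: "'a set"
  assumes C: "finite C" "C \<noteq> {}" and conn: "\<And>a b. a \<in> C \<Longrightarrow> b \<in> C \<Longrightarrow> (a, b) \<in> (r \<inter> C \<times> C)\<^sup>*"
  obtains l x where "l \<ge> 0" "\<And>i. i \<in> C \<Longrightarrow> x i > 0" "\<And>i. i \<in> C \<Longrightarrow> adj_apply r C x i = l * x i"
proof -
  let ?A = "adj_apply r C"
  obtain l x where l: "l \<ge> 0" and x: "\<And>i. i \<in> C \<Longrightarrow> x i \<ge> 0" "(\<Sum>i\<in>C. x i) = 1"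
    and sub: "\<And>i. i \<in> C \<Longrightarrow> l * x i \<le> ?A x i"
    and mx: "\<And>t y. t \<ge> 0 \<Longrightarrow> (\<And>i. i \<in> C \<Longrightarrow> y i \<ge> 0) \<Longrightarrow> (\<Sum>i\<in>C. y i) > 0 \<Longrightarrow>
       (\<And>i. i \<in> C \<Longrightarrow> t * y i \<le> ?A y i) \<Longrightarrow> t \<le> l"
    using collatz_wielandt_max[OF C, of r] by metis
  have "\<forall>p\<in>C\<times>C. \<exists>n. num_walks r C n (fst p) (snd p) \<ge> 1"
    using rtrancl_num_walks[OF C(1)] conn by auto
  then obtain d where d: "\<And>i j. i \<in> C \<Longrightarrow> j \<in> C \<Longrightarrow> num_walks r C (d (i, j)) i j \<ge> 1"
    by (metis (no_types, lifting) SigmaI bchoice fst_conv snd_conv)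
  define N where "N = Max (d ` (C \<times> C))"
  have dN: "d (i, j) \<le> N" if "i \<in> C" "j \<in> C" for i j
    unfolding N_def using that C by (intro Max_ge) auto
  have pow_nonneg: "(?A ^^ n) z i \<ge> 0" if "\<And>i. i \<in> C \<Longrightarrow> z i \<ge> 0" "i \<in> C" for n z i
    using that C by (simp add: num_walks_linear sum_nonneg)
  have pow_pos: "(?A ^^ d (i, k)) z i > 0" if "\<And>i. i \<in> C \<Longrightarrow> z i \<ge> 0" "z k > 0" "i \<in> C" "k \<in> C" for z i k
  proof -
    have "0 < real (num_walks r C (d (i, k)) i k) * z k" using d[OF that(3,4)] that(2) by auto
    also have "\<dots> \<le> (\<Sum>j\<in>C. real (num_walks r C (d (i, k)) i j) * z j)"
      using C that by (intro member_le_sum) auto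
    finally show ?thesis using num_walks_linear[OF C(1) that(3)] by metis
  qed
  have eig: "?A x i = l * x i" if i: "i \<in> C" for i
  proof (rule ccontr)
    assume "?A x i \<noteq> l * x i"
    define z where "z j = ?A x j - l * x j" for j
    have z: "\<And>j. j \<in> C \<Longrightarrow> z j \<ge> 0" "z i > 0"
      using sub i \<open>?A x i \<noteq> l * x i\<close> unfolding z_def by (auto simp: less_le)
    define y where "y j = (\<Sum>n\<le>N. (?A ^^ n) x j)" for j
    have y_ge: "y j \<ge> x j" if "j \<in> C" for j
      unfolding y_def using that x pow_nonneg[of x j] C
      by (intro order_trans[OF _ member_le_sum[of 0 "{..N}"]]) auto
    have Az: "(?A ^^ n) z j = (?A ^^ Suc n) x j - l * (?A ^^ n) x j" if "j \<in> C" for n j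
    proof -
      have "(?A ^^ Suc n) x j = (?A ^^ n) (?A x) j" by (simp add: funpow_swap1)
      then show ?thesis unfolding num_walks_linear[OF C(1) that] z_def
        by (simp add: algebra_simps sum_subtractf sum_distrib_left)
    qed
    have Ay: "?A y j - l * y j = (\<Sum>n\<le>N. (?A ^^ n) z j)" if "j \<in> C" for j
    proof -
      have "?A y j = (\<Sum>n\<le>N. (?A ^^ Suc n) x j)"
        unfolding y_def adj_apply_def by (simp add: sum.swap[of _ "{..N}"] adj_apply_def)
      then show ?thesis using that by (simp add: Az sum_subtractf y_def sum_distrib_left)
    qed
    have pos: "?A y j - l * y j > 0" if "j \<in> C" for j
    proof -
      have "0 < (?A ^^ d (j, i)) z j" using pow_pos z that i by blast
      also have "\<dots> \<le> (\<Sum>n\<le>N. (?A ^^ n) z j)"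
        using dN[OF that i] pow_nonneg[of z] z that by (intro member_le_sum) auto
      finally show ?thesis using Ay[OF that] by simp
    qed
    define Y where "Y = (\<Sum>j\<in>C. y j)"
    have Y: "Y \<ge> 1" "\<And>j. j \<in> C \<Longrightarrow> y j \<le> Y" "\<And>j. j \<in> C \<Longrightarrow> y j \<ge> 0"
    proof -
      show "Y \<ge> 1" unfolding Y_def using sum_mono[of C x y] y_ge x by simp
      show y0: "\<And>j. j \<in> C \<Longrightarrow> y j \<ge> 0" using y_ge x by force
      show "\<And>j. j \<in> C \<Longrightarrow> y j \<le> Y" unfolding Y_def using y0 C by (intro member_le_sum) auto
    qed
    define e where "e = Min ((\<lambda>j. ?A y j - l * y j) ` C)"
    have e: "e > 0" "\<And>j. j \<in> C \<Longrightarrow> e \<le> ?A y j - l * y j"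
      using C pos by (auto simp: e_def)
    have "l + e / Y \<le> l"
    proof (rule mx)
      show "0 \<le> l + e / Y" using l e Y by simp
      show "0 < (\<Sum>i\<in>C. y i)" using Y unfolding Y_def by linarith
      show "(l + e / Y) * y j \<le> ?A y j" if "j \<in> C" for j
      proof -
        have "e / Y * y j \<le> e / Y * Y" using Y that e by (intro mult_left_mono) auto
        then have "e / Y * y j \<le> e" using Y by simp
        then show ?thesis using e(2)[OF that] by (simp add: algebra_simps)
      qed
    qed (use Y in auto)
    then show False using e Y by (simp add: divide_le_0_iff)
  qed
  have "\<exists>k\<in>C. x k > 0"
  proof (rule ccontr)
    assume "\<not> (\<exists>k\<in>C. x k > 0)"
    then have "\<And>k. k \<in> C \<Longrightarrow> x k = 0" using x(1) by force
    then show False using x(2) by simp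
  qed
  then obtain k where k: "k \<in> C" "x k > 0" by blast
  have "x i > 0" if "i \<in> C" for i
  proof -
    have "0 < l ^ d (i, k) * x i"
      using pow_pos[of x k i] x(1) k that adj_apply_eigen_pow[of C r x l i "d (i, k)"] eig by simp
    then show ?thesis using l x(1)[OF that] by (simp add: zero_less_mult_iff)
  qed
  then show thesis using that l eig by blast
qed

definition scc_of :: "('a \<times> 'a) set \<Rightarrow> 'a \<Rightarrow> 'a set" where
  "scc_of r i = {j. (i, j) \<in> r\<^sup>* \<and> (j, i) \<in> r\<^sup>*}"

lemma scc_of_self: "i \<in> scc_of r i"
  by (simp add: scc_of_def)

lemma scc_of_eq: "j \<in> scc_of r i \<Longrightarrow> scc_of r j = scc_of r i"
  unfolding scc_of_def by (auto intro: rtrancl_trans)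

lemma rtrancl_in: "(i, j) \<in> r\<^sup>* \<Longrightarrow> r \<subseteq> V \<times> V \<Longrightarrow> i \<in> V \<Longrightarrow> j \<in> V"
  by (induction rule: rtrancl_induct) auto

lemma scc_of_subset: "r \<subseteq> V \<times> V \<Longrightarrow> i \<in> V \<Longrightarrow> scc_of r i \<subseteq> V"
  unfolding scc_of_def by (auto intro: rtrancl_in)

lemma scc_of_connected:
  assumes "a \<in> scc_of r i" "b \<in> scc_of r i"
  shows "(a, b) \<in> (r \<inter> scc_of r i \<times> scc_of r i)\<^sup>*"
proof -
  have "(a, b) \<in> r\<^sup>*" using assms unfolding scc_of_def by (auto intro: rtrancl_trans)
  then show ?thesis using assms(1)
  proof (induction rule: converse_rtrancl_induct)
    case (step a k)
    have "(i, k) \<in> r\<^sup>*" using step unfolding scc_of_def by (auto intro: rtrancl.rtrancl_into_rtrancl)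
    moreover have "(k, i) \<in> r\<^sup>*" using step assms(2) unfolding scc_of_def by (auto intro: rtrancl_trans)
    ultimately have "k \<in> scc_of r i" by (simp add: scc_of_def)
    then show ?case using step by (auto intro: converse_rtrancl_into_rtrancl)
  qed simp
qed

text \<open>The growth rate of a finite graph is that of a component: weighting the Perron vectors of the
  components by powers of a large constant, according to the number of reachable vertices, makes
  the contributions of the other components negligible.\<close>

lemma dominant_component:
  fixes r :: "('a \<times> 'a) set"
  assumes V: "finite V" "V \<noteq> {}" and r: "r \<subseteq> V \<times> V"
  obtains i l x where "i \<in> V" "l \<ge> 0" "\<And>j. j \<in> scc_of r i \<Longrightarrow> x j > 0"
    "\<And>j. j \<in> scc_of r i \<Longrightarrow> adj_apply r (scc_of r i) x j = l * x j"
    "\<And>l'. l' > l \<Longrightarrow> \<exists>y. \<forall>j\<in>V. y j > 0 \<and> adj_apply r V y j \<le> l' * y j"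
proof -
  have "\<forall>C\<in>scc_of r ` V. \<exists>p. fst p \<ge> 0 \<and> (\<forall>i\<in>C. snd p i > 0) \<and>
      (\<forall>i\<in>C. adj_apply r C (snd p) i = fst p * snd p i)"
  proof
    fix C assume "C \<in> scc_of r ` V"
    then obtain i where i: "i \<in> V" "C = scc_of r i" by auto
    have "finite C" "C \<noteq> {}"
      using i scc_of_subset[OF r i(1)] V finite_subset scc_of_self[of i r] by auto
    from perron_frobenius[OF this, of r] scc_of_connected[of _ r i] i
    obtain l and x :: "'a \<Rightarrow> real" where "l \<ge> 0" "\<And>i. i \<in> C \<Longrightarrow> x i > 0"
       "\<And>i. i \<in> C \<Longrightarrow> adj_apply r C x i = l * x i" by metis
    then show "\<exists>p. fst p \<ge> 0 \<and> (\<forall>i\<in>C. snd p i > 0) \<and> (\<forall>i\<in>C. adj_apply r C (snd p) i = fst p * snd p i)"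
      by (intro exI[of _ "(l, x)"]) auto
  qed
  then obtain P where P: "\<And>C. C \<in> scc_of r ` V \<Longrightarrow> fst (P C) \<ge> 0 \<and> (\<forall>i\<in>C. snd (P C) i > 0) \<and>
      (\<forall>i\<in>C. adj_apply r C (snd (P C)) i = fst (P C) * snd (P C) i)"
    using bchoice[of "scc_of r ` V"] by metis
  define l where "l i = fst (P (scc_of r i))" for i
  define X where "X i = snd (P (scc_of r i)) i" for i
  have l0: "l i \<ge> 0" if "i \<in> V" for i using P that unfolding l_def by auto
  have X0: "X i > 0" if "i \<in> V" for i using P[of "scc_of r i"] that scc_of_self[of i r] unfolding X_def by auto
  have eig: "adj_apply r (scc_of r i) X i = l i * X i" if "i \<in> V" for i
  proof -
    have "adj_apply r (scc_of r i) X i = adj_apply r (scc_of r i) (snd (P (scc_of r i))) i"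
      by (rule adj_apply_cong) (simp add: X_def scc_of_eq)
    then show ?thesis using P[of "scc_of r i"] that scc_of_self[of i r] unfolding X_def l_def by auto
  qed
  obtain i where i: "i \<in> V" "\<And>j. j \<in> V \<Longrightarrow> l j \<le> l i"
    using Max_in[of "l ` V"] Max_ge[of "l ` V"] V by (metis (no_types, lifting) finite_imageI image_iff image_is_empty)
  have super: "\<exists>y. \<forall>j\<in>V. y j > 0 \<and> adj_apply r V y j \<le> l' * y j" if l': "l' > l i" for l'
  proof -
    define M where "M = Max (X ` V)"
    define m where "m = Min (X ` V)"
    have M: "X j \<le> M" if "j \<in> V" for j using that V unfolding M_def by auto
    have m: "m > 0" "\<And>j. j \<in> V \<Longrightarrow> m \<le> X j" using V X0 unfolding m_def by auto
    have M0: "M > 0" using X0 M i(1) by force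
    define K where "K = max 1 (card V * M / ((l' - l i) * m))"
    have K: "K \<ge> 1" "card V * M \<le> (l' - l i) * m * K"
    proof -
      show "K \<ge> 1" by (simp add: K_def)
      have "card V * M / ((l' - l i) * m) \<le> K" by (simp add: K_def)
      then show "card V * M \<le> (l' - l i) * m * K" using m l' by (simp add: divide_le_eq mult_ac)
    qed
    define R where "R j = card (r\<^sup>* `` {j})" for j
    have finR: "finite (r\<^sup>* `` {j})" if "j \<in> V" for j
      using rtrancl_in[OF _ r that] V by (auto intro: finite_subset[of _ V])
    define y where "y j = K ^ R j * X j" for j
    have "adj_apply r V y j \<le> l' * y j" if j: "j \<in> V" for j
    proof -
      let ?C = "scc_of r j"
      have C: "?C \<subseteq> V" using scc_of_subset[OF r j] .
      have R1: "R j \<ge> 1" unfolding R_def using finR[OF j] by (simp add: Suc_le_eq card_gt_0_iff) blast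
      have "adj_apply r V y j = adj_apply r ?C y j + (\<Sum>k\<in>{k\<in>V - ?C. (j, k) \<in> r}. y k)"
        unfolding adj_apply_def using C V
        by (subst sum.union_disjoint[symmetric]) (auto intro!: sum.cong finite_subset[of _ V])
      also have "adj_apply r ?C y j = K ^ R j * (l j * X j)"
      proof -
        have "R k = R j" if "k \<in> ?C" for k
          using that unfolding R_def scc_of_def
          by (intro arg_cong[of _ _ card]) (auto intro: rtrancl_trans)
        then have "adj_apply r ?C y j = adj_apply r ?C (\<lambda>k. K ^ R j * X k) j"
          by (intro adj_apply_cong) (simp add: y_def)
        then show ?thesis using eig[OF j] by (simp add: adj_apply_scale)
      qed
      also have "(\<Sum>k\<in>{k\<in>V - ?C. (j, k) \<in> r}. y k) \<le> (\<Sum>k\<in>{k\<in>V - ?C. (j, k) \<in> r}. K ^ (R j - 1) * M)"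
      proof (rule sum_mono)
        fix k assume k: "k \<in> {k\<in>V - ?C. (j, k) \<in> r}"
        then have "r\<^sup>* `` {k} \<subset> r\<^sup>* `` {j}" unfolding scc_of_def
          by (auto intro: converse_rtrancl_into_rtrancl)
        then have "R k < R j" unfolding R_def using finR[OF j] by (rule psubset_card_mono[rotated])
        then have "K ^ R k \<le> K ^ (R j - 1)" using K by (intro power_increasing) auto
        then show "y k \<le> K ^ (R j - 1) * M" unfolding y_def
          using k M X0[of k] K by (intro mult_mono) auto
      qed
      also have "\<dots> = card {k\<in>V - ?C. (j, k) \<in> r} * (K ^ (R j - 1) * M)" by simp
      also have "\<dots> \<le> card V * (K ^ (R j - 1) * M)"
        using V K M0 by (intro mult_right_mono) (auto intro: card_mono)
      also have "\<dots> = (card V * M) * K ^ (R j - 1)" by simp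
      also have "\<dots> \<le> ((l' - l i) * m * K) * K ^ (R j - 1)"
        using K by (intro mult_right_mono) auto
      also have "\<dots> = (l' - l i) * m * K ^ R j" using R1 by (simp add: power_eq_if)
      also have "\<dots> \<le> (l' - l j) * X j * K ^ R j"
        using i(2)[OF j] m(2)[OF j] m(1) l' K by (intro mult_right_mono mult_mono) auto
      finally show ?thesis by (simp add: y_def[of j] algebra_simps)
    qed
    moreover have "y j > 0" if "j \<in> V" for j using X0[OF that] K by (simp add: y_def)
    ultimately show ?thesis by blast
  qed
  have "adj_apply r (scc_of r i) X j = l i * X j" if "j \<in> scc_of r i" for j
    using eig[of j] that scc_of_subset[OF r i(1)] scc_of_eq[OF that] by (auto simp: l_def)
  moreover have "X j > 0" if "j \<in> scc_of r i" for j
    using X0[of j] that scc_of_subset[OF r i(1)] by auto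
  ultimately show thesis using that[of i "l i" X] i l0[OF i(1)] super by blast
qed

lemma subsolution_le_supersolution:
  assumes V: "finite V" and x: "\<And>i. i \<in> V \<Longrightarrow> x i \<ge> 0" "k \<in> V" "x k > 0"
    "\<And>i. i \<in> V \<Longrightarrow> l * x i \<le> adj_apply r V x i"
    and y: "\<And>i. i \<in> V \<Longrightarrow> y i > 0" "\<And>i. i \<in> V \<Longrightarrow> adj_apply r V y i \<le> l' * y i"
  shows "l \<le> l'"
proof -
  define q where "q i = x i / y i" for i
  obtain i where i: "i \<in> V" "\<And>j. j \<in> V \<Longrightarrow> q j \<le> q i"
    using Max_in[of "q ` V"] Max_ge[of "q ` V"] V x(2)
    by (metis (no_types, lifting) empty_iff finite_imageI image_iff image_is_empty)
  have qi: "q i > 0" using divide_pos_pos[OF x(3) y(1)[OF x(2)]] i(2)[OF x(2)] unfolding q_def by linarith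
  then have xi: "x i > 0" "x i = q i * y i" using y(1)[OF i(1)] by (auto simp: q_def zero_less_divide_iff)
  have "l * x i \<le> adj_apply r V x i" using x i by blast
  also have "\<dots> \<le> adj_apply r V (\<lambda>j. q i * y j) i"
  proof (rule adj_apply_mono)
    fix j assume "j \<in> V"
    then show "x j \<le> q i * y j" using i(2)[of j] y(1)[of j] by (simp add: q_def divide_le_eq)
  qed
  also have "\<dots> = q i * adj_apply r V y i" by (rule adj_apply_scale)
  also have "\<dots> \<le> q i * (l' * y i)" using y(2)[OF i(1)] qi by simp
  also have "\<dots> = l' * x i" using xi by simp
  finally show ?thesis using xi(1) by (rule mult_right_le_imp_le)
qed

lemma num_walks_upper:
  assumes V: "finite V" and y: "\<And>i. i \<in> V \<Longrightarrow> y i > 0" "\<And>i. i \<in> V \<Longrightarrow> adj_apply r V y i \<le> l * y i"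
    and l: "l \<ge> 0"
  obtains K where "K > 0" "\<And>n. real (\<Sum>i\<in>V. \<Sum>j\<in>V. num_walks r V n i j) \<le> K * l ^ n"
proof (cases "V = {}")
  case True
  show ?thesis by (rule that[of 1]) (use True l in auto)
next
  case False
  define m where "m = Min (y ` V)"
  have m: "m > 0" "\<And>i. i \<in> V \<Longrightarrow> m \<le> y i" using V False y unfolding m_def by auto
  show ?thesis
  proof (rule that[of "(\<Sum>i\<in>V. y i) / m"])
    show "(\<Sum>i\<in>V. y i) / m > 0" using V False y m by (intro divide_pos_pos sum_pos) auto
    fix n
    have "m * real (\<Sum>i\<in>V. \<Sum>j\<in>V. num_walks r V n i j) = (\<Sum>i\<in>V. \<Sum>j\<in>V. real (num_walks r V n i j) * m)"
      by (simp add: sum_distrib_left mult_ac)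
    also have "\<dots> \<le> (\<Sum>i\<in>V. \<Sum>j\<in>V. real (num_walks r V n i j) * y j)"
      using m by (intro sum_mono mult_left_mono) auto
    also have "\<dots> = (\<Sum>i\<in>V. ((adj_apply r V) ^^ n) y i)" using V by (simp add: num_walks_linear)
    also have "\<dots> \<le> (\<Sum>i\<in>V. l ^ n * y i)"
      using y l by (intro sum_mono adj_apply_supersolution_pow) auto
    also have "\<dots> = (\<Sum>i\<in>V. y i) * l ^ n" by (simp add: sum_distrib_right mult.commute)
    finally show "real (\<Sum>i\<in>V. \<Sum>j\<in>V. num_walks r V n i j) \<le> (\<Sum>i\<in>V. y i) / m * l ^ n"
      using m by (simp add: pos_le_divide_eq mult_ac)
  qed
qed

lemma num_walks_lower:
  assumes C: "finite C" and conn: "\<And>a b. a \<in> C \<Longrightarrow> b \<in> C \<Longrightarrow> (a, b) \<in> (r \<inter> C \<times> C)\<^sup>*"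
    and x: "\<And>i. i \<in> C \<Longrightarrow> x i > 0" "\<And>i. i \<in> C \<Longrightarrow> adj_apply r C x i = l * x i"
    and b: "b \<in> C" "b' \<in> C"
  obtains K D where "K > 0" "\<And>n. \<exists>L. n \<le> L \<and> L \<le> n + D \<and> K * l ^ n \<le> real (num_walks r C L b b')"
proof -
  have "\<forall>j\<in>C. \<exists>n. num_walks r C n j b' \<ge> 1"
    using rtrancl_num_walks[OF C] conn b by blast
  then obtain d where d: "\<And>j. j \<in> C \<Longrightarrow> num_walks r C (d j) j b' \<ge> 1" by metis
  have dD: "d j \<le> Max (d ` C)" if "j \<in> C" for j using that C by auto
  define S where "S = (\<Sum>j\<in>C. x j)"
  have S: "S > 0" unfolding S_def using C b x by (intro sum_pos) auto
  show thesis
  proof (rule that[of "x b / S" "Max (d ` C)"])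
    show "x b / S > 0" using x b S by simp
    fix n
    have "\<exists>j\<in>C. x b / S * l ^ n \<le> real (num_walks r C n b j)"
    proof (rule ccontr)
      assume "\<not> ?thesis"
      then have lt: "real (num_walks r C n b j) < x b / S * l ^ n" if "j \<in> C" for j using that by force
      have "l ^ n * x b = (\<Sum>j\<in>C. real (num_walks r C n b j) * x j)"
        using adj_apply_eigen_pow[of C r x l b n] x b num_walks_linear[OF C b(1), of n r x] by simp
      also have "\<dots> < (\<Sum>j\<in>C. (x b / S * l ^ n) * x j)"
        using C b lt x by (intro sum_strict_mono mult_strict_right_mono) auto
      also have "\<dots> = (x b / S * l ^ n) * S" unfolding S_def by (rule sum_distrib_left[symmetric])
      also have "\<dots> = l ^ n * x b" using S by simp
      finally show False by simp
    qed
    then obtain j where j: "j \<in> C" "x b / S * l ^ n \<le> real (num_walks r C n b j)" by blast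
    have "num_walks r C n b j * 1 \<le> num_walks r C n b j * num_walks r C (d j) j b'"
      using d[OF j(1)] by (intro mult_left_mono) auto
    also have "\<dots> \<le> num_walks r C (n + d j) b b'" by (rule num_walks_add) (use C b j in auto)
    finally have "real (num_walks r C n b j) \<le> num_walks r C (n + d j) b b'" by simp
    then show "\<exists>L. n \<le> L \<and> L \<le> n + Max (d ` C) \<and> x b / S * l ^ n \<le> real (num_walks r C L b b')"
      using j dD[OF j(1)] by (intro exI[of _ "n + d j"]) auto
  qed
qed

section \<open>Perron eigenvalues and Perron numbers\<close>

lemma rat_poly_dvd_of_common_root:
  fixes x :: "'a :: field_char_0"
  assumes m: "Factorial_Ring.irreducible (m :: rat poly)"
    and x: "poly (map_poly of_rat m) x = 0" "poly (map_poly of_rat g) x = 0"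
  shows "m dvd g"
proof -
  interpret h: map_poly_comm_ring_hom "of_rat :: rat \<Rightarrow> 'a" ..
  define Q where "Q d \<longleftrightarrow> d \<noteq> 0 \<and> poly (map_poly of_rat d) x = 0" for d
  define d where "d = arg_min degree Q"
  have "Q m" using m x by (auto simp: Q_def)
  then have d: "Q d" "\<And>e. Q e \<Longrightarrow> degree d \<le> degree e"
    unfolding d_def by (auto intro: arg_min_natI arg_min_nat_le)
  have dvd: "d dvd e" if "poly (map_poly of_rat e) x = 0" for e
  proof (rule ccontr)
    assume "\<not> d dvd e"
    then have nz: "e mod d \<noteq> 0" by (simp add: dvd_eq_mod_eq_0)
    have "map_poly of_rat e = map_poly of_rat (e div d) * map_poly of_rat d + map_poly (of_rat :: rat \<Rightarrow> 'a) (e mod d)"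
      by (simp flip: h.hom_mult h.hom_add)
    then have "poly (map_poly of_rat (e mod d)) x = 0" using that d by (simp add: Q_def)
    then have "degree d \<le> degree (e mod d)" using d nz by (simp add: Q_def)
    moreover have "degree (e mod d) < degree d" using degree_mod_less'[of d e] d nz by (simp add: Q_def)
    ultimately show False by simp
  qed
  have "\<not> d dvd 1"
  proof
    assume "d dvd 1"
    then obtain e where "1 = d * e" by (rule dvdE)
    then have "poly (map_poly of_rat (d * e)) x = 1" by (metis h.hom_one poly_1)
    then show False using d by (simp add: h.hom_mult Q_def)
  qed
  then have "m dvd d" using dvd[OF x(1)] m Factorial_Ring.irreducibleD' by blast
  then show ?thesis using dvd[OF x(2)] by (rule dvd_trans)
qed

lemma cmod_diff_real_eq:
  assumes "cmod (z - of_real b) \<le> cmod z - b" "b > 0"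
  shows "z = of_real (cmod z)"
proof -
  have "0 \<le> cmod z - b" using assms(1) norm_ge_zero order_trans by blast
  then have "(cmod (z - of_real b))\<^sup>2 \<le> (cmod z - b)\<^sup>2" using assms by (intro power_mono) auto
  then have "b * cmod z \<le> b * Re z"
    by (simp add: cmod_power2[of "z - of_real b"] cmod_power2[of z] power2_diff mult_ac)
  then have re: "Re z = cmod z" using assms(2) complex_Re_le_cmod[of z] by (intro antisym) auto
  then have "Im z = 0" using cmod_power2[of z] by simp
  then show ?thesis using re by (simp add: complex_eq_iff)
qed

lemma nonneg_matrix_eigenvalue:
  fixes B :: "'a \<Rightarrow> 'a \<Rightarrow> real" and v :: "'a \<Rightarrow> complex"
  assumes I: "finite I" and B: "\<And>i j. B i j \<ge> 0" "\<And>i. i \<in> I \<Longrightarrow> B i i > 0"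
    and w: "\<And>i. i \<in> I \<Longrightarrow> w i > 0" "\<And>j. j \<in> I \<Longrightarrow> (\<Sum>i\<in>I. w i * B i j) = L * w j"
    and v: "\<And>i. i \<in> I \<Longrightarrow> (\<Sum>j\<in>I. of_real (B i j) * v j) = z * v i" "k \<in> I" "v k \<noteq> 0"
  shows "z = of_real L \<or> cmod z < L"
proof -
  define u where "u i = cmod (v i)" for i
  have le: "cmod z * u i \<le> (\<Sum>j\<in>I. B i j * u j)" if "i \<in> I" for i
  proof -
    have "cmod z * u i = cmod (\<Sum>j\<in>I. of_real (B i j) * v j)"
      using v(1)[OF that] by (simp add: u_def norm_mult)
    also have "\<dots> \<le> (\<Sum>j\<in>I. cmod (of_real (B i j) * v j))" by (rule norm_sum)
    finally show ?thesis using B by (simp add: norm_mult u_def)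
  qed
  define W where "W = (\<Sum>i\<in>I. w i * u i)"
  have "0 < w k * u k" using v w by (simp add: u_def)
  also have "\<dots> \<le> W" unfolding W_def using I v w by (intro member_le_sum) (auto simp: u_def less_imp_le)
  finally have W: "W > 0" .
  have "(\<Sum>i\<in>I. w i * (\<Sum>j\<in>I. B i j * u j)) = (\<Sum>i\<in>I. \<Sum>j\<in>I. w i * B i j * u j)"
    by (simp add: sum_distrib_left mult_ac)
  also have "\<dots> = (\<Sum>j\<in>I. \<Sum>i\<in>I. w i * B i j * u j)" by (rule sum.swap)
  also have "\<dots> = (\<Sum>j\<in>I. L * w j * u j)" using w(2) by (simp flip: sum_distrib_right)
  also have "\<dots> = L * W" by (simp add: W_def sum_distrib_left mult_ac)
  finally have LW: "(\<Sum>i\<in>I. w i * (\<Sum>j\<in>I. B i j * u j)) = L * W" .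
  have zW: "(\<Sum>i\<in>I. w i * (cmod z * u i)) = cmod z * W"
    by (simp add: W_def sum_distrib_left mult_ac)
  have "cmod z * W \<le> L * W"
    unfolding LW[symmetric] zW[symmetric] using le w by (intro sum_mono mult_left_mono) (auto simp: less_imp_le)
  then have zL: "cmod z \<le> L" using W by simp
  show ?thesis
  proof (cases "cmod z < L")
    case False
    then have zL: "cmod z = L" using zL by simp
    have "(\<Sum>i\<in>I. w i * ((\<Sum>j\<in>I. B i j * u j) - cmod z * u i)) = 0"
      using LW zW zL by (simp add: right_diff_distrib sum_subtractf)
    then have "w k * ((\<Sum>j\<in>I. B k j * u j) - cmod z * u k) = 0"
      by (subst (asm) sum_nonneg_eq_0_iff) (use I w le v in \<open>auto simp: less_imp_le\<close>)
    then have eq: "(\<Sum>j\<in>I. B k j * u j) = cmod z * u k" using w v by force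
    have "cmod (z - of_real (B k k)) * u k = cmod (\<Sum>j\<in>I - {k}. of_real (B k j) * v j)"
    proof -
      have "(\<Sum>j\<in>I - {k}. of_real (B k j) * v j) = (z - of_real (B k k)) * v k"
        using v(1)[OF v(2)] I v(2) by (simp add: sum.remove algebra_simps)
      then show ?thesis by (simp add: norm_mult u_def)
    qed
    also have "\<dots> \<le> (\<Sum>j\<in>I - {k}. cmod (of_real (B k j) * v j))" by (rule norm_sum)
    also have "\<dots> = (\<Sum>j\<in>I - {k}. B k j * u j)" using B by (simp add: norm_mult u_def)
    also have "\<dots> = (cmod z - B k k) * u k" using eq I v(2) by (simp add: sum.remove algebra_simps)
    finally have "cmod (z - of_real (B k k)) \<le> cmod z - B k k" using v by (simp add: u_def)
    from cmod_diff_real_eq[OF this B(2)[OF v(2)]] zL show ?thesis by simp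
  qed simp
qed

lemma perron_number_of_matrix:
  fixes B :: "'a \<Rightarrow> 'a \<Rightarrow> nat"
  assumes I: "finite I" "I \<noteq> {}" and B: "\<And>i. i \<in> I \<Longrightarrow> B i i > 0"
    and w: "\<And>i. i \<in> I \<Longrightarrow> w i > 0" "\<And>j. j \<in> I \<Longrightarrow> (\<Sum>i\<in>I. w i * real (B i j)) = L * w j"
    and x: "\<And>i. i \<in> I \<Longrightarrow> x i > 0" "\<And>i. i \<in> I \<Longrightarrow> (\<Sum>j\<in>I. real (B i j) * x j) = L * x i"
    and L: "L \<ge> 1"
  shows "perron_number L"
proof -
  define n where "n = card I"
  obtain c where c: "bij_betw c {0..<n} I" using ex_bij_betw_nat_finite[OF I(1)] n_def by auto
  have cI: "i < n \<Longrightarrow> c i \<in> I" for i using c by (auto simp: bij_betw_def)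
  have sumc: "(\<Sum>j\<in>I. f j) = (\<Sum>j\<in>{0..<n}. f (c j))" for f :: "'a \<Rightarrow> 'b :: comm_monoid_add"
    using sum.reindex_bij_betw[OF c, of f] by simp
  define M where "M = mat n n (\<lambda>(i, j). int (B (c i) (c j)))"
  have M: "M \<in> carrier_mat n n" by (simp add: M_def)
  define p where "p = char_poly M"
  have p1: "lead_coeff p = 1" using degree_monic_char_poly[OF M] by (simp add: p_def)
  let ?Mc = "map_mat of_int M :: complex mat"
  have Mc: "?Mc \<in> carrier_mat n n" using M by simp
  have charc: "char_poly ?Mc = map_poly of_int p"
    unfolding p_def by (rule of_int_hom.char_poly_hom[OF M])
  have n: "n > 0" using I by (simp add: n_def card_gt_0_iff)
  have Mv: "(?Mc *\<^sub>v v) $ i = (\<Sum>j\<in>{0..<n}. of_nat (B (c i) (c j)) * v $ j)"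
    if "i < n" "v \<in> carrier_vec n" for i and v :: "complex vec"
    using that by (auto simp: M_def mult_mat_vec_def scalar_prod_def intro!: sum.cong)
  have "eigenvector ?Mc (vec n (\<lambda>i. of_real (x (c i)))) (of_real L)"
    unfolding eigenvector_def
  proof (intro conjI)
    show "vec n (\<lambda>i. complex_of_real (x (c i))) \<noteq> 0\<^sub>v (dim_row ?Mc)"
    proof
      assume "vec n (\<lambda>i. complex_of_real (x (c i))) = 0\<^sub>v (dim_row ?Mc)"
      then have "vec n (\<lambda>i. complex_of_real (x (c i))) $ 0 = 0" using n M by (simp add: M_def)
      then show False using x(1)[OF cI[OF n]] n by simp
    qed
    show "?Mc *\<^sub>v vec n (\<lambda>i. complex_of_real (x (c i))) = of_real L \<cdot>\<^sub>v vec n (\<lambda>i. of_real (x (c i)))"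
    proof (rule eq_vecI)
      fix i assume "i < dim_vec (complex_of_real L \<cdot>\<^sub>v vec n (\<lambda>i. complex_of_real (x (c i))))"
      then have i: "i < n" by simp
      have "(?Mc *\<^sub>v vec n (\<lambda>i. complex_of_real (x (c i)))) $ i
          = (\<Sum>j\<in>{0..<n}. of_nat (B (c i) (c j)) * complex_of_real (x (c j)))"
        using i by (subst Mv) auto
      also have "\<dots> = complex_of_real (\<Sum>j\<in>I. real (B (c i) j) * x j)"
        unfolding sumc by simp
      finally show "(?Mc *\<^sub>v vec n (\<lambda>i. complex_of_real (x (c i)))) $ i
           = (complex_of_real L \<cdot>\<^sub>v vec n (\<lambda>i. complex_of_real (x (c i)))) $ i"
        using i x(2)[OF cI[OF i]] by simp
    qed (use M in auto)
  qed (use M in auto)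
  then have rootL: "poly (map_poly of_int p) (complex_of_real L) = 0"
    using eigenvalue_root_char_poly[OF Mc] charc unfolding eigenvalue_def by auto
  have "algebraic_int (complex_of_real L)"
    using rootL p1 algebraic_int_altdef_ipoly by blast
  then have "algebraic_int L" by simp
  moreover have "cmod z < \<bar>L\<bar>" if conj: "algebraic_conjugate (of_real L) z" "z \<noteq> of_real L" for z
  proof -
    obtain m where m: "Factorial_Ring.irreducible m" "poly (map_poly of_rat m) (complex_of_real L) = 0"
       "poly (map_poly of_rat m) z = 0"
      using conj(1) unfolding algebraic_conjugate_def is_minimal_poly_def by blast
    have pq: "map_poly of_rat (map_poly of_int p :: rat poly) = (map_poly of_int p :: complex poly)"
      by (simp add: map_poly_map_poly o_def)
    have "m dvd map_poly of_int p"
      by (rule rat_poly_dvd_of_common_root[OF m(1,2)]) (simp add: pq rootL)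
    then obtain q where "map_poly of_int p = m * q" by auto
    interpret h: map_poly_comm_ring_hom "of_rat :: rat \<Rightarrow> complex" ..
    have "poly (map_poly of_int p) z = 0"
      unfolding pq[symmetric] \<open>map_poly of_int p = m * q\<close> using m by (simp add: h.hom_mult)
    then have "eigenvalue ?Mc z" using eigenvalue_root_char_poly[OF Mc] charc by simp
    then obtain v where v: "v \<in> carrier_vec n" "v \<noteq> 0\<^sub>v n" "?Mc *\<^sub>v v = z \<cdot>\<^sub>v v"
      unfolding eigenvalue_def eigenvector_def using M by auto
    then obtain k where k: "k < n" "v $ k \<noteq> 0" by force
    have "z = of_real L \<or> cmod z < L"
    proof (rule nonneg_matrix_eigenvalue[where I = "{0..<n}" and B = "\<lambda>i j. real (B (c i) (c j))"
          and w = "\<lambda>i. w (c i)" and v = "\<lambda>i. v $ i" and k = k])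
      show "finite {0..<n}" by simp
      show "\<And>i j. 0 \<le> real (B (c i) (c j))" by simp
      show "\<And>i. i \<in> {0..<n} \<Longrightarrow> 0 < real (B (c i) (c i))" using B cI by simp
      show "\<And>i. i \<in> {0..<n} \<Longrightarrow> 0 < w (c i)" using w cI by simp
      show "(\<Sum>i\<in>{0..<n}. w (c i) * real (B (c i) (c j))) = L * w (c j)" if "j \<in> {0..<n}" for j
        using w(2)[of "c j"] cI that by (simp add: sumc)
      show "(\<Sum>j\<in>{0..<n}. complex_of_real (real (B (c i) (c j))) * v $ j) = z * v $ i" if "i \<in> {0..<n}" for i
        using Mv[of i v] v that by simp
      show "k \<in> {0..<n}" "v $ k \<noteq> 0" using k by auto
    qed
    then show ?thesis using conj L by auto
  qed
  ultimately show ?thesis using L by (simp add: perron_number_def)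
qed

lemma num_walks_left_eigen:
  assumes C: "finite C" and w: "\<And>j. j \<in> C \<Longrightarrow> adj_apply (r\<inverse>) C w j = l * w j" and j: "j \<in> C"
  shows "(\<Sum>i\<in>C. w i * real (num_walks r C n i j)) = l ^ n * w j"
proof (induction n)
  case 0
  have "(\<Sum>i\<in>C. w i * real (num_walks r C 0 i j)) = (\<Sum>i\<in>C. if i = j then w i else 0)"
    by (rule sum.cong) auto
  then show ?case using C j by simp
next
  case (Suc n)
  let ?N = "\<lambda>k. real (num_walks r C n k j)"
  have "(\<Sum>i\<in>C. w i * real (num_walks r C (Suc n) i j)) = (\<Sum>i\<in>C. \<Sum>k\<in>{k\<in>C. (i, k) \<in> r}. w i * ?N k)"
    by (simp add: sum_distrib_left)
  also have "\<dots> = (\<Sum>i\<in>C. \<Sum>k\<in>C. if (i, k) \<in> r then w i * ?N k else 0)"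
    using C by (simp add: sum.inter_filter)
  also have "\<dots> = (\<Sum>k\<in>C. \<Sum>i\<in>C. if (i, k) \<in> r then w i * ?N k else 0)" by (rule sum.swap)
  also have "\<dots> = (\<Sum>k\<in>C. adj_apply (r\<inverse>) C w k * ?N k)"
    using C by (simp add: adj_apply_def sum_distrib_right sum.inter_filter)
      (intro sum.cong, auto)
  also have "\<dots> = (\<Sum>k\<in>C. l * (w k * ?N k))" using w by (simp add: mult_ac)
  also have "\<dots> = l * (l ^ n * w j)" using Suc by (simp flip: sum_distrib_left)
  finally show ?case by simp
qed

lemma num_walks_repeat:
  assumes "finite C" "i \<in> C" "num_walks r C n i i \<ge> 1"
  shows "num_walks r C (m * n) i i \<ge> 1"
proof (induction m)
  case (Suc m)
  have "1 * 1 \<le> num_walks r C n i i * num_walks r C (m * n) i i"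
    using assms Suc by (intro mult_le_mono) auto
  also have "\<dots> \<le> num_walks r C (n + m * n) i i" by (rule num_walks_add) (use assms in auto)
  finally show ?case by simp
qed simp

lemma component_eigenvalue_perron:
  assumes C: "finite C" "C \<noteq> {}" and conn: "\<And>a b. a \<in> C \<Longrightarrow> b \<in> C \<Longrightarrow> (a, b) \<in> (r \<inter> C \<times> C)\<^sup>*"
    and x: "\<And>i. i \<in> C \<Longrightarrow> x i > 0" "\<And>i. i \<in> C \<Longrightarrow> adj_apply r C x i = l * x i" and l: "l \<ge> 1"
  obtains p where "p \<ge> 1" "perron_number (l ^ p)"
proof -
  have conn': "(a, b) \<in> (r\<inverse> \<inter> C \<times> C)\<^sup>*" if "a \<in> C" "b \<in> C" for a b
  proof -
    have "(a, b) \<in> ((r \<inter> C \<times> C)\<inverse>)\<^sup>*" using conn[OF that(2,1)] by (simp add: rtrancl_converse)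
    moreover have "(r \<inter> C \<times> C)\<inverse> = r\<inverse> \<inter> C \<times> C" by auto
    ultimately show ?thesis by simp
  qed
  obtain l' w where w: "l' \<ge> 0" "\<And>i. i \<in> C \<Longrightarrow> w i > 0" "\<And>j. j \<in> C \<Longrightarrow> adj_apply (r\<inverse>) C w j = l' * w j"
    using perron_frobenius[OF C conn'] by metis
  have "l' * (\<Sum>j\<in>C. w j * x j) = (\<Sum>j\<in>C. l' ^ 1 * w j * x j)" by (simp add: sum_distrib_left mult_ac)
  also have "\<dots> = (\<Sum>j\<in>C. \<Sum>i\<in>C. w i * real (num_walks r C 1 i j) * x j)"
    by (intro sum.cong refl, subst num_walks_left_eigen[OF C(1) w(3), symmetric]) (auto simp: sum_distrib_right)
  also have "\<dots> = (\<Sum>i\<in>C. \<Sum>j\<in>C. w i * real (num_walks r C 1 i j) * x j)" by (rule sum.swap)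
  also have "\<dots> = (\<Sum>i\<in>C. w i * (\<Sum>j\<in>C. real (num_walks r C 1 i j) * x j))"
    by (simp add: sum_distrib_left mult_ac)
  also have "\<dots> = (\<Sum>i\<in>C. w i * (l ^ 1 * x i))"
    using num_walks_linear[OF C(1), of _ 1 r x] adj_apply_eigen_pow[of C r x l _ 1] x by simp
  also have "\<dots> = l * (\<Sum>i\<in>C. w i * x i)" by (simp add: sum_distrib_left mult_ac)
  finally have "l' * (\<Sum>j\<in>C. w j * x j) = l * (\<Sum>i\<in>C. w i * x i)" .
  moreover have "(\<Sum>i\<in>C. w i * x i) > 0" using C w x by (intro sum_pos) auto
  ultimately have ll: "l' = l" by simp
  have "\<exists>n. n \<ge> 1 \<and> num_walks r C n i i \<ge> 1" if i: "i \<in> C" for i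
  proof -
    have "adj_apply r C x i > 0" using x i l by simp
    then have "{k\<in>C. (i, k) \<in> r} \<noteq> {}" unfolding adj_apply_def by force
    then obtain k where k: "k \<in> C" "(i, k) \<in> r" by auto
    obtain n where n: "num_walks r C n k i \<ge> 1" using rtrancl_num_walks[OF C(1) k(1) conn[OF k(1) i]] by auto
    have "num_walks r C n k i \<le> num_walks r C (Suc n) i i"
      unfolding num_walks.simps by (rule member_le_sum) (use k C in auto)
    then show ?thesis using n by (intro exI[of _ "Suc n"]) linarith
  qed
  then obtain d where d: "\<And>i. i \<in> C \<Longrightarrow> d i \<ge> 1 \<and> num_walks r C (d i) i i \<ge> 1" by metis
  define p where "p = prod d C"
  have p1: "p \<ge> 1" unfolding p_def using d by (intro prod_ge_1) auto
  have diag: "num_walks r C p i i > 0" if "i \<in> C" for i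
  proof -
    have "d i dvd p" unfolding p_def using C that by (intro dvd_prodI) auto
    then obtain m where "p = m * d i" by (metis dvdE mult.commute)
    then show ?thesis using num_walks_repeat[OF C(1) that, of r "d i" m] d[OF that] by simp
  qed
  have "perron_number (l ^ p)"
  proof (rule perron_number_of_matrix[OF C diag w(2)])
    show "(\<Sum>i\<in>C. w i * real (num_walks r C p i j)) = l ^ p * w j" if "j \<in> C" for j
      using num_walks_left_eigen[OF C(1) w(3) that] ll by simp
    show "(\<Sum>j\<in>C. real (num_walks r C p i j) * x j) = l ^ p * x i" if "i \<in> C" for i
      using num_walks_linear[OF C(1) that, of p r x] adj_apply_eigen_pow[of C r x l i p] x that by simp
  qed (use x l in auto)
  then show thesis using that p1 by blast
qed

section \<open>Lind's theorem\<close>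

lemma rat_poly_common_denominator:
  obtains a :: int and M where "a > 0" "Polynomial.smult (of_int a) (m :: rat poly) = map_poly of_int M"
proof -
  have "\<exists>a M. a > 0 \<and> Polynomial.smult (of_int a) m = map_poly of_int M"
  proof (induction m rule: pCons_induct)
    case 0
    show ?case by (rule exI[of _ 1], rule exI[of _ 0]) simp
  next
    case (pCons c m)
    then obtain a M where aM: "a > 0" "Polynomial.smult (of_int a) m = map_poly of_int M" by auto
    obtain n d :: int where c: "c = of_int n / of_int d" "d > 0" by (metis quotient_of_div quotient_of_denom_pos surj_pair)
    have eq: "Polynomial.smult (of_int (d * a)) (pCons c m) = map_poly of_int (pCons (n * a) (Polynomial.smult d M))"
    proof -
      have "of_int a * coeff m i = of_int (coeff M i)" for i
        using arg_cong[OF aM(2), of "\<lambda>p. coeff p i"] by (simp add: coeff_map_poly)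
      then show ?thesis using c
        by (intro poly_eqI) (simp add: coeff_map_poly coeff_pCons mult.assoc split: nat.split)
    qed
    show ?case by (rule exI[of _ "d * a"], rule exI[of _ "pCons (n * a) (Polynomial.smult d M)"])
       (use eq aM(1) c(2) in simp)
  qed
  then show thesis using that by blast
qed

lemma monic_rat_factor_of_monic_int:
  assumes m: "lead_coeff (m :: rat poly) = 1" and dvd: "m dvd map_poly of_int g" and g: "lead_coeff (g :: int poly) = 1"
  obtains f where "m = map_poly of_int f"
proof -
  obtain q where q: "map_poly of_int g = m * q" using dvd by (rule dvdE)
  have "lead_coeff (map_poly of_int g :: rat poly) = 1" using g by simp
  then have q1: "lead_coeff q = 1" using q m by (simp add: lead_coeff_mult)
  obtain a M where M: "a > 0" "Polynomial.smult (of_int a) m = map_poly of_int M" by (rule rat_poly_common_denominator)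
  obtain b Q where Q: "b > 0" "Polynomial.smult (of_int b) q = map_poly of_int Q" by (rule rat_poly_common_denominator)
  have lM: "lead_coeff M = a" using arg_cong[OF M(2), of lead_coeff] m M(1) by simp
  have lQ: "lead_coeff Q = b" using arg_cong[OF Q(2), of lead_coeff] q1 Q(1) by simp
  have "map_poly rat_of_int (M * Q) = map_poly of_int (Polynomial.smult (a * b) g)"
  proof -
    have "map_poly rat_of_int (M * Q) = Polynomial.smult (of_int a) m * Polynomial.smult (of_int b) q"
      unfolding M(2) Q(2) by (rule of_int_poly_hom.hom_mult)
    also have "\<dots> = Polynomial.smult (of_int (a * b)) (map_poly of_int g)" unfolding q by (simp add: mult.commute[of "rat_of_int a"])
    also have "\<dots> = map_poly of_int (Polynomial.smult (a * b) g)" by (rule poly_eqI) (simp add: coeff_map_poly)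
    finally show ?thesis .
  qed
  then have MQ: "M * Q = Polynomial.smult (a * b) g"
    by (metis of_int_poly_hom.eq_iff)
  have cg: "content g = 1" using content_dvd_coeff[of g "degree g"] g
    by (metis abs_1 is_unit_normalize normalize_content)
  have "content M * content Q = a * b"
    using arg_cong[OF MQ, of content] M Q cg by (simp add: content_mult abs_mult)
  moreover have "content M dvd a" "content Q dvd b" using lM lQ content_dvd_coeff by metis+
  moreover obtain u v where uv: "a = content M * u" "b = content Q * v"
    using calculation by (metis dvdE)
  ultimately have "content M * content Q * (u * v) = content M * content Q * 1"
    by (simp add: mult_ac)
  then have "u * v = 1" using uv M(1) Q(1) by auto
  moreover have "u > 0"
    using uv(1) M(1) normalize_content[of M] by (metis abs_ge_zero normalize_int_def zero_less_mult_pos2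
      mult.commute mult_eq_0_iff order_le_less zero_less_mult_pos)
  ultimately have "content M = a" using uv(1) by (simp add: pos_zmult_eq_1_iff)
  then have "M = Polynomial.smult a (primitive_part M)" by (metis content_times_primitive_part)
  then have "Polynomial.smult (of_int a) m = Polynomial.smult (of_int a) (map_poly of_int (primitive_part M))"
    using M(2) by (metis of_int_hom.map_poly_hom_smult)
  then have eq: "of_int a * coeff m i = of_int a * coeff (map_poly of_int (primitive_part M)) i" for i
    by (metis coeff_smult)
  have "m = map_poly of_int (primitive_part M)"
    by (rule poly_eqI) (use eq M(1) in simp)
  then show thesis by (rule that)
qed

lemma perron_number_int_poly:
  assumes "perron_number L"
  obtains f :: "int poly" where "lead_coeff f = 1" "poly (map_poly of_int f) (complex_of_real L) = 0"
    "card {z. poly (map_poly of_int f) z = (0 :: complex)} = degree f"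
    "\<And>z. poly (map_poly of_int f) z = 0 \<Longrightarrow> z \<noteq> of_real L \<Longrightarrow> cmod z < L"
proof -
  let ?L = "complex_of_real L"
  have "algebraic_int ?L" and L1: "L \<ge> 1" using assms by (auto simp: perron_number_def)
  then obtain g :: "int poly" where g: "poly (map_poly of_int g) ?L = 0" "lead_coeff g = 1"
    unfolding algebraic_int_altdef_ipoly by blast
  interpret h: map_poly_comm_ring_hom "of_rat :: rat \<Rightarrow> complex" ..
  have comp: "map_poly of_rat (map_poly of_int p :: rat poly) = (map_poly of_int p :: complex poly)" for p
    by (simp add: map_poly_map_poly o_def)
  define Q where "Q d \<longleftrightarrow> lead_coeff d = 1 \<and> poly (map_poly of_rat d) ?L = 0" for d :: "rat poly"
  define m where "m = arg_min degree Q"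
  have "Q (map_poly of_int g)" using g by (simp add: Q_def comp)
  then have m: "Q m" "\<And>e. Q e \<Longrightarrow> degree m \<le> degree e"
    unfolding m_def by (auto intro: arg_min_natI arg_min_nat_le)
  have m0: "m \<noteq> 0" using m by (auto simp: Q_def)
  have minimal: "degree m \<le> degree e" if "e \<noteq> 0" "poly (map_poly of_rat e) ?L = 0" for e
  proof -
    have "map_poly of_rat (Polynomial.smult (inverse (lead_coeff e)) e) = Polynomial.smult (of_rat (inverse (lead_coeff e))) (map_poly (of_rat :: rat \<Rightarrow> complex) e)"
      by (rule poly_eqI) (simp add: coeff_map_poly of_rat_mult)
    then have "Q (Polynomial.smult (inverse (lead_coeff e)) e)" using that by (simp add: Q_def)
    from m(2)[OF this] show ?thesis using that by simp
  qed
  have irr: "Factorial_Ring.irreducible m"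
  proof (rule irreducibleI)
    show "\<not> m dvd 1"
    proof
      assume "m dvd 1"
      then obtain e where "1 = m * e" by (rule dvdE)
      then have "poly (map_poly of_rat (m * e)) ?L = 1" by (metis h.hom_one poly_1)
      then show False using m by (simp add: h.hom_mult Q_def)
    qed
    have half: "b dvd 1" if "m = a * b" "poly (map_poly of_rat a) ?L = 0" for a b
    proof -
      have ab: "a \<noteq> 0" "b \<noteq> 0" using m0 that by auto
      then have "degree a + degree b \<le> degree a" using minimal[OF ab(1) that(2)] that(1) by (simp add: degree_mult_eq)
      then show ?thesis using ab by (simp add: is_unit_iff_degree)
    qed
    fix a b assume ab: "m = a * b"
    then have "poly (map_poly of_rat a) ?L = 0 \<or> poly (map_poly of_rat b) ?L = 0"
      using m(1) by (simp add: Q_def h.hom_mult)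
    then show "a dvd 1 \<or> b dvd 1" using half[of a b] half[of b a] ab by (auto simp: mult.commute)
  qed (use m0 in auto)
  have "m dvd map_poly of_int g"
    by (rule rat_poly_dvd_of_common_root[OF irr]) (use m g in \<open>auto simp: Q_def comp\<close>)
  then obtain f where f: "m = map_poly of_int f"
    using monic_rat_factor_of_monic_int m g by (metis Q_def)
  have fC: "map_poly of_int f = (map_poly of_rat m :: complex poly)" by (simp add: f comp)
  have f1: "lead_coeff f = 1" using m(1) by (simp add: f Q_def)
  have degm: "degree m > 0" using irr m0 by (auto simp: is_unit_iff_degree[OF m0] Factorial_Ring.irreducible_def)
  have "rsquarefree (map_poly of_int f :: complex poly)"
    unfolding rsquarefree_roots
  proof (intro allI notI)
    fix a :: complex assume "poly (map_poly of_int f) a = 0 \<and> poly (pderiv (map_poly of_int f)) a = 0"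
    moreover have "pderiv (map_poly of_int f) = (map_poly of_rat (pderiv m) :: complex poly)"
      unfolding fC by (rule poly_eqI) (simp add: coeff_pderiv coeff_map_poly of_rat_mult of_rat_add)
    ultimately have "m dvd pderiv m"
      by (intro rat_poly_dvd_of_common_root[OF irr, of a]) (auto simp: fC)
    then show False using degm m0 using dvd_imp_degree_le[of m "pderiv m"] by (simp add: degree_pderiv pderiv_eq_0_iff)
  qed
  from complex_poly_decompose_rsquarefree[OF this]
  have dec: "(\<Prod>z|poly (map_poly of_int f) z = (0 :: complex). [:-z, 1:]) = map_poly of_int f"
    using f1 by simp
  have "degree (\<Prod>z|poly (map_poly of_int f) z = (0 :: complex). [:-z, 1:]) = card {z. poly (map_poly of_int f) z = (0 :: complex)}"
    by (subst degree_prod_eq_sum_degree) auto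
  then have card: "card {z. poly (map_poly of_int f) z = (0 :: complex)} = degree f" unfolding dec by simp
  have min: "is_minimal_poly m ?L" using m irr by (simp add: is_minimal_poly_def Q_def)
  show thesis
  proof (rule that[OF f1 _ card])
    show "poly (map_poly of_int f) ?L = 0" using m by (simp add: fC Q_def)
    fix z assume z: "poly (map_poly of_int f) z = 0" "z \<noteq> ?L"
    then have "algebraic_conjugate ?L z" using min fC unfolding algebraic_conjugate_def by auto
    then show "cmod z < L" using assms z L1 by (auto simp: perron_number_def)
  qed
qed

lemma coeff_bound_of_values:
  assumes Z: "finite (Z :: complex set)"
  obtains K where "\<And>p i. degree p < card Z \<Longrightarrow> (\<And>z. z \<in> Z \<Longrightarrow> cmod (poly p z) \<le> R) \<Longrightarrow> cmod (coeff p i) \<le> K i"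
proof -
  define l where "l z = Polynomial.smult (1 / (\<Prod>y\<in>Z - {z}. z - y)) (\<Prod>y\<in>Z - {z}. [:-y, 1:])" for z
  have lz: "poly (l z) y = of_bool (y = z)" if "z \<in> Z" "y \<in> Z" for z y
    using that Z by (auto simp: l_def poly_prod)
  have ldeg: "degree (l z) < card Z" if "z \<in> Z" for z
  proof -
    have "degree (l z) \<le> degree (\<Prod>y\<in>Z - {z}. [:-y, 1:])" unfolding l_def by (rule degree_smult_le)
    also have "\<dots> = card (Z - {z})" by (subst degree_prod_eq_sum_degree) auto
    also have "\<dots> < card Z" using that Z by (intro psubset_card_mono) auto
    finally show ?thesis .
  qed
  show thesis
  proof (rule that[of "\<lambda>i. \<Sum>z\<in>Z. R * cmod (coeff (l z) i)"])
    fix p :: "complex poly" and i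
    assume p: "degree p < card Z" "\<And>z. z \<in> Z \<Longrightarrow> cmod (poly p z) \<le> R"
    have "p = (\<Sum>z\<in>Z. Polynomial.smult (poly p z) (l z))"
    proof (rule poly_eqI_degree[of Z])
      fix x assume x: "x \<in> Z"
      have "poly (\<Sum>z\<in>Z. Polynomial.smult (poly p z) (l z)) x = (\<Sum>z\<in>Z. if z = x then poly p z else 0)"
        unfolding poly_sum by (rule sum.cong) (use lz x in auto)
      then show "poly p x = poly (\<Sum>z\<in>Z. Polynomial.smult (poly p z) (l z)) x" using Z x by simp
    next
      have "degree (\<Sum>z\<in>Z. Polynomial.smult (poly p z) (l z)) \<le> card Z - 1"
        by (rule degree_sum_le[OF Z]) (use ldeg in \<open>fastforce intro: order_trans[OF degree_smult_le]\<close>)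
      then show "degree (\<Sum>z\<in>Z. Polynomial.smult (poly p z) (l z)) < card Z" using p(1) by linarith
    qed (use p in auto)
    then have "coeff p i = (\<Sum>z\<in>Z. poly p z * coeff (l z) i)"
      by (metis (no_types, lifting) coeff_smult coeff_sum sum.cong)
    also have "cmod \<dots> \<le> (\<Sum>z\<in>Z. cmod (poly p z * coeff (l z) i))" by (rule norm_sum)
    also have "\<dots> \<le> (\<Sum>z\<in>Z. R * cmod (coeff (l z) i))"
      unfolding norm_mult by (intro sum_mono mult_right_mono p) auto
    finally show "cmod (coeff p i) \<le> (\<Sum>z\<in>Z. R * cmod (coeff (l z) i))" .
  qed
qed

lemma finite_int_polys_bounded_values:
  assumes Z: "finite (Z :: complex set)"
  shows "finite {p :: int poly. degree p < card Z \<and> (\<forall>z\<in>Z. cmod (poly (map_poly of_int p) z) \<le> R)}" (is "finite ?S")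
proof -
  obtain K where K: "\<And>p i. degree p < card Z \<Longrightarrow> (\<And>z. z \<in> Z \<Longrightarrow> cmod (poly p z) \<le> R) \<Longrightarrow> cmod (coeff p i) \<le> K i"
    using coeff_bound_of_values[OF Z] by metis
  define M where "M = (\<Sum>i<card Z. \<lceil>\<bar>K i\<bar>\<rceil>)"
  have M: "coeff p i \<in> {-M..M}" if "p \<in> ?S" "i < card Z" for p i
  proof -
    have "cmod (coeff (map_poly of_int p) i) \<le> K i" by (rule K) (use that in auto)
    then have "\<bar>real_of_int (coeff p i)\<bar> \<le> \<bar>K i\<bar>" by (simp add: coeff_map_poly)
    then have "\<bar>coeff p i\<bar> \<le> \<lceil>\<bar>K i\<bar>\<rceil>" by linarith
    also have "\<dots> \<le> M" unfolding M_def using that by (intro member_le_sum) (auto simp: ceiling_le_zero)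
    finally show ?thesis by auto
  qed
  let ?f = "\<lambda>p :: int poly. map (coeff p) [0..<card Z]"
  have "?f ` ?S \<subseteq> {xs. set xs \<subseteq> {-M..M} \<and> length xs = card Z}" using M by auto
  then have "finite (?f ` ?S)" using finite_lists_length_eq[of "{-M..M}" "card Z"] by (auto intro: finite_subset)
  moreover have "inj_on ?f ?S"
  proof (rule inj_onI, rule poly_eqI)
    fix p q i assume pq: "p \<in> ?S" "q \<in> ?S" "?f p = ?f q"
    show "coeff p i = coeff q i"
    proof (cases "i < card Z")
      case True
      then show ?thesis using arg_cong[OF pq(3), of "\<lambda>xs. xs ! i"] by simp
    next
      case False
      then show ?thesis using pq by (simp add: coeff_eq_0)
    qed
  qed
  ultimately show ?thesis by (rule finite_imageD)
qed

lemma poly_int_degree_bound: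
  fixes p :: "int poly" and z :: complex
  assumes "\<And>i. \<bar>coeff p i\<bar> \<le> N" "degree p < n" "cmod z \<le> L" "L \<ge> 0"
  shows "cmod (poly (map_poly of_int p) z) \<le> real_of_int N * (\<Sum>i<n. L ^ i)"
proof -
  have "poly (map_poly of_int p) z = (\<Sum>i\<le>degree p. of_int (coeff p i) * z ^ i)"
    by (simp add: poly_altdef coeff_map_poly)
  also have "\<dots> = (\<Sum>i<n. of_int (coeff p i) * z ^ i)"
    using assms(2) by (intro sum.mono_neutral_left) (auto simp: coeff_eq_0)
  also have "cmod \<dots> \<le> (\<Sum>i<n. cmod (of_int (coeff p i) * z ^ i))" by (rule norm_sum)
  also have "\<dots> \<le> (\<Sum>i<n. real_of_int N * L ^ i)"
  proof (rule sum_mono)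
    fix i
    have "real_of_int \<bar>coeff p i\<bar> \<le> real_of_int N" using assms(1) of_int_le_iff by blast
    then show "cmod (of_int (coeff p i) * z ^ i) \<le> real_of_int N * L ^ i"
      unfolding norm_mult norm_power using assms by (intro mult_mono power_mono) auto
  qed
  finally show ?thesis by (simp add: sum_distrib_left)
qed

text \<open>The index set consists of the lattice points of bounded size in a cone around the dominant
  direction. Multiplication by \<open>L\<close> maps it into a narrower cone, and a long vector \<open>w\<close> of the narrower
  cone is a sum of \<open>N\<close> lattice points close to \<open>w / N\<close>, which are short and still in the cone.\<close>

lemma lind_matrix:
  assumes "perron_number L" "L > 1"
  obtains S :: "int poly set" and x :: "int poly \<Rightarrow> real" and B :: "int poly \<Rightarrow> int poly \<Rightarrow> nat"
  where "finite S" "S \<noteq> {}" "\<And>p. p \<in> S \<Longrightarrow> x p > 0"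
    "\<And>p. p \<in> S \<Longrightarrow> (\<Sum>q\<in>S. real (B p q) * x q) = L * x p"
proof -
  obtain f :: "int poly" where f: "lead_coeff f = 1" "poly (map_poly of_int f) (complex_of_real L) = 0"
    "card {z. poly (map_poly of_int f) z = (0 :: complex)} = degree f"
    "\<And>z. poly (map_poly of_int f) z = 0 \<Longrightarrow> z \<noteq> of_real L \<Longrightarrow> cmod z < L"
    using perron_number_int_poly[OF assms(1)] by metis
  define Z where "Z = {z. poly (map_poly of_int f) z = (0 :: complex)}"
  define n where "n = degree f"
  have f0: "(map_poly of_int f :: complex poly) \<noteq> 0" using f(1) by auto
  have Z: "finite Z" unfolding Z_def using f0 by (rule poly_roots_finite)
  have cZ: "card Z = n" using f by (simp add: Z_def n_def)
  have LZ: "of_real L \<in> Z" using f by (simp add: Z_def)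
  then have n0: "n > 0" using Z cZ by (metis card_gt_0_iff empty_iff)
  define Z' where "Z' = Z - {of_real L}"
  have Z': "finite Z'" "\<And>z. z \<in> Z' \<Longrightarrow> cmod z < L" "Z' \<subseteq> Z" using Z f by (auto simp: Z'_def Z_def)
  have ZL: "cmod z \<le> L" if "z \<in> Z" for z
    using Z'(2)[of z] that assms by (cases "z = of_real L") (auto simp: Z'_def)
  define \<rho> where "\<rho> = Max (insert 0 ((\<lambda>z. cmod z / L) ` Z'))"
  have \<rho>: "0 \<le> \<rho>" "\<rho> < 1" "\<And>z. z \<in> Z' \<Longrightarrow> cmod z \<le> \<rho> * L"
  proof -
    show "0 \<le> \<rho>" unfolding \<rho>_def using Z' by simp
    show "\<rho> < 1" unfolding \<rho>_def using Z' assms by (subst Max_less_iff) auto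
    fix z assume "z \<in> Z'"
    then have "cmod z / L \<le> \<rho>" unfolding \<rho>_def using Z'(1) by (intro Max_ge) auto
    then show "cmod z \<le> \<rho> * L" using assms by (simp add: divide_le_eq)
  qed
  define ev where "ev p z = poly (map_poly of_int p) z" for p :: "int poly" and z :: complex
  define er where "er p = poly (map_poly of_int p) L" for p :: "int poly"
  have evL: "ev p (of_real L) = of_real (er p)" for p
    by (simp add: ev_def er_def poly_altdef coeff_map_poly)
  have ev_add: "ev (p + q) z = ev p z + ev q z" for p q z
    unfolding ev_def by (simp add: of_int_poly_hom.hom_add)
  have ev_smult: "ev (Polynomial.smult c p) z = of_int c * ev p z" for c p z
    unfolding ev_def by (simp add: of_int_hom.map_poly_hom_smult)
  define c where "c = (\<Sum>i<n. L ^ i)"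
  have c1: "c \<ge> 1" unfolding c_def using n0 assms
    by (intro order_trans[OF _ member_le_sum[of 0]]) auto
  define N where "N = nat \<lceil>2 * L\<rceil>"
  have N: "N \<ge> 2" "2 * L \<le> real N" using assms by (simp_all add: N_def le_nat_iff le_ceiling_iff) 
  define R where "R = 2 * real N ^ 2 * c / (1 - \<rho>)"
  have R: "(1 - \<rho>) * R = 2 * real N ^ 2 * c" using \<rho> by (simp add: R_def)
  have RNc: "2 * N * c \<le> R"
  proof -
    have "2 * N * c \<le> 2 * real N ^ 2 * c" using N c1 by (simp add: power2_eq_square)
    also have "\<dots> \<le> 1 * R" unfolding R[symmetric] using \<rho> c1 by (intro mult_right_mono) (auto simp: R_def)
    finally show ?thesis by simp
  qed
  have Nc1: "real N * c \<ge> 1" using mult_mono[of 1 "real N" 1 c] N c1 by simp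
  then have R1: "R \<ge> 1" using RNc by simp
  define S where "S = {p. degree p < n \<and> 0 < er p \<and> er p \<le> R \<and> (\<forall>z\<in>Z'. cmod (ev p z) \<le> er p)}"
  have finS: "finite S"
  proof (rule finite_subset[OF _ finite_int_polys_bounded_values[OF Z, of R]])
    have "cmod (ev p z) \<le> R" if "p \<in> S" "z \<in> Z" for p z
      using that by (cases "z = of_real L") (auto simp: S_def Z'_def evL intro: order_trans)
    then show "S \<subseteq> {p. degree p < card Z \<and> (\<forall>z\<in>Z. cmod (poly (map_poly of_int p) z) \<le> R)}"
      by (auto simp: cZ ev_def[symmetric]) (auto simp: S_def)
  qed
  have "1 \<in> S" using R1 n0 by (simp add: S_def er_def ev_def)
  then have S0: "S \<noteq> {}" by auto
  have step: "\<exists>b :: int poly \<Rightarrow> nat. (\<Sum>q\<in>S. real (b q) * er q) = L * er p" if p: "p \<in> S" for p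
  proof -
    define P where "P = pCons 0 p - Polynomial.smult (coeff p (n - 1)) f"
    have degP: "degree P < n"
    proof -
      have "coeff P i = 0" if "i \<ge> n" for i
      proof (cases "i = n")
        case True
        then show ?thesis using f(1) n0 by (simp add: P_def n_def coeff_pCons split: nat.split)
      next
        case False
        then have i: "i > n" using that by simp
        moreover have "coeff p (i - 1) = 0" using p i by (intro coeff_eq_0) (auto simp: S_def)
        ultimately show ?thesis using n_def
          by (auto simp: P_def coeff_pCons coeff_eq_0 split: nat.split)
      qed
      then show ?thesis using n0 degree_lessI[of P n] by (cases "P = 0") (auto intro: degree_lessI)
    qed
    have evP: "ev P z = z * ev p z" if "z \<in> Z" for z
      using that unfolding ev_def P_def Z_def
      by (simp add: of_int_poly_hom.hom_minus of_int_hom.map_poly_hom_smult of_int_hom.map_poly_pCons_hom)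
    define w where "w = er P"
    have w: "w = L * er p"
      using evP[OF LZ] unfolding evL w_def by (simp flip: of_real_mult)
    have w0: "w > 0" using p assms by (simp add: w S_def)
    have wL: "w \<le> L * R" using p assms by (simp add: w S_def)
    have Pz: "cmod (ev P z) \<le> \<rho> * w" if "z \<in> Z'" for z
    proof -
      have "cmod (ev P z) = cmod z * cmod (ev p z)" using evP Z' that by (auto simp: norm_mult)
      also have "\<dots> \<le> (\<rho> * L) * er p" using \<rho> that p assms by (intro mult_mono) (auto simp: S_def)
      finally show ?thesis by (simp add: w)
    qed
    show ?thesis
    proof (cases "w \<le> R")
      case True
      have "\<rho> * w \<le> w" using \<rho> w0 by simp
      then have "cmod (ev P z) \<le> w" if "z \<in> Z'" for z using Pz[OF that] by linarith
      then have "P \<in> S" using degP w0 True by (simp add: S_def w_def[symmetric])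
      moreover have "(\<Sum>q\<in>S. real (of_bool (q = P)) * er q) = (\<Sum>q\<in>S. if q = P then er q else 0)"
        by (rule sum.cong) auto
      ultimately have "(\<Sum>q\<in>S. real (of_bool (q = P)) * er q) = w"
        using finS by (simp add: w_def)
      then show ?thesis using w by (intro exI[of _ "\<lambda>q. of_bool (q = P)"]) simp
    next
      case False
      define U where "U = map_poly (\<lambda>a. a div int N) P"
      define Q where "Q = map_poly (\<lambda>a. a mod int N) P"
      have cU: "coeff U i = coeff P i div int N" for i by (simp add: U_def coeff_map_poly)
      have cQ: "coeff Q i = coeff P i mod int N" for i by (simp add: Q_def coeff_map_poly)
      have PUQ: "P = Polynomial.smult (int N) U + Q" by (rule poly_eqI) (simp add: cU cQ)
      have degU: "degree U < n" using degP map_poly_degree_leq[of _ P] unfolding U_def by (metis le_less_trans)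
      have degQ: "degree Q < n" using degP map_poly_degree_leq[of _ P] unfolding Q_def by (metis le_less_trans)
      have Qb: "cmod (ev Q z) \<le> N * c" if "z \<in> Z" for z
      proof -
        have "\<bar>coeff Q i\<bar> \<le> int N" for i using N by (simp add: cQ less_imp_le)
        from poly_int_degree_bound[OF this degQ ZL[OF that]] show ?thesis using assms by (simp add: ev_def c_def)
      qed
      have Q0: "er Q \<ge> 0" unfolding er_def poly_altdef
        using assms N by (intro sum_nonneg mult_nonneg_nonneg) (auto simp: coeff_map_poly cQ)
      have QL: "er Q \<le> N * c" using Qb[OF LZ] Q0 by (simp add: evL)
      have evU: "ev U z = (ev P z - ev Q z) / of_nat N" for z
        using N arg_cong[OF PUQ, of "\<lambda>p. ev p z"] by (simp add: ev_add ev_smult field_simps)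
      have erU: "er U = (w - er Q) / N"
        using evU[of "of_real L"] unfolding evL w_def by (metis of_real_diff of_real_divide of_real_eq_iff of_real_of_nat_eq)
      define U' where "U' = U + Q"
      have evU': "ev U' z = ev P z / of_nat N + ev Q z * (1 - 1 / of_nat N)" for z
        using N unfolding U'_def ev_add evU by (simp add: diff_divide_distrib right_diff_distrib)
      have UQ: "er U' = er U + er Q" using ev_add[of U Q "of_real L"] unfolding evL U'_def
        by (metis of_real_add of_real_eq_iff)
      have NU: "real N * er U = w - er Q" using N by (simp add: erU)
      have erU': "er U' = w / N + er Q * (1 - 1 / N)"
        unfolding UQ erU by (simp add: diff_divide_distrib right_diff_distrib)
      have wR: "w > R" using False by simp
      have "(1 - \<rho>) * R < (1 - \<rho>) * w" using wR \<rho> by simp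
      then have big: "2 * real N ^ 2 * c \<le> (1 - \<rho>) * w" unfolding R by simp
      have Nc2: "N * c \<le> real N ^ 2 * c" using N c1 by (simp add: power2_eq_square)
      have half: "w / N \<le> R / 2"
      proof -
        have "w * 2 \<le> (2 * L) * R" using wL by simp
        also have "\<dots> \<le> N * R" using N R1 by (intro mult_right_mono) auto
        finally have "w * 2 \<le> N * R" .
        then show ?thesis using N by (simp add: divide_le_eq mult.commute)
      qed
      have \<rho>w: "0 \<le> \<rho> * w" using \<rho> w0 by simp
      have US: "U \<in> S"
      proof -
        have "w - er Q > 0" using QL big Nc2 \<rho>w Nc1 by (simp add: left_diff_distrib)
        then have "er U > 0" using N by (simp add: erU)
        moreover have "er U \<le> w / N" using Q0 N by (simp add: erU divide_right_mono)
        then have "er U \<le> R" using half R1 by linarith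
        moreover have "cmod (ev U z) \<le> er U" if z: "z \<in> Z'" for z
        proof -
          have "cmod (ev P z - ev Q z) \<le> cmod (ev P z) + cmod (ev Q z)" by (rule norm_triangle_ineq4)
          also have "\<dots> \<le> \<rho> * w + N * c" using Pz[OF z] Qb[of z] z Z' by auto
          also have "\<dots> \<le> w - N * c" using big Nc2 by (simp add: algebra_simps)
          also have "\<dots> \<le> w - er Q" using QL by simp
          finally show ?thesis using N by (simp add: evU erU norm_divide divide_right_mono)
        qed
        ultimately show ?thesis using degU by (simp add: S_def)
      qed
      have U'S: "U' \<in> S"
      proof -
        have fr: "0 \<le> 1 - 1 / real N" "1 - 1 / real N \<le> 1" using N by auto
        have lo: "w / N \<le> er U'" using Q0 fr by (simp add: erU')
        moreover have "w / N > 0" using w0 N by simp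
        ultimately have "er U' > 0" by linarith
        moreover have "er Q * (1 - 1 / N) \<le> er Q" using fr Q0 by (simp add: mult_left_le)
        then have "er U' \<le> R" using QL half RNc unfolding erU' by linarith
        moreover have "cmod (ev U' z) \<le> er U'" if z: "z \<in> Z'" for z
        proof -
          have "cmod (ev U' z) \<le> cmod (ev P z / of_nat N) + cmod (ev Q z * (1 - 1 / of_nat N))"
            unfolding evU' by (rule norm_triangle_ineq)
          also have "cmod (ev Q z * (1 - 1 / of_nat N)) \<le> cmod (ev Q z) * 1"
          proof -
            have "(1 - 1 / of_nat N :: complex) = of_real (1 - 1 / real N)" by simp
            then have "cmod (1 - 1 / of_nat N) = 1 - 1 / real N" using fr by (metis norm_of_real abs_of_nonneg)
            then show ?thesis unfolding norm_mult using fr by (intro mult_left_mono) auto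
          qed
          also have "cmod (ev P z / of_nat N) + cmod (ev Q z) * 1 \<le> \<rho> * w / N + N * c"
            using Pz[OF z] Qb[of z] z Z' N by (intro add_mono) (auto simp: norm_divide divide_right_mono)
          also have "\<dots> \<le> w / N"
          proof -
            have "real N ^ 2 * c \<le> (1 - \<rho>) * w" using big Nc1 Nc2 by linarith
            then have "real N ^ 2 * c / N \<le> (1 - \<rho>) * w / N" by (rule divide_right_mono) simp
            moreover have "real N ^ 2 * c / N = N * c" using N by (simp add: power2_eq_square)
            moreover have "(1 - \<rho>) * w / N = w / N - \<rho> * w / N" by (simp add: left_diff_distrib diff_divide_distrib)
            ultimately show ?thesis by linarith
          qed
          also note lo
          finally show ?thesis by simp
        qed
        ultimately show ?thesis using degree_add_less[OF degU degQ] by (simp add: S_def U'_def)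
      qed
      define b where "b q = (N - 1) * of_bool (q = U) + of_bool (q = U')" for q
      have "(\<Sum>q\<in>S. real (b q) * er q) = (\<Sum>q\<in>S. if q = U then real (N - 1) * er q else 0) + (\<Sum>q\<in>S. if q = U' then er q else 0)"
        unfolding sum.distrib[symmetric] by (rule sum.cong) (auto simp: b_def distrib_right)
      also have "\<dots> = real (N - 1) * er U + er U'" using finS US U'S by simp
      also have "\<dots> = w" using N NU by (simp add: UQ of_nat_diff left_diff_distrib)
      finally show ?thesis unfolding w by (intro exI[of _ b])
    qed
  qed
  then have "\<forall>p\<in>S. \<exists>b :: int poly \<Rightarrow> nat. (\<Sum>q\<in>S. real (b q) * er q) = L * er p" by blast
  from bchoice[OF this] obtain B :: "int poly \<Rightarrow> int poly \<Rightarrow> nat"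
    where B: "\<forall>p\<in>S. (\<Sum>q\<in>S. real (B p q) * er q) = L * er p" by blast
  show thesis
  proof (rule that[OF finS S0])
    show "er p > 0" if "p \<in> S" for p using that by (simp add: S_def)
    show "(\<Sum>q\<in>S. real (B p q) * er q) = L * er p" if "p \<in> S" for p using B that by blast
  qed
qed

section \<open>Estimates for the entropy of open covers\<close>

lemma funpow_in:
  assumes "\<And>x. x \<in> A \<Longrightarrow> T x \<in> A" "x \<in> A"
  shows "(T ^^ n) x \<in> A"
  by (induction n) (use assms in auto)

lemma finite_iterated_join:
  assumes "finite \<U>"
  shows "finite (iterated_join X T \<U> n)"
proof (rule finite_subset)
  show "iterated_join X T \<U> n \<subseteq> (\<lambda>U. topspace X \<inter> (\<Inter>i<n. (T ^^ i) -` U i)) ` (PiE {..<n} (\<lambda>_. \<U>))"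
  proof
    fix V assume "V \<in> iterated_join X T \<U> n"
    then obtain U where U: "V = topspace X \<inter> (\<Inter>i<n. (T ^^ i) -` U i)" "\<forall>i<n. U i \<in> \<U>"
      by (auto simp: iterated_join_def)
    then have "V = topspace X \<inter> (\<Inter>i<n. (T ^^ i) -` restrict U {..<n} i)" by auto
    then show "V \<in> (\<lambda>U. topspace X \<inter> (\<Inter>i<n. (T ^^ i) -` U i)) ` (PiE {..<n} (\<lambda>_. \<U>))"
      using U(2) by (intro image_eqI[of _ _ "restrict U {..<n}"]) auto
  qed
qed (use assms in \<open>simp add: finite_PiE\<close>)

text \<open>The members of the cover \<open>{X - (\<Union>s\<noteq>t. K s)}\<close> each meet only one of the sets \<open>K t\<close>, so that a
  member of an iterated join contains the point shadowing at most one sequence of blocks.\<close>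

lemma top_entropy_ge_blocks:
  fixes X :: "'b topology" and K :: "'t \<Rightarrow> 'b set"
  assumes T: "\<And>x. x \<in> topspace X \<Longrightarrow> T x \<in> topspace X"
    and I: "finite I" "I \<noteq> {}" and L: "L \<ge> 1"
    and closed: "\<And>t. t \<in> I \<Longrightarrow> closedin X (K t)"
    and disj: "\<And>s t. s \<in> I \<Longrightarrow> t \<in> I \<Longrightarrow> s \<noteq> t \<Longrightarrow> K s \<inter> K t = {}"
    and shadow: "\<And>m t. (\<And>j. t j \<in> I) \<Longrightarrow> \<exists>x\<in>topspace X. \<forall>j<m. (T ^^ (j * L)) x \<in> K (t j)"
  shows "ereal (ln (real (card I)) / real L) \<le> top_entropy X T"
proof -
  define U where "U t = topspace X - (\<Union>s\<in>I - {t}. K s)" for t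
  let ?\<U> = "U ` I"
  have "openin X (U t)" for t
    unfolding U_def by (intro openin_diff openin_topspace closedin_Union) (use I closed in auto)
  moreover have covers: "\<exists>t\<in>I. x \<in> U t" if "x \<in> topspace X" for x
  proof (cases "\<exists>t\<in>I. x \<in> K t")
    case True
    then obtain t where t: "t \<in> I" "x \<in> K t" by blast
    have "x \<in> U t" unfolding U_def using that t disj by blast
    with t(1) show ?thesis by blast
  next
    case False
    then show ?thesis using I that by (auto simp: U_def)
  qed
  moreover have "U t \<subseteq> topspace X" for t by (auto simp: U_def)
  ultimately have cover: "open_cover X ?\<U>"
    unfolding open_cover_def by (intro conjI ballI equalityI subsetI) blast+
  have meet: "t = s" if "t \<in> I" "s \<in> I" "x \<in> U t" "x \<in> K s" for s t x
    using that by (auto simp: U_def)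
  have bound: "ln (real (card I)) / real L \<le> ln (real (cover_number X (iterated_join X T ?\<U> n))) / real n"
    if n: "n \<ge> 1" for n
  proof -
    define J where "J = iterated_join X T ?\<U> n"
    have "\<Union>J = topspace X"
    proof
      show "topspace X \<subseteq> \<Union>J"
      proof
        fix x assume x: "x \<in> topspace X"
        have "\<forall>i. \<exists>t. t \<in> I \<and> (T ^^ i) x \<in> U t"
        proof
          fix i
          have "(T ^^ i) x \<in> topspace X" by (rule funpow_in[OF T x])
          then show "\<exists>t. t \<in> I \<and> (T ^^ i) x \<in> U t" using covers by blast
        qed
        from choice[OF this] obtain t where t: "\<And>i. t i \<in> I \<and> (T ^^ i) x \<in> U (t i)" by blast
        define O' where "O' i = U (t i)" for i
        have "topspace X \<inter> (\<Inter>i<n. (T ^^ i) -` O' i) \<in> J"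
          unfolding J_def iterated_join_def using t O'_def by blast
        moreover have "x \<in> topspace X \<inter> (\<Inter>i<n. (T ^^ i) -` O' i)"
          using x t unfolding O'_def by blast
        ultimately show "x \<in> \<Union>J" by (rule UnionI)
      qed
    qed (auto simp: J_def iterated_join_def)
    moreover have "finite J" unfolding J_def using I by (intro finite_iterated_join) auto
    ultimately have "\<exists>k \<V>. \<V> \<subseteq> J \<and> finite \<V> \<and> \<Union>\<V> = topspace X \<and> card \<V> = k" by blast
    from LeastI_ex[OF this] obtain \<V> where V: "\<V> \<subseteq> J" "finite \<V>" "\<Union>\<V> = topspace X" "card \<V> = cover_number X J"
      unfolding cover_number_def by blast
    define m where "m = (n + L - 1) div L"
    define k where "k = (n + L - 1) mod L"
    have "m * L + k = n + L - 1" unfolding m_def k_def by (rule div_mult_mod_eq)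
    moreover have "k < L" unfolding k_def using L by (intro mod_less_divisor) simp
    ultimately have mL: "m * L \<ge> n" using L by simp
    have jL: "j * L < n" if "j < m" for j
    proof -
      have "(j + 1) * L \<le> m * L" using that by (intro mult_right_mono) auto
      also have "\<dots> \<le> n + L - 1" by (simp add: m_def)
      finally show ?thesis using L by simp
    qed
    let ?S = "PiE {..<m} (\<lambda>_. I)"
    have "\<forall>f\<in>?S. \<exists>W. W \<in> \<V> \<and> (\<exists>x\<in>W. \<forall>j<m. (T ^^ (j * L)) x \<in> K (f j))"
    proof
      fix f assume f: "f \<in> ?S"
      obtain i where "i \<in> I" using I by blast
      define t where "t j = (if j < m then f j else i)" for j
      have "\<And>j. t j \<in> I" using f \<open>i \<in> I\<close> by (auto simp: t_def)
      then have "\<exists>x\<in>topspace X. \<forall>j<m. (T ^^ (j * L)) x \<in> K (t j)" by (rule shadow)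
      then obtain x where x: "x \<in> topspace X" "\<forall>j<m. (T ^^ (j * L)) x \<in> K (t j)" ..
      have "\<forall>j<m. (T ^^ (j * L)) x \<in> K (f j)" using x(2) by (simp add: t_def)
      then show "\<exists>W. W \<in> \<V> \<and> (\<exists>x\<in>W. \<forall>j<m. (T ^^ (j * L)) x \<in> K (f j))"
        using V(3) x(1) by blast
    qed
    from bchoice[OF this] obtain W
      where W: "\<And>f. f \<in> ?S \<Longrightarrow> W f \<in> \<V> \<and> (\<exists>x\<in>W f. \<forall>j<m. (T ^^ (j * L)) x \<in> K (f j))"
      by blast
    have "inj_on W ?S"
    proof (rule inj_onI, rule PiE_ext)
      fix f g j assume fg: "f \<in> ?S" "g \<in> ?S" "W f = W g" and j: "j \<in> {..<m}"
      obtain x y where x: "x \<in> W f" "\<forall>j<m. (T ^^ (j * L)) x \<in> K (f j)"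
        and y: "y \<in> W f" "\<forall>j<m. (T ^^ (j * L)) y \<in> K (g j)"
        using W[OF fg(1)] W[OF fg(2)] unfolding fg(3)[symmetric] by blast
      have "W f \<in> J" using W[OF fg(1)] V by blast
      then obtain O' where O': "\<forall>i<n. O' i \<in> ?\<U>" "W f = topspace X \<inter> (\<Inter>i<n. (T ^^ i) -` O' i)"
        unfolding J_def iterated_join_def by blast
      have jn: "j * L < n" using jL j by simp
      obtain t where t: "t \<in> I" "O' (j * L) = U t" using O'(1) jn by blast
      have "(T ^^ (j * L)) x \<in> O' (j * L)" "(T ^^ (j * L)) y \<in> O' (j * L)"
        using x(1) y(1) jn unfolding O'(2) by blast+
      then have "t = f j" "t = g j"
        using meet[OF t(1)] x(2) y(2) fg(1,2) j unfolding t(2) by (blast dest: PiE_mem)+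
      then show "f j = g j" by simp
    qed auto
    then have "card ?S \<le> card \<V>" using W V by (intro card_inj_on_le[of W]) auto
    then have le: "card I ^ m \<le> cover_number X J" using V by (simp add: card_PiE)
    have c1: "card I \<ge> 1" using I by (simp add: Suc_le_eq card_gt_0_iff)
    have "real n * ln (real (card I)) \<le> real (m * L) * ln (real (card I))"
      using mL c1 by (intro mult_right_mono) (simp_all only: of_nat_le_iff, simp)
    also have "\<dots> = real L * ln (real (card I ^ m))" using c1 by (simp add: ln_realpow)
    also have "\<dots> \<le> real L * ln (real (cover_number X J))"
    proof (intro mult_left_mono)
      have "0 < real (card I ^ m)" using c1 by simp
      then show "ln (real (card I ^ m)) \<le> ln (real (cover_number X J))" using le by (subst ln_le_cancel_iff) linarith+
    qed simp
    finally have "real n * ln (real (card I)) \<le> real L * ln (real (cover_number X J))" .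
    then show ?thesis using n L unfolding J_def by (simp add: field_simps)
  qed
  have "ereal (ln (real (card I)) / real L) \<le> cover_entropy X T ?\<U>"
    unfolding cover_entropy_def
    by (rule le_Limsup) (use bound in \<open>auto simp: eventually_sequentially intro!: exI[of _ 1]\<close>)
  also have "\<dots> \<le> top_entropy X T"
    unfolding top_entropy_def using cover by (intro SUP_upper) auto
  finally show ?thesis .
qed

lemma cover_number_join_le:
  assumes fin: "finite (g ` topspace X)"
    and ex: "\<And>x. x \<in> topspace X \<Longrightarrow> \<exists>W. \<forall>i<n. W i \<in> \<U> \<and> (\<forall>y\<in>topspace X. g y = g x \<longrightarrow> (T ^^ i) y \<in> W i)"
  shows "cover_number X (iterated_join X T \<U> n) \<le> card (g ` topspace X)"
proof -
  obtain W where W: "\<And>x. x \<in> topspace X \<Longrightarrow> \<forall>i<n. W x i \<in> \<U> \<and> (\<forall>y\<in>topspace X. g y = g x \<longrightarrow> (T ^^ i) y \<in> W x i)"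
    using ex by metis
  define h where "h c = inv_into (topspace X) g c" for c
  have h: "h c \<in> topspace X" "g (h c) = c" if "c \<in> g ` topspace X" for c
    using that unfolding h_def by (auto intro: inv_into_into f_inv_into_f)
  define V where "V c = topspace X \<inter> (\<Inter>i<n. (T ^^ i) -` W (h c) i)" for c
  have "V ` g ` topspace X \<subseteq> iterated_join X T \<U> n"
    unfolding iterated_join_def V_def using W h by blast
  moreover have "\<Union>(V ` g ` topspace X) = topspace X"
  proof
    show "topspace X \<subseteq> \<Union>(V ` g ` topspace X)"
    proof
      fix x assume x: "x \<in> topspace X"
      then have "x \<in> V (g x)" unfolding V_def using W[of "h (g x)"] h[of "g x"] by auto
      then show "x \<in> \<Union>(V ` g ` topspace X)" using x by blast
    qed
  qed (auto simp: V_def)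
  ultimately have "cover_number X (iterated_join X T \<U> n) \<le> card (V ` g ` topspace X)"
    unfolding cover_number_def using fin by (intro Least_le) blast
  also have "\<dots> \<le> card (g ` topspace X)" using fin by (rule card_image_le)
  finally show ?thesis .
qed

lemma top_entropy_le:
  assumes "\<And>\<U>. open_cover X \<U> \<Longrightarrow> \<exists>h. (\<forall>n. real (cover_number X (iterated_join X T \<U> n)) \<le> h n \<and> 1 \<le> h n) \<and>
      (\<lambda>n. ln (h n) / real n) \<longlonglongrightarrow> c"
  shows "top_entropy X T \<le> ereal c"
  unfolding top_entropy_def
proof (rule SUP_least)
  fix \<U> assume "\<U> \<in> Collect (open_cover X)"
  then obtain h where h: "\<And>n. real (cover_number X (iterated_join X T \<U> n)) \<le> h n" "\<And>n. 1 \<le> h n"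
      "(\<lambda>n. ln (h n) / real n) \<longlonglongrightarrow> c" using assms[of \<U>] by blast
  have "ln (real (cover_number X (iterated_join X T \<U> n))) / real n \<le> ln (h n) / real n" for n
  proof (rule divide_right_mono)
    show "ln (real (cover_number X (iterated_join X T \<U> n))) \<le> ln (h n)"
    proof (cases "cover_number X (iterated_join X T \<U> n) = 0")
      case False
      then show ?thesis using h(1)[of n] by (subst ln_le_cancel_iff) linarith+
    qed (use h(2)[of n] in simp)
  qed simp
  then have "cover_entropy X T \<U> \<le> limsup (\<lambda>n. ereal (ln (h n) / real n))"
    unfolding cover_entropy_def by (intro Limsup_mono) auto
  also have "\<dots> = ereal c" using h(3) by (intro lim_imp_Limsup) (auto intro: tendsto_ereal)
  finally show "cover_entropy X T \<U> \<le> ereal c" .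
qed

lemma top_entropy_finite:
  assumes T: "\<And>x. x \<in> topspace X \<Longrightarrow> T x \<in> topspace X" and fin: "finite (topspace X)"
  shows "top_entropy X T \<le> 0"
proof -
  let ?h = "\<lambda>_. max 1 (real (card (topspace X)))"
  have "top_entropy X T \<le> ereal 0"
  proof (rule top_entropy_le, rule exI[of _ ?h], intro conjI allI)
    fix \<U> n assume cover: "open_cover X \<U>"
    have "cover_number X (iterated_join X T \<U> n) \<le> card (id ` topspace X)"
    proof (rule cover_number_join_le)
      fix x assume x: "x \<in> topspace X"
      have "\<forall>i. \<exists>W. W \<in> \<U> \<and> (T ^^ i) x \<in> W"
      proof
        fix i
        have "(T ^^ i) x \<in> topspace X" by (rule funpow_in[OF T x])
        then show "\<exists>W. W \<in> \<U> \<and> (T ^^ i) x \<in> W" using cover unfolding open_cover_def by blast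
      qed
      from choice[OF this] obtain W where "\<And>i. W i \<in> \<U> \<and> (T ^^ i) x \<in> W i" by blast
      then show "\<exists>W. \<forall>i<n. W i \<in> \<U> \<and> (\<forall>y\<in>topspace X. id y = id x \<longrightarrow> (T ^^ i) y \<in> W i)"
        by (intro exI[of _ W]) simp
    qed (use fin in simp)
    then show "real (cover_number X (iterated_join X T \<U> n)) \<le> max 1 (real (card (topspace X)))" by simp
  next
    show "(\<lambda>n. ln (max 1 (real (card (topspace X)))) / real n) \<longlonglongrightarrow> 0"
      by (rule lim_const_over_n)
  qed simp
  then show ?thesis by (simp add: zero_ereal_def)
qed

section \<open>Markov multi-maps and their codings\<close>

locale markov =
  fixes F :: "'a multi_map"
  assumes mm: "markov_multi_map F" and pp: "properly_parametrized F"
begin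

lemma finite_alph: "finite (alph F)"
  using mm by (simp add: markov_multi_map_def)

lemma alph_cases:
  assumes "a \<in> alph F"
  obtains "a \<in> alph0 F" | "a \<in> alph1 F" "a \<notin> alph0 F" | "a \<in> alph2 F" "a \<notin> alph0 F" "a \<notin> alph1 F"
  using assms mm by (auto simp: alph_def markov_multi_map_def)

lemma pts_gaps:
  "\<exists>(p :: nat \<Rightarrow> real) r. (pts F = p ` {..r}) \<and>
     (p 0 = 0) \<and>
     (p r = 1) \<and>
     (\<forall>i\<le>r. \<forall>j\<le>r. p i < p j \<longleftrightarrow> i < j) \<and>
     (\<forall>i\<le>r. \<forall>j\<le>r. p i \<le> p j \<longleftrightarrow> i \<le> j) \<and>
     (\<forall>a\<in>alph0 F. \<exists>i<r. Dom F a = {p i..p (Suc i)}) \<and>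
     (\<forall>a\<in>alph F - alph0 F. \<exists>i\<le>r. Dom F a = {p i})"
proof -
  note mm[unfolded markov_multi_map_def, THEN conjunct1]
  then obtain p :: "nat \<Rightarrow> real" and r where p: "pts F = p ` {..r}" "strict_mono_on {..r} p" "p 0 = 0" "p r = 1"
    "\<forall>a\<in>alph0 F. \<exists>i<r. Dom F a = {p i..p (Suc i)}" "\<forall>a\<in>alph1 F \<union> alph2 F. \<exists>i\<le>r. Dom F a = {p i}"
    by blast
  have "\<forall>i\<le>r. \<forall>j\<le>r. p i < p j \<longleftrightarrow> i < j" using strict_mono_on_less[OF p(2)] by simp
  moreover have "\<forall>i\<le>r. \<forall>j\<le>r. p i \<le> p j \<longleftrightarrow> i \<le> j" using strict_mono_on_less_eq[OF p(2)] by simp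
  moreover have "\<forall>a\<in>alph F - alph0 F. \<exists>i\<le>r. Dom F a = {p i}" using p(6) by (auto simp: alph_def)
  ultimately show ?thesis using p(1,3,4,5) by blast
qed

lemma finite_pts: "finite (pts F)" and pts_subset: "pts F \<subseteq> {0..1}"
proof -
  obtain p r where p: "pts F = p ` {..r}"
    "p 0 = 0"
    "p r = 1"
    "\<forall>i\<le>r. \<forall>j\<le>r. p i < p j \<longleftrightarrow> i < j"
    "\<forall>i\<le>r. \<forall>j\<le>r. p i \<le> p j \<longleftrightarrow> i \<le> j"
    "\<forall>a\<in>alph0 F. \<exists>i<r. Dom F a = {p i..p (Suc i)}"
    "\<forall>a\<in>alph F - alph0 F. \<exists>i\<le>r. Dom F a = {p i}"
    using pts_gaps by (elim exE conjE) (rule that)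
  show "finite (pts F)" using p(1) by simp
  have "0 \<le> p i" "p i \<le> 1" if "i \<le> r" for i
    using p(5)[rule_format, of 0 i] p(5)[rule_format, of i r] p(2,3) that by auto
  then show "pts F \<subseteq> {0..1}" using p(1) by auto
qed

lemma Dom_alph0:
  assumes "a \<in> alph0 F"
  shows "\<exists>l\<in>pts F. \<exists>u\<in>pts F. l < u \<and> Dom F a = {l..u} \<and> (\<forall>q\<in>pts F. q \<le> l \<or> u \<le> q)"
proof -
  obtain p r where p: "pts F = p ` {..r}"
    "p 0 = 0"
    "p r = 1"
    "\<forall>i\<le>r. \<forall>j\<le>r. p i < p j \<longleftrightarrow> i < j"
    "\<forall>i\<le>r. \<forall>j\<le>r. p i \<le> p j \<longleftrightarrow> i \<le> j"
    "\<forall>a\<in>alph0 F. \<exists>i<r. Dom F a = {p i..p (Suc i)}"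
    "\<forall>a\<in>alph F - alph0 F. \<exists>i\<le>r. Dom F a = {p i}"
    using pts_gaps by (elim exE conjE) (rule that)
  obtain i where i: "i < r" "Dom F a = {p i..p (Suc i)}" using p(6) assms by blast
  have "q \<le> p i \<or> p (Suc i) \<le> q" if q: "q \<in> pts F" for q
  proof -
    obtain j where "j \<le> r" "q = p j" using p(1) q by auto
    then show ?thesis using p(5)[rule_format, of j i] p(5)[rule_format, of "Suc i" j] i by auto
  qed
  moreover have "p i < p (Suc i)" "p i \<in> pts F" "p (Suc i) \<in> pts F" using p(1) p(4)[rule_format, of i "Suc i"] i by auto
  ultimately show ?thesis using i by blast
qed

lemma Dom_alph12:
  assumes "a \<in> alph F" "a \<notin> alph0 F"
  shows "\<exists>q\<in>pts F. Dom F a = {q}"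
proof -
  obtain p r where p: "pts F = p ` {..r}"
    "p 0 = 0"
    "p r = 1"
    "\<forall>i\<le>r. \<forall>j\<le>r. p i < p j \<longleftrightarrow> i < j"
    "\<forall>i\<le>r. \<forall>j\<le>r. p i \<le> p j \<longleftrightarrow> i \<le> j"
    "\<forall>a\<in>alph0 F. \<exists>i<r. Dom F a = {p i..p (Suc i)}"
    "\<forall>a\<in>alph F - alph0 F. \<exists>i\<le>r. Dom F a = {p i}"
    using pts_gaps by (elim exE conjE) (rule that)
  show ?thesis using p(1) p(7) assms by blast
qed

lemma Ran_alph0: "a \<in> alph0 F \<Longrightarrow> \<exists>l\<in>pts F. \<exists>u\<in>pts F. l < u \<and> Ran F a = {l..u}"
  using mm[unfolded markov_multi_map_def, THEN conjunct2, THEN conjunct2, THEN conjunct2, THEN conjunct2, THEN conjunct2, THEN conjunct1] by blast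

lemma Ran_alph1: "a \<in> alph1 F \<Longrightarrow> \<exists>l\<in>pts F. \<exists>u\<in>pts F. l < u \<and> Ran F a = {l..u}"
  using mm[unfolded markov_multi_map_def, THEN conjunct2, THEN conjunct2, THEN conjunct2, THEN conjunct2, THEN conjunct2, THEN conjunct2, THEN conjunct1] by blast

lemma Ran_alph2: "a \<in> alph2 F \<Longrightarrow> \<exists>u\<in>pts F. Ran F a = {u}"
  using mm[unfolded markov_multi_map_def, THEN conjunct2, THEN conjunct2, THEN conjunct2, THEN conjunct2, THEN conjunct2, THEN conjunct2, THEN conjunct2, THEN conjunct1] by blast

lemma Ran0_cases:
  assumes "a \<in> alph F"
  obtains l u where "l \<in> pts F" "u \<in> pts F" "l < u" "Ran F a = {l..u}" "Ran0 F a = {l<..<u}"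
        | q where "q \<in> pts F" "Ran F a = {q}" "Ran0 F a = {q}"
  using assms
proof (cases rule: alph_cases)
  case 1
  then obtain l u where "l \<in> pts F" "u \<in> pts F" "l < u" "Ran F a = {l..u}" using Ran_alph0 by blast
  then show ?thesis using that(1)[of l u] 1 by (simp add: Ran0_def)
next
  case 2
  then obtain l u where "l \<in> pts F" "u \<in> pts F" "l < u" "Ran F a = {l..u}" using Ran_alph1 by blast
  then show ?thesis using that(1)[of l u] 2 by (simp add: Ran0_def)
next
  case 3
  then obtain u where "u \<in> pts F" "Ran F a = {u}" using Ran_alph2 by blast
  then show ?thesis using that(2)[of u] 3 by (simp add: Ran0_def)
qed

lemma Dom0_alph0: "a \<in> alph0 F \<Longrightarrow> Dom F a = {l..u} \<Longrightarrow> Dom0 F a = {l<..<u}"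
  by (simp add: Dom0_def)

lemma Dom0_subset: "Dom0 F a \<subseteq> Dom F a"
  by (simp add: Dom0_def interior_subset)

lemma Ran0_subset: "Ran0 F a \<subseteq> Ran F a"
  by (simp add: Ran0_def interior_subset)

lemma Dom0_nonempty: "a \<in> alph F \<Longrightarrow> Dom0 F a \<noteq> {}"
  using Dom_alph0[of a] Dom_alph12[of a] by (cases "a \<in> alph0 F") (auto simp: Dom0_def)

lemma Dom_unit: "a \<in> alph F \<Longrightarrow> Dom F a \<subseteq> {0..1}"
  using pts_subset Dom_alph0[of a] Dom_alph12[of a] by (cases "a \<in> alph0 F") force+

lemma Ran_unit: "a \<in> alph F \<Longrightarrow> Ran F a \<subseteq> {0..1}"
  using pts_subset by (elim Ran0_cases) auto

lemma Dom0_alph0_pts: "a \<in> alph0 F \<Longrightarrow> Dom0 F a = Dom F a - pts F"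
proof -
  assume a: "a \<in> alph0 F"
  obtain l u where lu: "l \<in> pts F" "u \<in> pts F" "l < u" "Dom F a = {l..u}" "\<forall>q\<in>pts F. q \<le> l \<or> u \<le> q"
    using Dom_alph0[OF a] by blast
  have "x \<notin> pts F" if "l < x" "x < u" for x using lu(5) that by force
  then show ?thesis using Dom0_alph0[OF a lu(4)] lu by (auto simp: less_le)
qed

lemma Dom0_subset_Ran0:
  assumes "a \<in> alph F" "b \<in> alph F" "y \<in> Dom0 F b" "y \<in> Ran0 F a"
  shows "Dom0 F b \<subseteq> Ran0 F a"
proof (cases "b \<in> alph0 F")
  case True
  obtain l u where lu: "Dom F b = {l..u}" "\<forall>q\<in>pts F. q \<le> l \<or> u \<le> q"
    using Dom_alph0[OF True] by blast
  have D: "Dom0 F b = {l<..<u}" using Dom0_alph0[OF True lu(1)] .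
  from assms(1) show ?thesis
  proof (cases rule: Ran0_cases)
    case (1 l' u')
    then show ?thesis using bspec[OF lu(2), of l'] bspec[OF lu(2), of u'] D assms(3,4) by auto
  next
    case (2 q)
    then show ?thesis using bspec[OF lu(2), of q] D assms(3,4) by auto
  qed
next
  case False
  then show ?thesis using assms Dom_alph12[OF assms(2) False] by (auto simp: Dom0_def)
qed

lemma branch_monotone:
  assumes "a \<in> alph0 F"
  shows "strict_mono_on (Dom F a) (branch F a) \<or> strict_antimono_on (Dom F a) (branch F a)"
    and "branch F a ` Dom F a = Ran F a" and "continuous_on (Dom F a) (branch F a)"
proof -
  obtain g where g: "homeomorphism (Dom F a) (Ran F a) (branch F a) g"
    using mm[unfolded markov_multi_map_def, THEN conjunct2, THEN conjunct2, THEN conjunct2, THEN conjunct2, THEN conjunct2, THEN conjunct2, THEN conjunct2, THEN conjunct2, THEN conjunct1] assms by blast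
  obtain l u where lu: "Dom F a = {l..u}" using Dom_alph0[OF assms] by blast
  have "inj_on (branch F a) (Dom F a)" by (rule inj_on_inverseI[of _ g]) (use g in \<open>simp add: homeomorphism_def\<close>)
  moreover show c: "continuous_on (Dom F a) (branch F a)" using g by (simp add: homeomorphism_def)
  moreover have "is_interval (Dom F a)" by (simp add: lu is_interval_cc)
  ultimately show "strict_mono_on (Dom F a) (branch F a) \<or> strict_antimono_on (Dom F a) (branch F a)"
    using injective_eq_monotone_map[of "Dom F a" "branch F a"] by simp
  show "branch F a ` Dom F a = Ran F a" using g by (simp add: homeomorphism_def)
qed

lemma branch_ends:
  assumes a: "a \<in> alph0 F" and D: "Dom F a = {l..u}" "l < u" and R: "Ran F a = {l'..u'}" "l' < u'"
  shows "branch F a l = l' \<and> branch F a u = u' \<or> branch F a l = u' \<and> branch F a u = l'"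
proof -
  let ?f = "branch F a"
  have im: "?f ` {l..u} = {l'..u'}" using branch_monotone(2)[OF a] D R by simp
  then obtain x y where xy: "x \<in> {l..u}" "?f x = l'" "y \<in> {l..u}" "?f y = u'"
  proof -
    have "l' \<in> ?f ` {l..u}" "u' \<in> ?f ` {l..u}" unfolding im using R(2) by auto
    then show thesis using that by blast
  qed
  have end_in: "?f l \<in> {l'..u'}" "?f u \<in> {l'..u'}" using im D(2) by force+
  from branch_monotone(1)[OF a] show ?thesis
  proof
    assume m: "strict_mono_on (Dom F a) ?f"
    have "?f l \<le> ?f x" "?f y \<le> ?f u"
      using strict_mono_on_less_eq[OF m] D xy by auto
    then show ?thesis using end_in xy by auto
  next
    assume m: "strict_antimono_on (Dom F a) ?f"
    have "?f l \<ge> ?f y" "?f x \<ge> ?f u"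
      using m D xy unfolding monotone_on_def by (auto simp: le_less)
    then show ?thesis using end_in xy by auto
  qed
qed

lemma branch_inj: "a \<in> alph0 F \<Longrightarrow> inj_on (branch F a) (Dom F a)"
proof (rule inj_onI)
  fix x y assume "a \<in> alph0 F" and xy: "x \<in> Dom F a" "y \<in> Dom F a" "branch F a x = branch F a y"
  then show "x = y"
    using branch_monotone(1)[of a] unfolding monotone_on_def by (cases x y rule: linorder_cases) force+
qed

lemma graph_of_alph0:
  assumes "a \<in> alph0 F" "(x, y) \<in> graph_of F a"
  shows "x \<in> Dom F a" "y = branch F a x" "y \<in> Ran F a"
  using assms branch_monotone(2)[OF assms(1)] by (auto simp: graph_of_def)

lemma graph_of_pts:
  assumes a: "a \<in> alph0 F" and xy: "(x, y) \<in> graph_of F a" and R: "Ran F a = {l..u}" "l < u"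
  shows "x \<in> pts F \<longleftrightarrow> y \<in> {l, u}"
proof -
  obtain l' u' where lu: "l' \<in> pts F" "u' \<in> pts F" "l' < u'" "Dom F a = {l'..u'}" "\<forall>q\<in>pts F. q \<le> l' \<or> u' \<le> q"
    using Dom_alph0[OF a] by blast
  have x: "x \<in> {l'..u'}" "y = branch F a x" using graph_of_alph0[OF a xy] lu by auto
  have ends: "branch F a l' = l \<and> branch F a u' = u \<or> branch F a l' = u \<and> branch F a u' = l"
    by (rule branch_ends[OF a lu(4,3) R])
  have "x \<in> pts F \<longleftrightarrow> x = l' \<or> x = u'" using lu x by force
  moreover have inj: "branch F a x = branch F a z \<longleftrightarrow> x = z" if "z \<in> {l'..u'}" for z
    using branch_inj[OF a] x(1) that lu(4) by (auto simp: inj_on_def)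
  have "y = branch F a l' \<longleftrightarrow> x = l'" "y = branch F a u' \<longleftrightarrow> x = u'"
    using inj[of l'] inj[of u'] x(2) lu(3) by auto
  ultimately show ?thesis using ends by auto
qed

lemma graph0_subset: "graph0_of F a \<subseteq> graph_of F a"
  using Dom0_subset Ran0_subset by (auto simp: graph0_of_def graph_of_def)

lemma graph0_iff:
  assumes "a \<in> alph F" "(x, y) \<in> graph0_of F a"
  shows "x \<in> Dom0 F a" "y \<in> Ran0 F a"
proof -
  show x: "x \<in> Dom0 F a" using assms by (auto simp: graph0_of_def split: if_splits)
  show "y \<in> Ran0 F a"
  proof (cases "a \<in> alph0 F")
    case True
    obtain l u where lu: "Ran F a = {l..u}" "l < u" using Ran_alph0[OF True] by blast
    have xy: "(x, y) \<in> graph_of F a" using assms graph0_subset by blast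
    have "x \<notin> pts F" using x Dom0_alph0_pts[OF True] by auto
    then have "y \<notin> {l, u}" using graph_of_pts[OF True xy lu] by blast
    then show ?thesis using graph_of_alph0(3)[OF True xy] lu True by (auto simp: Ran0_def)
  qed (use assms in \<open>auto simp: graph0_of_def\<close>)
qed

lemma graph0_backward:
  assumes a: "a \<in> alph F" and y: "y \<in> Ran0 F a"
  shows "\<exists>x. (x, y) \<in> graph0_of F a"
proof (cases "a \<in> alph0 F")
  case True
  obtain l u where lu: "Ran F a = {l..u}" "l < u" using Ran_alph0[OF True] by blast
  have y': "y \<in> Ran F a" "y \<notin> {l, u}" using y lu True by (auto simp: Ran0_def)
  then obtain x where x: "x \<in> Dom F a" "y = branch F a x" using branch_monotone(2)[OF True] by auto
  then have xy: "(x, y) \<in> graph_of F a" using True by (auto simp: graph_of_def)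
  then have "x \<notin> pts F" using graph_of_pts[OF True xy lu] y' by blast
  then show ?thesis using x True Dom0_alph0_pts[OF True] by (auto simp: graph0_of_def)
next
  case False
  then show ?thesis using y Dom0_nonempty[OF a] by (auto simp: graph0_of_def)
qed

lemma graph_of_alph0_not_pts:
  assumes a: "a \<in> alph0 F" and xy: "(x, y) \<in> graph_of F a"
  shows "x \<notin> pts F \<Longrightarrow> (x, y) \<in> graph0_of F a" and "x \<in> pts F \<Longrightarrow> y \<in> pts F"
proof -
  show "(x, y) \<in> graph0_of F a" if "x \<notin> pts F"
    using that graph_of_alph0[OF a xy] Dom0_alph0_pts[OF a] a by (auto simp: graph0_of_def)
  obtain l u where lu: "l \<in> pts F" "u \<in> pts F" "l < u" "Ran F a = {l..u}" using Ran_alph0[OF a] by blast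
  show "y \<in> pts F" if "x \<in> pts F" using graph_of_pts[OF a xy lu(4,3)] that lu by auto
qed

lemma graph_code:
  assumes "(x, y) \<in> graph F"
  shows "\<exists>a\<in>alph F. (x, y) \<in> graph0_of F a"
  using assms pp by (auto simp: properly_parametrized_def)

lemma graph_code_unique:
  assumes "(x, y) \<in> graph0_of F a" "(x, y) \<in> graph0_of F b" "a \<in> alph F" "b \<in> alph F"
  shows "a = b"
  using assms pp unfolding properly_parametrized_def disjoint_family_on_def by blast

lemma graph0_graph: "a \<in> alph F \<Longrightarrow> (x, y) \<in> graph0_of F a \<Longrightarrow> (x, y) \<in> graph F"
  using graph0_subset by (auto simp: graph_def)

lemma graph_total: "x \<in> {0..1} \<Longrightarrow> \<exists>y. (x, y) \<in> graph F"
proof -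
  assume "x \<in> {0..1}"
  then obtain a where a: "a \<in> alph F" "x \<in> Dom F a"
    using mm[unfolded markov_multi_map_def, THEN conjunct2, THEN conjunct2, THEN conjunct2, THEN conjunct2, THEN conjunct2, THEN conjunct2, THEN conjunct2, THEN conjunct2, THEN conjunct2] by blast
  have "Ran F a \<noteq> {}" using a(1) by (cases rule: Ran0_cases) auto
  then have "\<exists>y. (x, y) \<in> graph_of F a" using a by (auto simp: graph_of_def)
  then show ?thesis using a by (auto simp: graph_def)
qed

lemma graph_unit: "(x, y) \<in> graph F \<Longrightarrow> x \<in> {0..1} \<and> y \<in> {0..1}"
proof -
  assume "(x, y) \<in> graph F"
  then obtain a where a: "a \<in> alph F" "(x, y) \<in> graph0_of F a" using graph_code by blast
  then show ?thesis using graph0_iff[OF a] Dom0_subset[of a] Ran0_subset[of a] Dom_unit[OF a(1)] Ran_unit[OF a(1)] by blast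
qed

lemma closed_graph_of: "a \<in> alph F \<Longrightarrow> closed (graph_of F a)"
proof -
  assume a: "a \<in> alph F"
  show ?thesis
  proof (cases "a \<in> alph0 F")
    case True
    have "compact (Dom F a)" using Dom_alph0[OF True] by auto
    then have "compact ((\<lambda>x. (x, branch F a x)) ` Dom F a)"
      using branch_monotone(3)[OF True] by (intro compact_continuous_image continuous_intros) auto
    moreover have "graph_of F a = (\<lambda>x. (x, branch F a x)) ` Dom F a" using True by (auto simp: graph_of_def)
    ultimately show ?thesis by (simp add: compact_imp_closed)
  next
    case False
    have "closed (Dom F a)" using Dom_alph12[OF a False] by auto
    moreover have "closed (Ran F a)" using a by (cases rule: Ran0_cases) auto
    ultimately show ?thesis using False by (simp add: graph_of_def closed_Times)
  qed
qed

lemma closed_graph: "closed (graph F)"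
  unfolding graph_def using finite_alph closed_graph_of by (intro closed_UN) auto

lemma graph_of_monotone:
  assumes "a \<in> alph F"
  shows "(\<forall>x y x' y'. (x, y) \<in> graph_of F a \<longrightarrow> (x', y') \<in> graph_of F a \<longrightarrow> y \<le> y' \<longrightarrow> x \<le> x') \<or>
         (\<forall>x y x' y'. (x, y) \<in> graph_of F a \<longrightarrow> (x', y') \<in> graph_of F a \<longrightarrow> y \<le> y' \<longrightarrow> x' \<le> x)"
proof (cases "a \<in> alph0 F")
  case True
  from branch_monotone(1)[OF True] show ?thesis
  proof
    assume "strict_mono_on (Dom F a) (branch F a)"
    then have le: "x \<le> x'" if "x \<in> Dom F a" "x' \<in> Dom F a" "branch F a x \<le> branch F a x'" for x x'
      using that strict_mono_on_less_eq by blast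
    show ?thesis
    proof (rule disjI1, intro allI impI)
      fix x y x' y' assume "(x, y) \<in> graph_of F a" "(x', y') \<in> graph_of F a" "y \<le> y'"
      then show "x \<le> x'" using le[of x x'] graph_of_alph0(1,2)[OF True, of x y] graph_of_alph0(1,2)[OF True, of x' y'] by simp
    qed
  next
    assume "strict_antimono_on (Dom F a) (branch F a)"
    then have le: "x' \<le> x" if "x \<in> Dom F a" "x' \<in> Dom F a" "branch F a x \<le> branch F a x'" for x x'
      using that unfolding monotone_on_def by (meson leD linorder_le_less_linear)
    show ?thesis
    proof (rule disjI2, intro allI impI)
      fix x y x' y' assume "(x, y) \<in> graph_of F a" "(x', y') \<in> graph_of F a" "y \<le> y'"
      then show "x' \<le> x" using le[of x x'] graph_of_alph0(1,2)[OF True, of x y] graph_of_alph0(1,2)[OF True, of x' y'] by simp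
    qed
  qed
next
  case False
  then show ?thesis using Dom_alph12[OF assms False] by (auto simp: graph_of_def)
qed

end

section \<open>Upper bound for the entropy of the trajectory space\<close>

lemma shift_funpow: "(shift ^^ n) x = (\<lambda>i. x (i + n))"
  by (induction n) (auto simp: shift_def)

lemma log_growth_limit:
  fixes a c e :: real
  assumes "e > 0"
  shows "(\<lambda>n. (a + real (n + k) * c + ln (real (Suc (n + k)) * e + 1)) / real n) \<longlonglongrightarrow> c"
  using assms by real_asymp

definition cell_index :: "nat \<Rightarrow> real \<Rightarrow> nat" where
  "cell_index q t = nat \<lfloor>real q * t\<rfloor>"

lemma cell_index_mono: "t \<le> t' \<Longrightarrow> cell_index q t \<le> cell_index q t'"
  unfolding cell_index_def by (intro nat_mono floor_mono mult_left_mono) auto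

lemma cell_index_le: "t \<le> 1 \<Longrightarrow> cell_index q t \<le> q"
  using cell_index_mono[of t 1 q] by (simp add: cell_index_def)

lemma cell_index_eq_dist:
  assumes "cell_index q t = cell_index q t'" "q > 0" "t \<ge> 0" "t' \<ge> 0"
  shows "\<bar>t - t'\<bar> < 1 / real q"
proof -
  have nn: "0 \<le> \<lfloor>real q * t\<rfloor>" "0 \<le> \<lfloor>real q * t'\<rfloor>" using assms by auto
  have "\<lfloor>real q * t\<rfloor> = \<lfloor>real q * t'\<rfloor>" using assms(1) nn unfolding cell_index_def by (simp add: eq_nat_nat_iff)
  then have "\<bar>real q * t - real q * t'\<bar> < 1" by linarith
  then have "real q * \<bar>t - t'\<bar> < 1" using assms by (simp add: abs_mult flip: right_diff_distrib)
  then show ?thesis using assms by (simp add: field_simps)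
qed

lemma card_image_factor:
  assumes "finite (g ` A)" "\<And>x y. x \<in> A \<Longrightarrow> y \<in> A \<Longrightarrow> g x = g y \<Longrightarrow> f x = f y"
  shows "card (f ` A) \<le> card (g ` A)" "finite (f ` A)"
proof -
  have "f ` A \<subseteq> (f \<circ> inv_into A g) ` (g ` A)"
  proof
    fix y assume "y \<in> f ` A"
    then obtain x where x: "x \<in> A" "y = f x" by blast
    have "f (inv_into A g (g x)) = f x"
      by (rule assms(2)) (use x in \<open>auto intro: inv_into_into f_inv_into_f\<close>)
    then show "y \<in> (f \<circ> inv_into A g) ` (g ` A)" using x by force
  qed
  moreover have "card ((f \<circ> inv_into A g) ` (g ` A)) \<le> card (g ` A)" using assms(1) by (rule card_image_le)
  ultimately show "card (f ` A) \<le> card (g ` A)" "finite (f ` A)"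
    using assms(1) by (meson card_mono finite_imageI le_trans, meson finite_imageI finite_subset)
qed

context markov
begin

lemma trajectory_space_eq: "trajectory_space F = top_of_set (trajectories F)"
proof -
  have "product_topology (\<lambda>_::nat. top_of_set {0..1::real}) UNIV = top_of_set (PiE UNIV (\<lambda>_. {0..1}))"
    unfolding subtopology_product_topology[symmetric] euclidean_product_topology ..
  moreover have "PiE UNIV (\<lambda>_. {0..1}) \<inter> trajectories F = trajectories F"
    by (auto simp: trajectories_def)
  ultimately show ?thesis by (simp add: trajectory_space_def subtopology_subtopology)
qed

lemma trajectories_iff: "x \<in> trajectories F \<longleftrightarrow> (\<forall>n. (x n, x (Suc n)) \<in> graph F)"
  using graph_unit unfolding trajectories_def values_at_def by blast

lemma trajectory_unit: "x \<in> trajectories F \<Longrightarrow> x n \<in> {0..1}"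
  by (simp add: trajectories_def)

lemma shift_trajectory: "x \<in> trajectories F \<Longrightarrow> shift x \<in> trajectories F"
  by (simp add: trajectories_iff shift_def)

lemma topspace_trajectories: "topspace (trajectory_space F) = trajectories F"
  by (simp add: trajectory_space_eq)

lemma continuous_pair: "continuous_on UNIV (\<lambda>x::nat \<Rightarrow> real. (x i, x j))"
  by (intro continuous_on_Pair continuous_on_product_coordinates)

lemma closed_pair: "closed S \<Longrightarrow> closed {x::nat \<Rightarrow> real. (x i, x j) \<in> S}"
  using continuous_closed_vimage[of S "\<lambda>x::nat \<Rightarrow> real. (x i, x j)"] continuous_pair[of i j]
  by (simp add: continuous_on_eq_continuous_at vimage_def)

lemma compact_trajectories: "compact (trajectories F)"
proof -
  have "compactin (product_topology (\<lambda>_::nat. euclidean) UNIV) (PiE UNIV (\<lambda>_. {0..1::real}))"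
    by (subst compactin_PiE) auto
  then have "compact (PiE (UNIV::nat set) (\<lambda>_. {0..1::real}))" by (simp add: euclidean_product_topology)
  moreover have "closed (\<Inter>n. {x. (x n, x (Suc n)) \<in> graph F})"
    by (intro closed_INT ballI closed_pair closed_graph)
  ultimately have "compact (PiE (UNIV::nat set) (\<lambda>_. {0..1::real}) \<inter> (\<Inter>n. {x. (x n, x (Suc n)) \<in> graph F}))"
    by (rule compact_Int_closed)
  moreover have "PiE (UNIV::nat set) (\<lambda>_. {0..1::real}) \<inter> (\<Inter>n. {x. (x n, x (Suc n)) \<in> graph F}) = trajectories F"
    using trajectory_unit by (auto simp: trajectories_iff)
  ultimately show ?thesis by simp
qed

lemma edges_subset: "edges F \<subseteq> alph F \<times> alph F"
  by (auto simp: edges_def)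

lemma edges_iff: "(a, b) \<in> edges F \<longleftrightarrow> a \<in> alph F \<and> b \<in> alph F \<and> Dom0 F b \<subseteq> Ran0 F a"
  by (auto simp: edges_def trans_matrix_def)

lemma sft_iff: "s \<in> sft F \<longleftrightarrow> (\<forall>n. (s n, s (Suc n)) \<in> edges F)"
  by (auto simp: edges_def sft_def)

lemma trajectory_code:
  assumes x: "x \<in> trajectories F"
  shows "\<exists>s\<in>sft F. \<forall>n. (x n, x (Suc n)) \<in> graph0_of F (s n)"
proof -
  have "\<forall>n. \<exists>a. a \<in> alph F \<and> (x n, x (Suc n)) \<in> graph0_of F a"
    using x graph_code unfolding trajectories_iff by blast
  from choice[OF this] obtain s where s: "\<And>n. s n \<in> alph F" "\<And>n. (x n, x (Suc n)) \<in> graph0_of F (s n)" by blast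
  have "(s n, s (Suc n)) \<in> edges F" for n
    unfolding edges_iff
    using s(1)[of n] s(1)[of "Suc n"] graph0_iff[OF s(1) s(2), of n] graph0_iff[OF s(1) s(2), of "Suc n"]
      Dom0_subset_Ran0 by blast
  then show ?thesis using s(2) sft_iff by blast
qed

text \<open>A trajectory following a given word is determined by its last point, each earlier point being a
  monotone function of it. With the orientation reversed where this function is decreasing, the sum of
  the labels is monotone in the last point and therefore determines all labels.\<close>

lemma card_labels_word:
  fixes w :: "'a list"
  assumes w: "\<And>k. k < n \<Longrightarrow> w ! k \<in> alph F"
  defines "A \<equiv> {x \<in> trajectories F. \<forall>k<n. (x k, x (Suc k)) \<in> graph_of F (w ! k)}"
  shows "card ((\<lambda>x. map (\<lambda>i. cell_index q (x i)) [0..<Suc n]) ` A) \<le> Suc n * q + 1"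
    and "finite ((\<lambda>x. map (\<lambda>i. cell_index q (x i)) [0..<Suc n]) ` A)"
proof -
  define up where "up i \<longleftrightarrow> (\<forall>x\<in>A. \<forall>y\<in>A. x n \<le> y n \<longrightarrow> x i \<le> y i)" for i
  define dn where "dn i \<longleftrightarrow> (\<forall>x\<in>A. \<forall>y\<in>A. x n \<le> y n \<longrightarrow> y i \<le> x i)" for i
  have mon: "up i \<or> dn i" if "i \<le> n" for i
    using that
  proof (induction rule: inc_induct)
    case base
    show ?case by (simp add: up_def)
  next
    case (step i)
    have gr: "(x i, x (Suc i)) \<in> graph_of F (w ! i)" if "x \<in> A" for x using that step by (simp add: A_def)
    from graph_of_monotone[OF w[OF step(2)]] show ?case
    proof
      assume m: "\<forall>x y x' y'. (x, y) \<in> graph_of F (w ! i) \<longrightarrow> (x', y') \<in> graph_of F (w ! i) \<longrightarrow> y \<le> y' \<longrightarrow> x \<le> x'"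
      then have "x i \<le> y i" if "x \<in> A" "y \<in> A" "x (Suc i) \<le> y (Suc i)" for x y using gr that by blast
      then show ?thesis using step(3) unfolding up_def dn_def by blast
    next
      assume m: "\<forall>x y x' y'. (x, y) \<in> graph_of F (w ! i) \<longrightarrow> (x', y') \<in> graph_of F (w ! i) \<longrightarrow> y \<le> y' \<longrightarrow> x' \<le> x"
      then have "y i \<le> x i" if "x \<in> A" "y \<in> A" "x (Suc i) \<le> y (Suc i)" for x y using gr that by blast
      then show ?thesis using step(3) unfolding up_def dn_def by blast
    qed
  qed
  define h where "h i x = (if up i then cell_index q (x i) else q - cell_index q (x i))" for i and x :: "nat \<Rightarrow> real"
  define S where "S x = (\<Sum>i\<le>n. h i x)" for x
  have labq: "cell_index q (x i) \<le> q" if "x \<in> A" for x i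
    using that trajectory_unit[of x i] by (intro cell_index_le) (auto simp: A_def)
  have h_mono: "h i x \<le> h i y" if "x \<in> A" "y \<in> A" "x n \<le> y n" "i \<le> n" for i x y
  proof (cases "up i")
    case True
    then show ?thesis using that by (auto simp: h_def up_def intro: cell_index_mono)
  next
    case False
    then have "y i \<le> x i" using mon[OF that(4)] that by (auto simp: dn_def)
    then show ?thesis using False by (auto simp: h_def intro: diff_le_mono2 cell_index_mono)
  qed
  have S_le: "S x \<le> Suc n * q" if "x \<in> A" for x
  proof -
    have "S x \<le> (\<Sum>i\<le>n. q)" unfolding S_def by (rule sum_mono) (use labq[OF that] in \<open>auto simp: h_def\<close>)
    then show ?thesis by simp
  qed
  have inj: "cell_index q (x i) = cell_index q (y i)" if "x \<in> A" "y \<in> A" "x n \<le> y n" "S x = S y" "i \<le> n" for x y i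
  proof -
    have "h i x = h i y"
      by (rule sum_mono_inv[of "\<lambda>i. h i x" "{..n}" "\<lambda>i. h i y"])
         (use that h_mono[OF that(1,2,3)] in \<open>auto simp: S_def\<close>)
    then show ?thesis using labq[OF that(1), of i] labq[OF that(2), of i] by (auto simp: h_def split: if_splits)
  qed
  have SA: "S ` A \<subseteq> {..Suc n * q}" using S_le by auto
  have fin: "finite (S ` A)" using SA by (rule finite_subset) simp
  have fac: "map (\<lambda>i. cell_index q (x i)) [0..<Suc n] = map (\<lambda>i. cell_index q (y i)) [0..<Suc n]"
    if xy: "x \<in> A" "y \<in> A" "S x = S y" for x y
  proof -
    have "cell_index q (x i) = cell_index q (y i)" if "i \<le> n" for i
      using inj[OF xy(1,2) _ xy(3) that] inj[OF xy(2,1) _ xy(3)[symmetric] that] by (cases "x n \<le> y n") auto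
    then show ?thesis by (intro map_cong) auto
  qed
  show "finite ((\<lambda>x. map (\<lambda>i. cell_index q (x i)) [0..<Suc n]) ` A)"
    using fin fac by (rule card_image_factor(2))
  have "card ((\<lambda>x. map (\<lambda>i. cell_index q (x i)) [0..<Suc n]) ` A) \<le> card (S ` A)"
    using fin fac by (rule card_image_factor(1))
  also have "\<dots> \<le> card {..Suc n * q}" using SA by (intro card_mono) auto
  finally show "card ((\<lambda>x. map (\<lambda>i. cell_index q (x i)) [0..<Suc n]) ` A) \<le> Suc n * q + 1" by simp
qed

lemma card_labels:
  defines "lv n q \<equiv> (\<lambda>x. map (\<lambda>i. cell_index q (x i)) [0..<Suc n])"
  shows "card (lv n q ` trajectories F) \<le>
      (\<Sum>i\<in>alph F. \<Sum>j\<in>alph F. num_walks (edges F) (alph F) n i j) * (Suc n * q + 1)"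
    and "finite (lv n q ` trajectories F)"
proof -
  let ?W = "\<Union>i\<in>alph F. \<Union>j\<in>alph F. walks (edges F) (alph F) n i j"
  define A where "A w = {x \<in> trajectories F. \<forall>k<n. (x k, x (Suc k)) \<in> graph_of F (w ! k)}" for w
  have fin: "finite ?W" using finite_alph by (auto intro: finite_walks)
  have cW: "card ?W \<le> (\<Sum>i\<in>alph F. \<Sum>j\<in>alph F. num_walks (edges F) (alph F) n i j)"
  proof -
    have "card ?W \<le> (\<Sum>i\<in>alph F. card (\<Union>j\<in>alph F. walks (edges F) (alph F) n i j))"
      using finite_alph by (rule card_UN_le)
    also have "\<dots> \<le> (\<Sum>i\<in>alph F. \<Sum>j\<in>alph F. card (walks (edges F) (alph F) n i j))"
      using finite_alph by (intro sum_mono card_UN_le)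
    finally show ?thesis using finite_alph by (simp add: card_walks)
  qed
  have walkA: "w ! k \<in> alph F" if "w \<in> ?W" "k < n" for w k
  proof -
    from that(1) obtain i j where "i \<in> alph F" "w \<in> walks (edges F) (alph F) n i j" by blast
    from walks_set[OF this(2,1)] walks_length[OF this(2)] that(2) show ?thesis
      by (metis less_Suc_eq nth_mem subsetD)
  qed
  have sub: "lv n q ` trajectories F \<subseteq> (\<Union>w\<in>?W. lv n q ` A w)"
  proof (rule image_subsetI)
    fix x assume x: "x \<in> trajectories F"
    then obtain s where s: "s \<in> sft F" "\<And>n. (x n, x (Suc n)) \<in> graph0_of F (s n)" using trajectory_code by blast
    define w where "w = map s [0..<Suc n]"
    have sa: "s k \<in> alph F" for k using s(1) by (simp add: sft_def)
    have "w \<in> walks (edges F) (alph F) n (s 0) (s n)"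
      unfolding w_def by (rule seq_in_walks) (use s(1) sa sft_iff in auto)
    then have "w \<in> ?W" using sa by blast
    moreover have "w ! k = s k" if "k < n" for k using that by (simp add: w_def nth_append)
    then have "x \<in> A w" using x s(2) graph0_subset by (auto simp: A_def)
    ultimately show "lv n q x \<in> (\<Union>w\<in>?W. lv n q ` A w)" by blast
  qed
  have finA: "finite (lv n q ` A w)" if "w \<in> ?W" for w
    unfolding lv_def A_def by (rule card_labels_word(2)) (rule walkA[OF that])
  have fin2: "finite (\<Union>w\<in>?W. lv n q ` A w)" using fin finA by blast
  show "finite (lv n q ` trajectories F)" using sub fin2 by (rule finite_subset)
  have "card (lv n q ` trajectories F) \<le> card (\<Union>w\<in>?W. lv n q ` A w)" using fin2 sub by (rule card_mono)
  also have "\<dots> \<le> (\<Sum>w\<in>?W. card (lv n q ` A w))" using fin by (rule card_UN_le)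
  also have "\<dots> \<le> (\<Sum>w\<in>?W. Suc n * q + 1)"
    by (rule sum_mono, unfold lv_def A_def, rule card_labels_word(1), rule walkA)
  also have "\<dots> = card ?W * (Suc n * q + 1)" by simp
  also have "\<dots> \<le> (\<Sum>i\<in>alph F. \<Sum>j\<in>alph F. num_walks (edges F) (alph F) n i j) * (Suc n * q + 1)"
    using cW by (rule mult_le_mono1)
  finally show "card (lv n q ` trajectories F) \<le>
      (\<Sum>i\<in>alph F. \<Sum>j\<in>alph F. num_walks (edges F) (alph F) n i j) * (Suc n * q + 1)" .
qed

lemma lebesgue_labels:
  assumes cover: "open_cover (trajectory_space F) \<U>"
  obtains k q where "q > 0"
    "\<And>x. x \<in> trajectories F \<Longrightarrow> \<exists>U\<in>\<U>. \<forall>y\<in>trajectories F. (\<forall>i\<le>k. cell_index q (y i) = cell_index q (x i)) \<longrightarrow> y \<in> U"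
proof -
  define \<G> where "\<G> = {G. open G \<and> trajectories F \<inter> G \<in> \<U>}"
  have cov: "\<Union>\<U> = trajectories F" "\<And>U. U \<in> \<U> \<Longrightarrow> openin (top_of_set (trajectories F)) U"
    using cover by (simp_all add: open_cover_def trajectory_space_eq)
  have sub: "trajectories F \<subseteq> \<Union>\<G>"
  proof
    fix x assume x: "x \<in> trajectories F"
    then obtain U where U: "U \<in> \<U>" "x \<in> U" unfolding cov(1)[symmetric] by (rule UnionE)
    obtain G where G: "open G" "U = trajectories F \<inter> G" using cov(2)[OF U(1)] by (auto simp: openin_open)
    then show "x \<in> \<Union>\<G>" using U by (intro UnionI[of G]) (auto simp: \<G>_def)
  qed
  obtain e where e: "e > 0" "\<And>x. x \<in> trajectories F \<Longrightarrow> \<exists>G\<in>\<G>. ball x e \<subseteq> G"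
    by (rule Heine_Borel_lemma[OF compact_trajectories sub]) (auto simp: \<G>_def)
  obtain N where N: "(1/2 :: real) ^ N < e / 2"
    using real_arch_pow_inv[of "e / 2" "1/2"] e(1) by auto
  obtain q :: nat where "max 1 (4 / e) < real q" using reals_Archimedean2 by blast
  then have q: "q > 0" "4 / e < real q" by (auto intro: gr0I)
  define k where "k = Max ((from_nat :: nat \<Rightarrow> nat) ` {..N})"
  have k: "from_nat i \<le> k" if "i \<le> N" for i :: nat
    unfolding k_def using that by (intro Max_ge) auto
  have close: "dist x y < e"
    if xy: "x \<in> trajectories F" "y \<in> trajectories F" "\<forall>i\<le>k. cell_index q (y i) = cell_index q (x i)" for x y
  proof -
    have each: "dist (x (from_nat i)) (y (from_nat i)) \<le> 1 / real q" if "i \<le> N" for i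
      using cell_index_eq_dist[of q "x (from_nat i)" "y (from_nat i)"] xy k[OF that] q(1)
        trajectory_unit[OF xy(1), of "from_nat i"] trajectory_unit[OF xy(2), of "from_nat i"]
      by (simp add: dist_real_def)
    have "{dist (x (from_nat n)) (y (from_nat n)) |n. n \<le> N} = (\<lambda>n. dist (x (from_nat n)) (y (from_nat n))) ` {..N}"
      by auto
    then have "Max {dist (x (from_nat n)) (y (from_nat n)) |n. n \<le> N} \<le> 1 / real q"
      using each by (simp add: Max_le_iff)
    moreover have "1 / real q < e / 4" using q e(1) by (simp add: field_simps)
    ultimately show ?thesis using dist_fun_le_dist_first_terms[of x y N] N by linarith
  qed
  show thesis
  proof (rule that[OF q(1)])
    fix x assume x: "x \<in> trajectories F"
    then obtain G where G: "G \<in> \<G>" "ball x e \<subseteq> G" using e(2) by blast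
    show "\<exists>U\<in>\<U>. \<forall>y\<in>trajectories F. (\<forall>i\<le>k. cell_index q (y i) = cell_index q (x i)) \<longrightarrow> y \<in> U"
    proof (rule bexI[of _ "trajectories F \<inter> G"])
      show "trajectories F \<inter> G \<in> \<U>" using G by (simp add: \<G>_def)
      show "\<forall>y\<in>trajectories F. (\<forall>i\<le>k. cell_index q (y i) = cell_index q (x i)) \<longrightarrow> y \<in> trajectories F \<inter> G"
        using close[OF x] G(2) by (auto simp: subset_eq)
    qed
  qed
qed

lemma top_entropy_trajectories_le:
  assumes y: "\<And>a. a \<in> alph F \<Longrightarrow> y a > 0" "\<And>a. a \<in> alph F \<Longrightarrow> adj_apply (edges F) (alph F) y a \<le> l * y a"
    and l: "l \<ge> 1"
  shows "top_entropy (trajectory_space F) shift \<le> ereal (ln l)"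
proof (rule top_entropy_le)
  fix \<U> assume cover: "open_cover (trajectory_space F) \<U>"
  obtain k q where q: "q > 0" and leb: "\<And>x. x \<in> trajectories F \<Longrightarrow>
      \<exists>U\<in>\<U>. \<forall>y\<in>trajectories F. (\<forall>i\<le>k. cell_index q (y i) = cell_index q (x i)) \<longrightarrow> y \<in> U"
    using lebesgue_labels[OF cover] by metis
  have l0: "l \<ge> 0" using l by simp
  obtain K' where K': "K' > 0" "\<And>n. real (\<Sum>i\<in>alph F. \<Sum>j\<in>alph F. num_walks (edges F) (alph F) n i j) \<le> K' * l ^ n"
    by (rule num_walks_upper[OF finite_alph y l0]) auto
  define K where "K = max 1 K'"
  define h where "h n = K * l ^ (n + k) * (real (Suc (n + k)) * real q + 1)" for n
  define lv where "lv n = (\<lambda>x :: nat \<Rightarrow> real. map (\<lambda>i. cell_index q (x i)) [0..<Suc n])" for n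
  have "real (cover_number (trajectory_space F) (iterated_join (trajectory_space F) shift \<U> n)) \<le> h n" for n
  proof -
    have "cover_number (trajectory_space F) (iterated_join (trajectory_space F) shift \<U> n)
        \<le> card (lv (n + k) ` topspace (trajectory_space F))"
    proof (rule cover_number_join_le)
      show "finite (lv (n + k) ` topspace (trajectory_space F))"
        unfolding topspace_trajectories lv_def by (rule card_labels(2))
      fix x assume "x \<in> topspace (trajectory_space F)"
      then have x: "x \<in> trajectories F" by (simp add: topspace_trajectories)
      have "\<forall>i. \<exists>U. U \<in> \<U> \<and> (\<forall>y\<in>trajectories F. (\<forall>j\<le>k. cell_index q (y j) = cell_index q ((shift ^^ i) x j)) \<longrightarrow> y \<in> U)"
      proof
        fix i
        have "(shift ^^ i) x \<in> trajectories F" by (rule funpow_in[OF shift_trajectory x])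
        from leb[OF this] show "\<exists>U. U \<in> \<U> \<and> (\<forall>y\<in>trajectories F. (\<forall>j\<le>k. cell_index q (y j) = cell_index q ((shift ^^ i) x j)) \<longrightarrow> y \<in> U)"
          by blast
      qed
      from choice[OF this] obtain W where W: "\<And>i. W i \<in> \<U>"
        "\<And>i y. y \<in> trajectories F \<Longrightarrow> (\<forall>j\<le>k. cell_index q (y j) = cell_index q ((shift ^^ i) x j)) \<Longrightarrow> y \<in> W i" by blast
      show "\<exists>W. \<forall>i<n. W i \<in> \<U> \<and> (\<forall>y\<in>topspace (trajectory_space F). lv (n + k) y = lv (n + k) x \<longrightarrow> (shift ^^ i) y \<in> W i)"
      proof (intro exI[of _ W] allI impI conjI ballI W(1))
        fix i y assume i: "i < n" and y: "y \<in> topspace (trajectory_space F)" "lv (n + k) y = lv (n + k) x"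
        have y': "y \<in> trajectories F" using y(1) by (simp add: topspace_trajectories)
        have same: "cell_index q (y j) = cell_index q (x j)" if "j \<le> n + k" for j
          using y(2) that unfolding lv_def map_eq_conv by (simp del: upt_Suc)
        show "(shift ^^ i) y \<in> W i"
        proof (rule W(2))
          show "(shift ^^ i) y \<in> trajectories F" by (rule funpow_in[OF shift_trajectory y'])
          show "\<forall>j\<le>k. cell_index q ((shift ^^ i) y j) = cell_index q ((shift ^^ i) x j)"
            using same i by (simp add: shift_funpow)
        qed
      qed
    qed
    also have "card (lv (n + k) ` topspace (trajectory_space F))
        \<le> (\<Sum>i\<in>alph F. \<Sum>j\<in>alph F. num_walks (edges F) (alph F) (n + k) i j) * (Suc (n + k) * q + 1)"
      unfolding topspace_trajectories lv_def by (rule card_labels(1))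
    finally have "real (cover_number (trajectory_space F) (iterated_join (trajectory_space F) shift \<U> n))
        \<le> real ((\<Sum>i\<in>alph F. \<Sum>j\<in>alph F. num_walks (edges F) (alph F) (n + k) i j) * (Suc (n + k) * q + 1))"
      by (simp only: of_nat_le_iff)
    also have "\<dots> = real (\<Sum>i\<in>alph F. \<Sum>j\<in>alph F. num_walks (edges F) (alph F) (n + k) i j) * (real (Suc (n + k)) * real q + 1)"
      by (simp only: of_nat_mult of_nat_add of_nat_1)
    also have "\<dots> \<le> (K * l ^ (n + k)) * (real (Suc (n + k)) * real q + 1)"
    proof (rule mult_right_mono)
      have "K' * l ^ (n + k) \<le> K * l ^ (n + k)" using l unfolding K_def by (intro mult_right_mono) auto
      then show "real (\<Sum>i\<in>alph F. \<Sum>j\<in>alph F. num_walks (edges F) (alph F) (n + k) i j) \<le> K * l ^ (n + k)"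
        using K'(2)[of "n + k"] by linarith
    qed simp
    finally show ?thesis by (simp add: h_def)
  qed
  moreover have "1 \<le> h n" for n
  proof -
    have "1 * 1 \<le> (K * l ^ (n + k)) * (real (Suc (n + k)) * real q + 1)"
    proof (rule mult_mono)
      have "1 * 1 \<le> K * l ^ (n + k)" using l by (intro mult_mono one_le_power) (auto simp: K_def)
      then show "1 \<le> K * l ^ (n + k)" by simp
      then show "0 \<le> K * l ^ (n + k)" by linarith
    qed auto
    then show ?thesis by (simp add: h_def)
  qed
  moreover have "(\<lambda>n. ln (h n) / real n) \<longlonglongrightarrow> ln l"
  proof -
    have "ln (h n) = ln K + real (n + k) * ln l + ln (real (Suc (n + k)) * real q + 1)" for n
    proof -
      have pos: "K > 0" "l ^ (n + k) > 0" "real (Suc (n + k)) * real q + 1 > 0"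
        using l by (auto simp: K_def intro: add_nonneg_pos)
      have "ln (h n) = ln (K * l ^ (n + k)) + ln (real (Suc (n + k)) * real q + 1)"
        unfolding h_def using pos by (intro ln_mult_pos mult_pos_pos)
      also have "ln (K * l ^ (n + k)) = ln K + ln (l ^ (n + k))"
        using pos by (intro ln_mult_pos)
      also have "ln (l ^ (n + k)) = real (n + k) * ln l" using l by (simp add: ln_realpow)
      finally show ?thesis .
    qed
    then show ?thesis using log_growth_limit[of "real q" "ln K" k "ln l"] q by simp
  qed
  ultimately show "\<exists>h. (\<forall>n. real (cover_number (trajectory_space F) (iterated_join (trajectory_space F) shift \<U> n)) \<le> h n \<and> 1 \<le> h n) \<and>
      (\<lambda>n. ln (h n) / real n) \<longlonglongrightarrow> ln l" by (intro exI[of _ h]) blast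
qed

end

section \<open>Lower bounds\<close>

lemma growth_rate_limit:
  fixes h :: ereal and c :: "nat \<Rightarrow> nat"
  assumes l: "l > 1" and K: "K > 0"
    and cnt: "\<And>n. \<exists>L. n \<le> L \<and> L \<le> n + D \<and> K * l ^ n \<le> real (c L)"
    and h: "\<And>L. L \<ge> 1 \<Longrightarrow> c L \<ge> 1 \<Longrightarrow> ereal (ln (real (c L)) / real (N + L)) \<le> h"
  shows "ereal (ln l) \<le> h"
proof -
  have "(\<lambda>n. (ln K + real n * ln l) / (real N + real n + real D)) \<longlonglongrightarrow> ln l"
    by real_asymp
  then have lim: "(\<lambda>n. ereal ((ln K + real n * ln l) / (real N + real n + real D))) \<longlonglongrightarrow> ereal (ln l)"
    by simp
  obtain n0 where n0: "1 / K < l ^ n0" using real_arch_pow[OF l] by blast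
  have "ereal ((ln K + real n * ln l) / (real N + real n + real D)) \<le> h" if n: "n \<ge> max 1 n0" for n
  proof -
    obtain L where L: "n \<le> L" "L \<le> n + D" "K * l ^ n \<le> real (c L)" using cnt by blast
    have "l ^ n0 \<le> l ^ n" using n l by (intro power_increasing) auto
    then have "1 / K < l ^ n" using n0 by linarith
    then have big: "1 \<le> K * l ^ n" using K by (simp add: divide_less_eq mult.commute)
    then have c1: "1 \<le> real (c L)" using L(3) by linarith
    have "ln K + real n * ln l = ln (K * l ^ n)" using K l by (simp add: ln_mult_pos ln_realpow)
    also have "\<dots> \<le> ln (real (c L))" using L(3) big by (subst ln_le_cancel_iff) linarith+
    finally have "(ln K + real n * ln l) / (real N + real n + real D) \<le> ln (real (c L)) / (real N + real n + real D)"
      by (rule divide_right_mono) simp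
    also have "\<dots> \<le> ln (real (c L)) / real (N + L)"
      using L(1,2) n c1 by (intro divide_left_mono mult_pos_pos) auto
    finally have "ereal ((ln K + real n * ln l) / (real N + real n + real D)) \<le> ereal (ln (real (c L)) / real (N + L))"
      by simp
    also have "\<dots> \<le> h" using L(1) n c1 by (intro h) auto
    finally show ?thesis .
  qed
  then have "\<forall>\<^sub>F n in sequentially. ereal ((ln K + real n * ln l) / (real N + real n + real D)) \<le> h"
    unfolding eventually_sequentially by blast
  from tendsto_upperbound[OF lim this] show ?thesis by simp
qed

definition concat_seq :: "nat \<Rightarrow> (nat \<Rightarrow> 'a list) \<Rightarrow> nat \<Rightarrow> 'a" where
  "concat_seq P t n = t (n div P) ! (n mod P)"

lemma concat_seq_block:
  assumes t: "\<And>j. t j \<in> walks r C P b b" and P: "P \<ge> 1" and i: "i \<le> P"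
  shows "concat_seq P t (j * P + i) = t j ! i"
proof (cases "i = P")
  case True
  have "j * P + P = Suc j * P" by simp
  moreover have "concat_seq P t (Suc j * P) = t (Suc j) ! 0"
    unfolding concat_seq_def using P by (simp del: mult_Suc)
  ultimately show ?thesis using True walks_first[OF t] walks_last[OF t] by metis
next
  case False
  then show ?thesis unfolding concat_seq_def using i P by simp
qed

lemma concat_seq_edges:
  assumes t: "\<And>j. t j \<in> walks r C P b b" and P: "P \<ge> 1" and b: "b \<in> C"
  shows "(concat_seq P t n, concat_seq P t (Suc n)) \<in> r" "concat_seq P t n \<in> C"
proof -
  define j i where "j = n div P" and "i = n mod P"
  have n: "n = j * P + i" and i: "i < P" using P by (auto simp: j_def i_def)
  have n': "Suc n = j * P + Suc i" using n by simp
  have blk: "concat_seq P t (j * P + i) = t j ! i" if "i \<le> P" for i j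
    by (rule concat_seq_block[OF t P that])
  have a: "concat_seq P t n = t j ! i" "concat_seq P t (Suc n) = t j ! Suc i"
    unfolding n' using n blk[of i j] blk[of "Suc i" j] i by auto
  show "(concat_seq P t n, concat_seq P t (Suc n)) \<in> r" unfolding a using walks_edge[OF t i] .
  show "concat_seq P t n \<in> C" unfolding a
    using walks_set[OF t b] walks_length[OF t, of j] i by (metis less_SucI nth_mem subsetD)
qed

lemma walks_eqI:
  assumes "t \<in> walks r C P b b" "t' \<in> walks r C P b b" "\<And>i. i < P \<Longrightarrow> t ! i = t' ! i"
  shows "t = t'"
proof (rule nth_equalityI)
  fix i assume "i < length t"
  then have "i < P \<or> i = P" using walks_length[OF assms(1)] by auto
  then show "t ! i = t' ! i" using assms(3) walks_last[OF assms(1)] walks_last[OF assms(2)] by auto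
qed (use walks_length[OF assms(1)] walks_length[OF assms(2)] in simp)

lemma walks_append:
  "v \<in> walks r C N a b \<Longrightarrow> t \<in> walks r C L b c \<Longrightarrow> b \<in> C \<Longrightarrow> v @ tl t \<in> walks r C (N + L) a c"
proof (induction N arbitrary: v a)
  case 0
  then have "v = [a]" "a = b" by (auto split: if_splits)
  moreover have "a # tl t = t" using walks_first[OF 0(2)] walks_length[OF 0(2)] \<open>a = b\<close>
    by (cases t) auto
  ultimately show ?case using 0 by simp
qed auto

lemma (in markov) subshift_topspace: "S \<subseteq> sft F \<Longrightarrow> topspace (subshift_space F S) = S"
  by (auto simp: subshift_space_def sft_def PiE_iff)

lemma (in markov) top_entropy_sft_ge:
  assumes C: "C \<subseteq> D" "D \<subseteq> alph F" and conn: "\<And>a b. a \<in> C \<Longrightarrow> b \<in> C \<Longrightarrow> (a, b) \<in> (edges F \<inter> C \<times> C)\<^sup>*"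
    and ne: "C \<noteq> {}"
    and x: "\<And>i. i \<in> C \<Longrightarrow> x i > 0" "\<And>i. i \<in> C \<Longrightarrow> adj_apply (edges F) C x i = l * x i" and l: "l > 1"
  shows "ereal (ln l) \<le> top_entropy (subshift_space F (sft_on F D)) shift"
proof -
  have finC: "finite C" using C finite_alph by (meson finite_subset)
  obtain b where b: "b \<in> C" using ne by blast
  let ?S = "sft_on F D" and ?r = "edges F"
  have S: "topspace (subshift_space F ?S) = ?S" by (rule subshift_topspace) (auto simp: sft_on_def)
  obtain K E where K: "K > 0"
    "\<And>n. \<exists>L. n \<le> L \<and> L \<le> n + E \<and> K * l ^ n \<le> real (num_walks ?r C L b b)"
    by (rule num_walks_lower[OF finC conn x b b]) auto
  show ?thesis
  proof (rule growth_rate_limit[OF l K, where N = 0])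
    fix L assume L: "L \<ge> 1" and c1: "num_walks ?r C L b b \<ge> 1"
    let ?I = "walks ?r C L b b"
    have fin: "finite ?I" by (rule finite_walks[OF finC])
    have card: "card ?I = num_walks ?r C L b b" by (rule card_walks[OF finC])
    define Kt where "Kt t = {s \<in> ?S. \<forall>i\<le>L. s i = t ! i}" for t
    have "ereal (ln (real (card ?I)) / real L) \<le> top_entropy (subshift_space F ?S) shift"
    proof (rule top_entropy_ge_blocks[where K = Kt])
      show "finite ?I" by (rule fin)
      show "?I \<noteq> {}" using c1 card by (metis card.empty not_one_le_zero)
      show "L \<ge> 1" by (rule L)
      show "shift s \<in> topspace (subshift_space F ?S)" if "s \<in> topspace (subshift_space F ?S)" for s
        using that unfolding S by (auto simp: sft_on_def sft_iff shift_def)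
      show "closedin (subshift_space F ?S) (Kt t)" if t: "t \<in> ?I" for t
      proof -
        let ?X = "product_topology (\<lambda>_. discrete_topology (alph F)) UNIV"
        have ta: "t ! i \<in> alph F" if "i \<le> L" for i
          using walks_set[OF t b] walks_length[OF t] that C by (metis le_imp_less_Suc nth_mem subsetD)
        have "closedin ?X {s \<in> topspace ?X. s i \<in> {t ! i}}" if "i \<le> L" for i
          by (rule closedin_continuous_map_preimage[OF continuous_map_product_projection])
             (use ta[OF that] in auto)
        then have "closedin ?X (\<Inter>i\<in>{..L}. {s \<in> topspace ?X. s i \<in> {t ! i}})"
          by (intro closedin_INT) auto
        moreover have "Kt t = (\<Inter>i\<in>{..L}. {s \<in> topspace ?X. s i \<in> {t ! i}}) \<inter> ?S"
          by (auto simp: Kt_def sft_on_def sft_def PiE_iff)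
        ultimately show ?thesis unfolding subshift_space_def closedin_subtopology by blast
      qed
      show "Kt s \<inter> Kt t = {}" if "s \<in> ?I" "t \<in> ?I" "s \<noteq> t" for s t
      proof (rule ccontr)
        assume "Kt s \<inter> Kt t \<noteq> {}"
        then have "s ! i = t ! i" if "i < L" for i using that by (auto simp: Kt_def)
        then show False using walks_eqI[OF \<open>s \<in> ?I\<close> \<open>t \<in> ?I\<close>] \<open>s \<noteq> t\<close> by blast
      qed
      fix m :: nat and t :: "nat \<Rightarrow> 'a list" assume t: "\<And>j. t j \<in> ?I"
      let ?s = "concat_seq L t"
      have s: "?s \<in> ?S" using concat_seq_edges[OF t L b] C by (auto simp: sft_on_def sft_iff)
      show "\<exists>x\<in>topspace (subshift_space F ?S). \<forall>j<m. (shift ^^ (j * L)) x \<in> Kt (t j)"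
      proof (rule bexI[of _ ?s], intro allI impI)
        fix j assume "j < m"
        have "(shift ^^ (j * L)) ?s \<in> ?S"
          using s unfolding shift_funpow by (auto simp: sft_on_def sft_iff)
        moreover have "?s (j * L + i) = t j ! i" if "i \<le> L" for i
          by (rule concat_seq_block[OF t L that])
        then have "(shift ^^ (j * L)) ?s i = t j ! i" if "i \<le> L" for i
          using that by (simp add: shift_funpow add.commute)
        ultimately show "(shift ^^ (j * L)) ?s \<in> Kt (t j)" by (simp add: Kt_def)
      qed (use s S in simp)
    qed
    then show "ereal (ln (real (num_walks ?r C L b b)) / real (0 + L)) \<le> top_entropy (subshift_space F ?S) shift"
      by (simp add: card)
  qed
qed

context markov
begin

lemma trajectory_from:
  assumes "t \<in> {0..1}"
  shows "\<exists>x\<in>trajectories F. x 0 = t"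
proof -
  have "\<forall>t\<in>{0..1}. \<exists>y. (t, y) \<in> graph F" using graph_total by blast
  from bchoice[OF this] obtain f where f: "\<And>t. t \<in> {0..1} \<Longrightarrow> (t, f t) \<in> graph F" by blast
  define x where "x n = (f ^^ n) t" for n
  have "f t \<in> {0..1}" if "t \<in> {0..1}" for t using graph_unit[OF f[OF that]] by blast
  then have "x n \<in> {0..1}" for n unfolding x_def by (rule funpow_in) (use assms in auto)
  then have "x \<in> trajectories F" unfolding trajectories_iff using f by (simp add: x_def)
  moreover have "x 0 = t" by (simp add: x_def)
  ultimately show ?thesis by blast
qed

lemma realize_word:
  assumes "\<And>k. k < n \<Longrightarrow> (s k, s (Suc k)) \<in> edges F" "\<And>k. k \<le> n \<Longrightarrow> s k \<in> alph F"
  shows "\<exists>x\<in>trajectories F. (\<forall>k<n. (x k, x (Suc k)) \<in> graph0_of F (s k)) \<and> (\<forall>k\<le>n. x k \<in> Dom0 F (s k))"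
  using assms
proof (induction n arbitrary: s)
  case 0
  then obtain t where t: "t \<in> Dom0 F (s 0)" using Dom0_nonempty[of "s 0"] by auto
  then have "t \<in> {0..1}" using Dom_unit[of "s 0"] Dom0_subset[of "s 0"] 0(2)[of 0] by blast
  from trajectory_from[OF this] t show ?case by auto
next
  case (Suc n)
  have "\<exists>x\<in>trajectories F. (\<forall>k<n. (x k, x (Suc k)) \<in> graph0_of F (s (Suc k))) \<and> (\<forall>k\<le>n. x k \<in> Dom0 F (s (Suc k)))"
    by (rule Suc.IH) (use Suc.prems in auto)
  then obtain x where x: "x \<in> trajectories F" "\<And>k. k < n \<Longrightarrow> (x k, x (Suc k)) \<in> graph0_of F (s (Suc k))"
    "\<And>k. k \<le> n \<Longrightarrow> x k \<in> Dom0 F (s (Suc k))" by blast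
  have s0: "s 0 \<in> alph F" using Suc.prems(2)[of 0] by simp
  have "x 0 \<in> Ran0 F (s 0)" using Suc.prems(1)[of 0] x(3)[of 0] by (auto simp: edges_iff)
  then obtain y where y: "(y, x 0) \<in> graph0_of F (s 0)" using graph0_backward[OF s0] by blast
  define z where "z = case_nat y x"
  have z: "z 0 = y" "z (Suc k) = x k" for k by (simp_all add: z_def)
  have "z \<in> trajectories F" unfolding trajectories_iff
  proof
    fix k show "(z k, z (Suc k)) \<in> graph F"
      using graph0_graph[OF s0 y] x(1) by (cases k) (auto simp: z trajectories_iff)
  qed
  moreover have "(z k, z (Suc k)) \<in> graph0_of F (s k)" if "k < Suc n" for k
    using that y x(2) by (cases k) (auto simp: z)
  moreover have "z k \<in> Dom0 F (s k)" if "k \<le> Suc n" for k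
    using that graph0_iff(1)[OF s0 y] x(3) by (cases k) (auto simp: z)
  ultimately show ?case by blast
qed

lemma closedin_trajectories: "closed S \<Longrightarrow> closedin (trajectory_space F) (trajectories F \<inter> S)"
  unfolding trajectory_space_eq by (auto simp: closedin_closed)

lemma top_entropy_ge_point_blocks:
  assumes b: "b \<in> C" "b \<notin> alph0 F" and C: "C \<subseteq> alph F" and L: "L \<ge> 1" and ne: "walks (edges F) C L b b \<noteq> {}"
  shows "ereal (ln (real (card (walks (edges F) C L b b))) / real L) \<le> top_entropy (trajectory_space F) shift"
proof -
  let ?I = "walks (edges F) C L b b"
  have finC: "finite C" using C finite_alph by (rule finite_subset)
  have ba: "b \<in> alph F" using b C by blast
  obtain p where p: "Dom F b = {p}" using Dom_alph12[OF ba b(2)] by blast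
  then have p0: "Dom0 F b = {p}" using b by (simp add: Dom0_def)
  have "\<forall>t\<in>?I. \<exists>x. (\<forall>k<L. (x k, x (Suc k)) \<in> graph0_of F (t ! k)) \<and> x 0 = p \<and> x L = p"
  proof
    fix t assume t: "t \<in> ?I"
    have "t ! k \<in> alph F" if "k \<le> L" for k
      using walks_set[OF t b(1)] walks_length[OF t] that C by (metis le_imp_less_Suc nth_mem subsetD)
    from realize_word[of L "\<lambda>k. t ! k", OF walks_edge[OF t] this]
    obtain x where x: "\<forall>k<L. (x k, x (Suc k)) \<in> graph0_of F (t ! k)" "\<forall>k\<le>L. x k \<in> Dom0 F (t ! k)" by blast
    have "x 0 = p" "x L = p" using x(2)[rule_format, of 0] x(2)[rule_format, of L] walks_first[OF t] walks_last[OF t] p0 by auto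
    then show "\<exists>x. (\<forall>k<L. (x k, x (Suc k)) \<in> graph0_of F (t ! k)) \<and> x 0 = p \<and> x L = p" using x(1) by blast
  qed
  from bchoice[OF this] obtain \<xi> where \<xi>: "\<And>t k. t \<in> ?I \<Longrightarrow> k < L \<Longrightarrow> (\<xi> t k, \<xi> t (Suc k)) \<in> graph0_of F (t ! k)"
    "\<And>t. t \<in> ?I \<Longrightarrow> \<xi> t 0 = p" "\<And>t. t \<in> ?I \<Longrightarrow> \<xi> t L = p" by blast
  have ta: "t ! k \<in> alph F" if "t \<in> ?I" "k < L" for t k
    using walks_set[OF that(1) b(1)] walks_length[OF that(1)] that(2) C by (metis less_SucI nth_mem subsetD)
  define Kt where "Kt t = trajectories F \<inter> (\<Inter>i\<in>{..L}. {x. x i = \<xi> t i})" for t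
  show ?thesis
  proof (rule top_entropy_ge_blocks[where K = Kt])
    show "finite ?I" by (rule finite_walks[OF finC])
    show "shift x \<in> topspace (trajectory_space F)" if "x \<in> topspace (trajectory_space F)" for x
      using that by (simp add: topspace_trajectories shift_trajectory)
    show "closedin (trajectory_space F) (Kt t)" if "t \<in> ?I" for t
      unfolding Kt_def by (intro closedin_trajectories closed_INT ballI closed_Collect_eq
        continuous_on_product_coordinates continuous_on_const)
    show "Kt s \<inter> Kt t = {}" if st: "s \<in> ?I" "t \<in> ?I" "s \<noteq> t" for s t
    proof (rule ccontr)
      assume "Kt s \<inter> Kt t \<noteq> {}"
      then obtain x where "x \<in> Kt s" "x \<in> Kt t" by blast
      then have x: "\<And>i. i \<le> L \<Longrightarrow> x i = \<xi> s i" "\<And>i. i \<le> L \<Longrightarrow> x i = \<xi> t i" by (auto simp: Kt_def)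
      have "s ! i = t ! i" if i: "i < L" for i
      proof (rule graph_code_unique)
        show "(x i, x (Suc i)) \<in> graph0_of F (s ! i)" using \<xi>(1)[OF st(1) i] x(1)[of i] x(1)[of "Suc i"] i by simp
        show "(x i, x (Suc i)) \<in> graph0_of F (t ! i)" using \<xi>(1)[OF st(2) i] x(2)[of i] x(2)[of "Suc i"] i by simp
      qed (use ta st i in auto)
      then show False using walks_eqI[OF st(1,2)] st(3) by blast
    qed
    fix m :: nat and t :: "nat \<Rightarrow> 'a list" assume t: "\<And>j. t j \<in> ?I"
    define x where "x n = \<xi> (t (n div L)) (n mod L)" for n
    have blk: "x (j * L + i) = \<xi> (t j) i" if i: "i \<le> L" for i j
    proof (cases "i = L")
      case True
      have "x (Suc j * L) = \<xi> (t (Suc j)) 0" unfolding x_def using L by (simp del: mult_Suc)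
      then show ?thesis using True \<xi>(2,3)[OF t] by (simp add: add.commute)
    next
      case False
      then show ?thesis unfolding x_def using i L by simp
    qed
    have x: "x \<in> trajectories F" unfolding trajectories_iff
    proof
      fix n
      define j i where "j = n div L" and "i = n mod L"
      have n: "n = j * L + i" and i: "i < L" using L by (auto simp: j_def i_def)
      have n': "Suc n = j * L + Suc i" using n by simp
      have "x n = \<xi> (t j) i" "x (Suc n) = \<xi> (t j) (Suc i)"
        unfolding n' using n blk[of i j] blk[of "Suc i" j] i by auto
      then show "(x n, x (Suc n)) \<in> graph F" using graph0_graph[OF ta[OF t i] \<xi>(1)[OF t i]] by simp
    qed
    show "\<exists>x\<in>topspace (trajectory_space F). \<forall>j<m. (shift ^^ (j * L)) x \<in> Kt (t j)"
    proof (rule bexI[of _ x], intro allI impI)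
      fix j assume "j < m"
      have "(shift ^^ (j * L)) x \<in> trajectories F" by (rule funpow_in[OF shift_trajectory x])
      then show "(shift ^^ (j * L)) x \<in> Kt (t j)"
        using blk[of _ j] by (simp add: Kt_def shift_funpow add.commute)
    qed (use x topspace_trajectories in simp)
  qed (use L ne in auto)
qed

lemma word_interval_mem:
  assumes "\<And>k. k < length w \<Longrightarrow> w ! k \<in> alph F" "w \<noteq> []"
    "\<And>k. Suc k < length w \<Longrightarrow> (y k, y (Suc k)) \<in> graph_of F (w ! k)" "y (length w - 1) \<in> Dom F (last w)"
  shows "y 0 \<in> word_interval F w"
  using assms
proof (induction w arbitrary: y)
  case (Cons a w)
  show ?case
  proof (cases "w = []")
    case True
    then show ?thesis using Cons.prems by (simp add: word_interval_def)
  next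
    case False
    have "y (Suc 0) \<in> word_interval F w"
    proof (rule Cons.IH[of "\<lambda>k. y (Suc k)"])
      show "w ! k \<in> alph F" if "k < length w" for k using Cons.prems(1)[of "Suc k"] that by simp
      show "(y (Suc k), y (Suc (Suc k))) \<in> graph_of F (w ! k)" if "Suc k < length w" for k
        using Cons.prems(3)[of "Suc k"] that by simp
      show "y (Suc (length w - 1)) \<in> Dom F (last w)" using Cons.prems(4) False by simp
    qed (use False in simp)
    moreover have "y 0 = branch_inv F a (y (Suc 0))"
    proof -
      have g: "(y 0, y (Suc 0)) \<in> graph_of F a" using Cons.prems(3)[of 0] False by simp
      have a: "a \<in> alph F" using Cons.prems(1)[of 0] by simp
      show ?thesis
      proof (cases "a \<in> alph0 F")
        case True
        then show ?thesis using graph_of_alph0[OF True g] branch_inj[OF True] by (simp add: branch_inv_def)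
      next
        case False
        then show ?thesis using g Dom_alph12[OF a False] by (auto simp: branch_inv_def graph_of_def)
      qed
    qed
    ultimately show ?thesis using False by (simp add: word_interval_def)
  qed
qed simp

lemma top_entropy_ge_avoiding_blocks:
  assumes C: "C \<subseteq> alph0 F" and v: "v \<in> walks (edges F) C N a b" "word_interval F v \<inter> pts F = {}"
    and ab: "a \<in> C" "b \<in> C" and L: "L \<ge> 1" and ne: "walks (edges F) C L b a \<noteq> {}"
  shows "ereal (ln (real (card (walks (edges F) C L b a))) / real (N + L)) \<le> top_entropy (trajectory_space F) shift"
proof -
  let ?I = "(\<lambda>t. v @ tl t) ` walks (edges F) C L b a"
  define P where "P = N + L"
  have P: "P \<ge> 1" "N < P" using L by (auto simp: P_def)
  have Ca: "C \<subseteq> alph F" using C by (auto simp: alph_def)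
  have finC: "finite C" using Ca finite_alph by (rule finite_subset)
  have lv: "length v = Suc N" by (rule walks_length[OF v(1)])
  have inj: "inj_on (\<lambda>t. v @ tl t) (walks (edges F) C L b a)"
  proof (rule inj_onI)
    fix t t' assume t: "t \<in> walks (edges F) C L b a" "t' \<in> walks (edges F) C L b a" "v @ tl t = v @ tl t'"
    have "t = b # tl t" "t' = b # tl t'"
      using walks_first[OF t(1)] walks_first[OF t(2)] walks_length[OF t(1)] walks_length[OF t(2)]
      by (metis Suc_length_conv list.sel(3) nth_Cons_0)+
    then show "t = t'" using t(3) by simp
  qed
  have IW: "t \<in> walks (edges F) C P a a" if "t \<in> ?I" for t
    using that walks_append[OF v(1) _ ab(2)] by (auto simp: P_def)
  have Iv: "t ! i = v ! i" if "t \<in> ?I" "i \<le> N" for t i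
    using that lv by (auto simp: nth_append)
  have tC: "t ! k \<in> C" if "t \<in> ?I" "k < P" for t k
    using walks_set[OF IW[OF that(1)] ab(1)] walks_length[OF IW[OF that(1)]] that(2) by (metis less_SucI nth_mem subsetD)
  have vC: "v ! k \<in> C" if "k \<le> N" for k
    using walks_set[OF v(1) ab(1)] lv that by (metis le_imp_less_Suc nth_mem subsetD)
  define W where "W t k = (if k < P then t ! k else v ! (k - P))" for t k
  have WC: "W t k \<in> C" if "t \<in> ?I" "k \<le> P + N" for t k
    unfolding W_def using tC[OF that(1), of k] vC[of "k - P"] that(2) by auto
  define Kt where "Kt t = trajectories F \<inter> ((\<Inter>k\<in>{..<P + N}. {x. (x k, x (Suc k)) \<in> graph_of F (W t k)}) \<inter>
      {x. (x (P + N), x (P + N)) \<in> Dom F (v ! N) \<times> UNIV})" for t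
  have code: "(x k, x (Suc k)) \<in> graph0_of F (t ! k)" if t: "t \<in> ?I" and x: "x \<in> Kt t" and k: "k < P" for t x k
  proof -
    have gr: "(x k, x (Suc k)) \<in> graph_of F (W t k)" if "k < P + N" for k using x that by (auto simp: Kt_def)
    have "x P \<in> word_interval F v"
    proof -
      have "(\<lambda>i. x (P + i)) 0 \<in> word_interval F v"
      proof (rule word_interval_mem)
        show "v ! k \<in> alph F" if "k < length v" for k using vC[of k] Ca that lv by auto
        show "v \<noteq> []" using lv by auto
        show "(x (P + k), x (P + Suc k)) \<in> graph_of F (v ! k)" if "Suc k < length v" for k
          using gr[of "P + k"] that lv by (simp add: W_def)
        have "v \<noteq> []" using lv by auto
        then have "last v = v ! N" using lv last_conv_nth[of v] by simp
        then show "x (P + (length v - 1)) \<in> Dom F (last v)" using x lv by (auto simp: Kt_def)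
      qed
      then show ?thesis by simp
    qed
    then have xP: "x P \<notin> pts F" using v(2) by blast
    have "x k \<notin> pts F" if "k \<le> P" for k
      using that
    proof (induction rule: inc_induct)
      case base
      show ?case by (rule xP)
    next
      case (step k)
      have "W t k \<in> alph0 F" using WC[OF t, of k] step(2) C by auto
      from graph_of_alph0_not_pts(2)[OF this gr[of k]] step show ?case by auto
    qed
    moreover have "W t k \<in> alph0 F" using WC[OF t, of k] k C by auto
    ultimately have "(x k, x (Suc k)) \<in> graph0_of F (W t k)"
      using graph_of_alph0_not_pts(1)[of "W t k" "x k" "x (Suc k)"] gr[of k] k by simp
    then show ?thesis using k by (simp add: W_def)
  qed
  have "ereal (ln (real (card ?I)) / real P) \<le> top_entropy (trajectory_space F) shift"
  proof (rule top_entropy_ge_blocks[where K = Kt])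
    show "finite ?I" using finite_walks[OF finC] by blast
    show "shift x \<in> topspace (trajectory_space F)" if "x \<in> topspace (trajectory_space F)" for x
      using that by (simp add: topspace_trajectories shift_trajectory)
    show "closedin (trajectory_space F) (Kt t)" if t: "t \<in> ?I" for t
    proof -
      have "closed (graph_of F (W t k))" if "k < P + N" for k
        using closed_graph_of WC[OF t, of k] that Ca by auto
      moreover have "v ! N \<in> alph0 F" using vC[of N] C by auto
      then obtain l u where "Dom F (v ! N) = {l..u}" using Dom_alph0 by blast
      then have "closed (Dom F (v ! N) \<times> (UNIV :: real set))" by (simp add: closed_Times)
      ultimately show ?thesis
        unfolding Kt_def by (intro closedin_trajectories closed_Int closed_INT ballI closed_pair) auto
    qed
    show "Kt s \<inter> Kt t = {}" if st: "s \<in> ?I" "t \<in> ?I" "s \<noteq> t" for s t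
    proof (rule ccontr)
      assume "Kt s \<inter> Kt t \<noteq> {}"
      then obtain x where x: "x \<in> Kt s" "x \<in> Kt t" by blast
      have "s ! i = t ! i" if i: "i < P" for i
        using graph_code_unique[OF code[OF st(1) x(1) i] code[OF st(2) x(2) i]] tC[OF st(1) i] tC[OF st(2) i] Ca by blast
      then show False using walks_eqI[OF IW[OF st(1)] IW[OF st(2)]] st(3) by blast
    qed
    fix m :: nat and t :: "nat \<Rightarrow> 'a list" assume t: "\<And>j. t j \<in> ?I"
    have tW: "\<And>j. t j \<in> walks (edges F) C P a a" using IW t by blast
    let ?s = "concat_seq P t" and ?n = "m * P + N"
    have "\<exists>x\<in>trajectories F. (\<forall>k<?n. (x k, x (Suc k)) \<in> graph0_of F (?s k)) \<and> (\<forall>k\<le>?n. x k \<in> Dom0 F (?s k))"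
    proof (rule realize_word)
      show "(?s k, ?s (Suc k)) \<in> edges F" for k by (rule concat_seq_edges(1)[OF tW P(1) ab(1)])
      show "?s k \<in> alph F" for k using concat_seq_edges(2)[OF tW P(1) ab(1)] Ca by (rule subsetD[rotated])
    qed
    then obtain x where x: "x \<in> trajectories F" "\<forall>k<?n. (x k, x (Suc k)) \<in> graph0_of F (?s k)"
      "\<forall>k\<le>?n. x k \<in> Dom0 F (?s k)" by (elim bexE conjE) (rule that)
    show "\<exists>x\<in>topspace (trajectory_space F). \<forall>j<m. (shift ^^ (j * P)) x \<in> Kt (t j)"
    proof (rule bexI[of _ x], intro allI impI)
      fix j assume j: "j < m"
      have "Suc j * P \<le> m * P" using j by (intro mult_le_mono1) simp
      then have jn: "j * P + (P + N) \<le> ?n" by simp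
      have blk: "?s (j * P + i) = t j ! i" if "i \<le> P" for i j
        by (rule concat_seq_block[OF tW P(1) that])
      have sW: "?s (j * P + k) = W (t j) k" if "k \<le> P + N" for k
      proof (cases "k < P")
        case True
        then show ?thesis using blk[of k j] by (simp add: W_def)
      next
        case False
        have "j * P + k = Suc j * P + (k - P)" using False by simp
        then have "?s (j * P + k) = t (Suc j) ! (k - P)"
          using blk[of "k - P" "Suc j"] that P(2) by simp
        then show ?thesis using Iv[OF t, of "k - P" "Suc j"] that False by (simp add: W_def)
      qed
      have "(shift ^^ (j * P)) x \<in> trajectories F" by (rule funpow_in[OF shift_trajectory x(1)])
      moreover have "(x (k + j * P), x (Suc k + j * P)) \<in> graph_of F (W (t j) k)" if "k < P + N" for k
        using x(2)[rule_format, of "j * P + k"] sW[of k] graph0_subset that jn by (auto simp: add.commute)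
      moreover have "x (P + N + j * P) \<in> Dom F (v ! N)"
        using x(3)[rule_format, of "j * P + (P + N)"] sW[of "P + N"] Dom0_subset jn by (auto simp: add.commute W_def)
      ultimately show "(shift ^^ (j * P)) x \<in> Kt (t j)"
        unfolding Kt_def by (auto simp: shift_funpow)
    qed (use x topspace_trajectories in simp)
  qed (use P ne in auto)
  then show ?thesis by (simp add: card_image[OF inj] P_def)
qed

end

section \<open>Entropies in the class are logarithms of Perron numbers\<close>

context markov
begin

lemma edge_Dom_Ran:
  assumes "(a, b) \<in> edges F"
  shows "Dom F b \<subseteq> Ran F a"
proof -
  have ab: "a \<in> alph F" "b \<in> alph F" "Dom0 F b \<subseteq> Ran F a" using assms Ran0_subset by (auto simp: edges_iff)
  show ?thesis
  proof (cases "b \<in> alph0 F")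
    case True
    then obtain l u where lu: "l < u" "Dom F b = {l..u}" using Dom_alph0 by blast
    have "closed (Ran F a)" using ab(1) by (cases rule: Ran0_cases) auto
    then have "closure {l<..<u} \<subseteq> Ran F a"
      using ab(3) Dom0_alph0[OF True lu(2)] by (intro closure_minimal) auto
    then show ?thesis using lu by simp
  next
    case False
    then show ?thesis using ab by (simp add: Dom0_def)
  qed
qed

lemma branch_inv_Dom:
  assumes a: "a \<in> alph F" and y: "y \<in> Ran F a"
  shows "branch_inv F a y \<in> Dom F a"
proof (cases "a \<in> alph0 F")
  case True
  have "y \<in> branch F a ` Dom F a" using y unfolding branch_monotone(2)[OF True] .
  from inv_into_into[OF this] show ?thesis using True by (simp add: branch_inv_def)
next
  case False
  obtain q where "Dom F a = {q}" using Dom_alph12[OF a False] by blast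
  then show ?thesis using False by (simp add: branch_inv_def)
qed

lemma word_interval_decreasing:
  assumes "s \<in> sft F" "m \<le> n"
  shows "word_interval F (map s [0..<Suc n]) \<subseteq> word_interval F (map s [0..<Suc m])"
  using assms(2)
proof (induction rule: dec_induct)
  case (step n)
  let ?g = "\<lambda>a S. branch_inv F a ` S"
  have mono: "foldr ?g w S \<subseteq> foldr ?g w S'" if "S \<subseteq> S'" for w S S'
    using that by (induction w) auto
  have e: "(s n, s (Suc n)) \<in> edges F" using assms(1) by (simp add: sft_iff)
  have "word_interval F (map s [0..<Suc (Suc n)]) = foldr ?g (map s [0..<n]) (branch_inv F (s n) ` Dom F (s (Suc n)))"
    by (simp add: word_interval_def butlast_append)
  also have "\<dots> \<subseteq> foldr ?g (map s [0..<n]) (Dom F (s n))"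
    using edge_Dom_Ran[OF e] branch_inv_Dom[of "s n"] e by (intro mono) (auto simp: edges_iff)
  also have "\<dots> = word_interval F (map s [0..<Suc n])" by (simp add: word_interval_def)
  finally show ?case using step by blast
qed simp

lemma avoiding_walk:
  assumes u: "avoiding_word F C u" and C: "C \<subseteq> alph F" and succ: "\<And>c. c \<in> C \<Longrightarrow> \<exists>d\<in>C. (c, d) \<in> edges F"
  obtains N a b v where "a \<in> C" "b \<in> C" "v \<in> walks (edges F) C N a b" "word_interval F v \<inter> pts F = {}"
proof -
  have uC: "u \<noteq> []" "set u \<subseteq> C" "\<And>i. Suc i < length u \<Longrightarrow> (u ! i, u ! Suc i) \<in> edges F"
    using u C by (auto simp: avoiding_word_def language_on_def language_def edges_def)
  obtain nxt where nxt: "\<And>c. c \<in> C \<Longrightarrow> nxt c \<in> C \<and> (c, nxt c) \<in> edges F" using succ by metis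
  define g where "g n = (nxt ^^ n) (last u)" for n
  have last: "last u \<in> C" using uC by auto
  have gC: "g n \<in> C" for n unfolding g_def by (rule funpow_in) (use nxt last in auto)
  have gS: "(g n, g (Suc n)) \<in> edges F" for n using nxt[OF gC[of n]] by (simp add: g_def)
  define s where "s n = (if n < length u then u ! n else g (Suc n - length u))" for n
  have sC: "s n \<in> C" for n using uC(2) gC by (auto simp: s_def)
  have se: "(s n, s (Suc n)) \<in> edges F" for n
  proof -
    consider "Suc n < length u" | "Suc n = length u" | "length u \<le> n" by linarith
    then show ?thesis
    proof cases
      case 1
      then show ?thesis using uC(3) by (simp add: s_def)
    next
      case 2
      then have "u ! n = g 0" using uC(1) by (simp add: g_def last_conv_nth flip: 2)
      then show ?thesis using 2 gS[of 0] by (simp add: s_def flip: 2)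
    next
      case 3
      then show ?thesis using gS[of "Suc n - length u"] by (simp add: s_def Suc_diff_le)
    qed
  qed
  have s: "s \<in> sft F" using se by (simp add: sft_iff)
  then have "s \<in> cylinder F u" by (auto simp: cylinder_def s_def)
  then have empty: "seq_interval F s \<inter> pts F = {}" using u by (auto simp: avoiding_word_def)
  have "\<forall>p\<in>pts F. \<exists>n. p \<notin> word_interval F (map s [0..<Suc n])"
    using empty unfolding seq_interval_def by blast
  from bchoice[OF this] obtain n where n: "\<And>p. p \<in> pts F \<Longrightarrow> p \<notin> word_interval F (map s [0..<Suc (n p)])" by blast
  define N where "N = Max (insert 0 (n ` pts F))"
  have "n p \<le> N" if "p \<in> pts F" for p unfolding N_def using finite_pts that by (intro Max_ge) auto
  then have "word_interval F (map s [0..<Suc N]) \<inter> pts F = {}"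
    using n word_interval_decreasing[OF s] by blast
  moreover have "map s [0..<Suc N] \<in> walks (edges F) C N (s 0) (s N)"
    by (rule seq_in_walks) (use se sC in auto)
  ultimately show thesis using that sC by blast
qed

lemma scc_of_component:
  assumes "i \<in> alph F"
  shows "irreducible_component F (scc_of (edges F) i)"
  unfolding irreducible_component_def strongly_connected_def
proof (intro conjI allI impI ballI)
  let ?C = "scc_of (edges F) i"
  show "?C \<noteq> {}" using scc_of_self by fast
  show "?C \<subseteq> alph F" by (rule scc_of_subset[OF edges_subset assms])
  show "(a, b) \<in> (edges F \<inter> ?C \<times> ?C)\<^sup>*" if "a \<in> ?C" "b \<in> ?C" for a b by (rule scc_of_connected[OF that])
  fix C' assume C': "(C' \<noteq> {} \<and> C' \<subseteq> alph F \<and> (\<forall>a\<in>C'. \<forall>b\<in>C'. (a, b) \<in> (edges F \<inter> C' \<times> C')\<^sup>*)) \<and> ?C \<subseteq> C'"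
  then have i: "i \<in> C'" using scc_of_self by fast
  have "(edges F \<inter> C' \<times> C')\<^sup>* \<subseteq> (edges F)\<^sup>*" by (rule rtrancl_mono) auto
  then have "b \<in> ?C" if "b \<in> C'" for b using C' i that unfolding scc_of_def by blast
  then show "C' = ?C" using C' by blast
qed

lemma component_entropy_pos:
  assumes i: "i \<in> alph F" and C: "C = scc_of (edges F) i"
    and x: "\<And>j. j \<in> C \<Longrightarrow> x j > 0" "\<And>j. j \<in> C \<Longrightarrow> adj_apply (edges F) C x j = l * x j" and l: "l > 1"
  shows "positive_entropy_component F C" "top_entropy (subshift_space F (sft F)) shift > 0"
proof -
  have Ca: "C \<subseteq> alph F" unfolding C by (rule scc_of_subset[OF edges_subset i])
  have conn: "\<And>a b. a \<in> C \<Longrightarrow> b \<in> C \<Longrightarrow> (a, b) \<in> (edges F \<inter> C \<times> C)\<^sup>*" unfolding C by (rule scc_of_connected)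
  have ne: "C \<noteq> {}" unfolding C using scc_of_self by fast
  have pos: "0 < ereal (ln l)" using l by simp
  have ge: "ereal (ln l) \<le> top_entropy (subshift_space F (sft_on F D)) shift" if "C \<subseteq> D" "D \<subseteq> alph F" for D
    by (rule top_entropy_sft_ge[OF that conn ne x l]) auto
  show "positive_entropy_component F C"
    unfolding positive_entropy_component_def
    using scc_of_component[OF i] less_le_trans[OF pos ge[OF order_refl Ca]] unfolding C[symmetric] by blast
  have "sft_on F (alph F) = sft F" by (auto simp: sft_on_def sft_def)
  then show "top_entropy (subshift_space F (sft F)) shift > 0"
    using less_le_trans[OF pos ge[OF Ca order_refl]] by simp
qed

lemma top_entropy_trajectories_ge:
  assumes i: "i \<in> alph F" and C: "C = scc_of (edges F) i"
    and x: "\<And>j. j \<in> C \<Longrightarrow> x j > 0" "\<And>j. j \<in> C \<Longrightarrow> adj_apply (edges F) C x j = l * x j" and l: "l > 1"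
    and av: "C \<subseteq> alph0 F \<Longrightarrow> \<exists>u. avoiding_word F C u"
  shows "ereal (ln l) \<le> top_entropy (trajectory_space F) shift"
proof -
  have Ca: "C \<subseteq> alph F" unfolding C by (rule scc_of_subset[OF edges_subset i])
  have finC: "finite C" using Ca finite_alph by (rule finite_subset)
  have conn: "\<And>a b. a \<in> C \<Longrightarrow> b \<in> C \<Longrightarrow> (a, b) \<in> (edges F \<inter> C \<times> C)\<^sup>*" unfolding C by (rule scc_of_connected)
  have counts: "\<exists>K D. K > 0 \<and> (\<forall>n. \<exists>L. n \<le> L \<and> L \<le> n + D \<and> K * l ^ n \<le> real (num_walks (edges F) C L b b'))"
    if "b \<in> C" "b' \<in> C" for b b'
    by (rule num_walks_lower[OF finC conn x that]) auto
  have ne: "walks (edges F) C L b b' \<noteq> {}" if "num_walks (edges F) C L b b' \<ge> 1" for L b b'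
    using that card_walks[OF finC, of "edges F" L b b'] by auto
  show ?thesis
  proof (cases "C \<subseteq> alph0 F")
    case False
    then obtain b where b: "b \<in> C" "b \<notin> alph0 F" by blast
    obtain K D where K: "K > 0" "\<And>n. \<exists>L. n \<le> L \<and> L \<le> n + D \<and> K * l ^ n \<le> real (num_walks (edges F) C L b b)"
      using counts[OF b(1) b(1)] by blast
    show ?thesis
    proof (rule growth_rate_limit[OF l K, where N = 0])
      fix L assume L: "L \<ge> 1" "num_walks (edges F) C L b b \<ge> 1"
      show "ereal (ln (real (num_walks (edges F) C L b b)) / real (0 + L)) \<le> top_entropy (trajectory_space F) shift"
        using top_entropy_ge_point_blocks[OF b Ca L(1) ne[OF L(2)]] by (simp add: card_walks[OF finC])
    qed
  next
    case True
    then obtain u where u: "avoiding_word F C u" using av by blast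
    have "\<exists>d\<in>C. (c, d) \<in> edges F" if "c \<in> C" for c
    proof (rule ccontr)
      assume "\<not> ?thesis"
      then have e: "{j \<in> C. (c, j) \<in> edges F} = {}" by blast
      have "adj_apply (edges F) C x c = 0" unfolding adj_apply_def e by simp
      then show False using x[OF that] l by simp
    qed
    then obtain N a b v where v: "a \<in> C" "b \<in> C" "v \<in> walks (edges F) C N a b" "word_interval F v \<inter> pts F = {}"
      by (rule avoiding_walk[OF u Ca])
    obtain K D where K: "K > 0" "\<And>n. \<exists>L. n \<le> L \<and> L \<le> n + D \<and> K * l ^ n \<le> real (num_walks (edges F) C L b a)"
      using counts[OF v(2) v(1)] by blast
    show ?thesis
    proof (rule growth_rate_limit[OF l K, where N = N])
      fix L assume L: "L \<ge> 1" "num_walks (edges F) C L b a \<ge> 1"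
      show "ereal (ln (real (num_walks (edges F) C L b a)) / real (N + L)) \<le> top_entropy (trajectory_space F) shift"
        using top_entropy_ge_avoiding_blocks[OF True v(3,4,1,2) L(1) ne[OF L(2)]] by (simp add: card_walks[OF finC])
    qed
  qed
qed

lemma alph_nonempty: "alph F \<noteq> {}"
  using graph_total[of 0] graph_code by fastforce

end

lemma entropies_F_subset:
  assumes "r \<in> entropies_F"
  shows "\<exists>q l. r = of_rat q * ln l \<and> (q :: rat) > 0 \<and> l > 1 \<and> perron_number l"
proof -
  obtain F :: "nat multi_map" where F: "r > 0" "class_F F" "top_entropy (trajectory_space F) shift = ereal r"
    using assms by (auto simp: entropies_F_def)
  interpret markov F by unfold_locales (use F(2) in \<open>simp_all add: class_F_def\<close>)
  obtain i l x where i: "i \<in> alph F" "l \<ge> 0" and x: "\<And>j. j \<in> scc_of (edges F) i \<Longrightarrow> x j > 0"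
    "\<And>j. j \<in> scc_of (edges F) i \<Longrightarrow> adj_apply (edges F) (scc_of (edges F) i) x j = l * x j"
    and super: "\<And>l'. l' > l \<Longrightarrow> \<exists>y. \<forall>j\<in>alph F. y j > 0 \<and> adj_apply (edges F) (alph F) y j \<le> l' * y j"
    using dominant_component[OF finite_alph alph_nonempty edges_subset] by metis
  have upper: "r \<le> ln l'" if l': "l' > l" "l' \<ge> 1" for l'
  proof -
    obtain y where y: "\<forall>j\<in>alph F. y j > 0 \<and> adj_apply (edges F) (alph F) y j \<le> l' * y j" using super[OF l'(1)] by blast
    have "top_entropy (trajectory_space F) shift \<le> ereal (ln l')"
      by (rule top_entropy_trajectories_le[of y]) (use y l' in auto)
    then show ?thesis using F(3) by simp
  qed
  have l1: "l > 1"
  proof (rule ccontr)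
    assume "\<not> l > 1"
    have "exp (r / 2) > 1" using F(1) by simp
    then have "r \<le> ln (exp (r / 2))" using \<open>\<not> l > 1\<close> by (intro upper) linarith+
    then show False using F(1) by simp
  qed
  have "r \<le> ln l"
  proof (rule ccontr)
    assume "\<not> r \<le> ln l"
    then have "exp (ln l) < exp r" by simp
    then have "l < exp r" using l1 by simp
    then obtain l' where l': "l < l'" "l' < exp r" using dense by blast
    have "r \<le> ln l'" using l' l1 by (intro upper) auto
    moreover have "ln l' < r" using l' l1 ln_less_cancel_iff[of l' "exp r"] by simp
    ultimately show False by simp
  qed
  moreover have "ln l \<le> r"
  proof -
    let ?C = "scc_of (edges F) i"
    have "positive_entropy_component F ?C" by (rule component_entropy_pos(1)[OF i(1) refl x l1])
    then have av: "\<exists>u. avoiding_word F ?C u" if "?C \<subseteq> alph0 F" using F(2) that by (simp add: class_F_def)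
    have "ereal (ln l) \<le> top_entropy (trajectory_space F) shift"
      by (rule top_entropy_trajectories_ge[OF i(1) refl x l1 av])
    then show ?thesis using F(3) by simp
  qed
  ultimately have r: "r = ln l" by simp
  have C: "finite (scc_of (edges F) i)" "scc_of (edges F) i \<noteq> {}"
    using finite_subset[OF scc_of_subset[OF edges_subset i(1)] finite_alph] scc_of_self[of i "edges F"] by auto
  obtain p where p: "p \<ge> 1" "perron_number (l ^ p)"
    by (rule component_eigenvalue_perron[OF C scc_of_connected x less_imp_le[OF l1]])
  show ?thesis
  proof (intro exI conjI)
    show "r = of_rat (1 / of_nat p) * ln (l ^ p)"
      using p l1 by (simp add: r ln_realpow of_rat_divide)
    show "(0 :: rat) < 1 / of_nat p" using p by simp
    show "1 < l ^ p" using l1 p by (intro one_less_power) auto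
    show "perron_number (l ^ p)" by (rule p(2))
  qed
qed

section \<open>Realization\<close>

primrec mat_power :: "'v set \<Rightarrow> ('v \<Rightarrow> 'v \<Rightarrow> nat) \<Rightarrow> nat \<Rightarrow> 'v \<Rightarrow> 'v \<Rightarrow> nat" where
  "mat_power S B 0 p q = of_bool (p = q)"
| "mat_power S B (Suc k) p q = (\<Sum>s\<in>S. B p s * mat_power S B k s q)"

lemma mat_power_eigen:
  assumes S: "finite S" and x: "\<And>p. p \<in> S \<Longrightarrow> (\<Sum>q\<in>S. real (B p q) * x q) = L * x p" and p: "p \<in> S"
  shows "(\<Sum>q\<in>S. real (mat_power S B k p q) * x q) = L ^ k * x p"
  using p
proof (induction k arbitrary: p)
  case 0
  have "(\<Sum>q\<in>S. real (mat_power S B 0 p q) * x q) = (\<Sum>q\<in>S. if q = p then x q else 0)"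
    by (rule sum.cong) auto
  then show ?case using S 0 by simp
next
  case (Suc k)
  have "(\<Sum>q\<in>S. real (mat_power S B (Suc k) p q) * x q)
      = (\<Sum>q\<in>S. \<Sum>s\<in>S. real (B p s) * (real (mat_power S B k s q) * x q))"
    by (simp add: sum_distrib_right mult.assoc)
  also have "\<dots> = (\<Sum>s\<in>S. \<Sum>q\<in>S. real (B p s) * (real (mat_power S B k s q) * x q))" by (rule sum.swap)
  also have "\<dots> = (\<Sum>s\<in>S. real (B p s) * (L ^ k * x s))"
    by (rule sum.cong[OF refl]) (simp add: Suc.IH flip: sum_distrib_left)
  also have "\<dots> = L ^ k * (\<Sum>s\<in>S. real (B p s) * x s)" by (simp add: sum_distrib_left mult_ac)
  finally show ?case using x[OF Suc.prems] by simp
qed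

text \<open>Replacing every arrow of the multigraph by a path of \<open>n\<close> arrows takes the \<open>n\<close>-th root of the
  eigenvalue and, as \<open>n \<ge> 2\<close>, leaves no multiple arrows.\<close>

lemma subdivision_graph:
  fixes B :: "'v \<Rightarrow> 'v \<Rightarrow> nat"
  assumes S: "finite S" "S \<noteq> {}" and x: "\<And>p. p \<in> S \<Longrightarrow> x p > 0"
    "\<And>p. p \<in> S \<Longrightarrow> (\<Sum>q\<in>S. real (B p q) * x q) = \<mu> ^ n * x p" and n: "n \<ge> 2" and \<mu>: "\<mu> > 0"
  obtains V :: "('v + 'v \<times> 'v \<times> nat \<times> nat) set" and r y where "finite V" "V \<noteq> {}" "r \<subseteq> V \<times> V"
    "\<And>v. v \<in> V \<Longrightarrow> y v > (0::real)" "\<And>v. v \<in> V \<Longrightarrow> adj_apply r V y v = \<mu> * y v"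
proof -
  define W where "W = (SIGMA p:S. SIGMA q:S. {..<B p q} \<times> {1..<n})"
  define V :: "('v + 'v \<times> 'v \<times> nat \<times> nat) set" where "V = Inl ` S \<union> Inr ` W"
  define r where "r = {(Inl p, Inr (p, q, e, 1)) | p q e. p \<in> S \<and> q \<in> S \<and> e < B p q} \<union>
    {(Inr (p, q, e, k), Inr (p, q, e, Suc k)) | p q e k. (p, q, e, k) \<in> W \<and> Suc k < n} \<union>
    {(Inr (p, q, e, n - 1), Inl q) | p q e. (p, q, e, n - 1) \<in> W}"
  define y where "y v = (case v of Inl p \<Rightarrow> x p | Inr (p, q, e, k) \<Rightarrow> x q * \<mu> ^ k / \<mu> ^ n)"
    for v :: "'v + 'v \<times> 'v \<times> nat \<times> nat"
  have fW: "finite W" unfolding W_def using S by auto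
  show thesis
  proof (rule that[of V r y])
    show "finite V" using S fW by (simp add: V_def)
    show "V \<noteq> {}" using S by (simp add: V_def)
    show "r \<subseteq> V \<times> V" using n by (auto simp: r_def V_def W_def)
    show "y v > 0" if "v \<in> V" for v using that x(1) \<mu> by (auto simp: V_def W_def y_def)
    fix v assume v: "v \<in> V"
    show "adj_apply r V y v = \<mu> * y v"
    proof (cases v)
      case (Inl p)
      then have p: "p \<in> S" using v by (auto simp: V_def)
      define f :: "'v \<times> nat \<Rightarrow> 'v + 'v \<times> 'v \<times> nat \<times> nat" where "f = (\<lambda>(q, e). Inr (p, q, e, 1))"
      have img: "{w \<in> V. (v, w) \<in> r} = f ` (SIGMA q:S. {..<B p q})"
        using n p by (auto simp: Inl r_def V_def W_def f_def)
      have inj: "inj_on f (SIGMA q:S. {..<B p q})"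
        by (auto simp: inj_on_def f_def)
      have "adj_apply r V y v = sum (y \<circ> f) (SIGMA q:S. {..<B p q})"
        unfolding adj_apply_def img by (rule sum.reindex[OF inj])
      also have "\<dots> = (\<Sum>(q, e)\<in>(SIGMA q:S. {..<B p q}). x q * \<mu> / \<mu> ^ n)"
        by (rule sum.cong) (auto simp: y_def f_def)
      also have "\<dots> = (\<Sum>q\<in>S. \<Sum>e\<in>{..<B p q}. x q * \<mu> / \<mu> ^ n)"
        using S by (subst sum.Sigma) auto
      also have "\<dots> = \<mu> / \<mu> ^ n * (\<Sum>q\<in>S. real (B p q) * x q)" by (simp add: sum_distrib_left mult_ac)
      also have "\<dots> = \<mu> * x p" using x(2)[OF p] \<mu> by simp
      finally show ?thesis by (simp add: Inl y_def)
    next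
      case (Inr w)
      obtain p q e k where w: "w = (p, q, e, k)" by (metis prod_cases4)
      have W: "(p, q, e, k) \<in> W" using v Inr w by (auto simp: V_def)
      show ?thesis
      proof (cases "Suc k < n")
        case True
        have "{u \<in> V. (v, u) \<in> r} = {Inr (p, q, e, Suc k)}"
          using W True by (auto simp: Inr w r_def V_def W_def)
        then show ?thesis using \<mu> unfolding adj_apply_def by (simp add: Inr w y_def)
      next
        case False
        then have k: "n = Suc k" using W by (auto simp: W_def)
        have "{u \<in> V. (v, u) \<in> r} = {Inl q}"
          using W k by (auto simp: Inr w r_def V_def W_def)
        then show ?thesis using \<mu> k unfolding adj_apply_def by (simp add: Inr w y_def)
      qed
    qed
  qed
qed

lemma graph_on_nat:
  assumes V: "finite V" "V \<noteq> {}" and y: "\<And>v. v \<in> V \<Longrightarrow> y v > (0::real)" "\<And>v. v \<in> V \<Longrightarrow> adj_apply r V y v = \<mu> * y v"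
  shows "\<exists>(N :: nat) r' y'. N \<ge> 1 \<and> r' \<subseteq> {..<N} \<times> {..<N} \<and>
    (\<forall>v<N. y' v > (0::real)) \<and> (\<forall>v<N. adj_apply r' {..<N} y' v = \<mu> * y' v)"
proof -
  define N where "N = card V"
  obtain c where c: "bij_betw c {..<N} V"
    using ex_bij_betw_nat_finite[OF V(1)] by (auto simp: N_def atLeast0LessThan)
  have cV: "c i \<in> V" if "i < N" for i using c that by (auto simp: bij_betw_def)
  define r' where "r' = {(i, j). i < N \<and> j < N \<and> (c i, c j) \<in> r}"
  show ?thesis
  proof (intro exI[of _ N] exI[of _ r'] exI[of _ "y \<circ> c"] conjI allI impI)
    show "N \<ge> 1" using V by (simp add: N_def Suc_le_eq card_gt_0_iff)
    show "r' \<subseteq> {..<N} \<times> {..<N}" by (auto simp: r'_def)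
    show "(y \<circ> c) v > 0" if "v < N" for v using y(1) cV that by simp
    fix v assume v: "v < N"
    have "bij_betw c {j \<in> {..<N}. (v, j) \<in> r'} {u \<in> V. (c v, u) \<in> r}"
    proof (rule bij_betw_imageI)
      show "inj_on c {j \<in> {..<N}. (v, j) \<in> r'}" using c by (auto simp: bij_betw_def inj_on_def)
      show "c ` {j \<in> {..<N}. (v, j) \<in> r'} = {u \<in> V. (c v, u) \<in> r}"
      proof
        show "{u \<in> V. (c v, u) \<in> r} \<subseteq> c ` {j \<in> {..<N}. (v, j) \<in> r'}"
        proof
          fix u assume u: "u \<in> {u \<in> V. (c v, u) \<in> r}"
          then obtain j where "j < N" "u = c j" using c by (auto simp: bij_betw_def)
          then show "u \<in> c ` {j \<in> {..<N}. (v, j) \<in> r'}" using u v by (auto simp: r'_def)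
        qed
      qed (use cV in \<open>auto simp: r'_def\<close>)
    qed
    then have "adj_apply r' {..<N} (y \<circ> c) v = adj_apply r V y (c v)"
      unfolding adj_apply_def by (subst sum.reindex_bij_betw[symmetric]) auto
    then show "adj_apply r' {..<N} (y \<circ> c) v = \<mu> * (y \<circ> c) v" using y(2)[OF cV[OF v]] by simp
  qed
qed

definition grid :: "nat \<Rightarrow> nat \<Rightarrow> real" where
  "grid N i = real i / real (Suc N)"

lemma grid_less [simp]: "grid N i < grid N j \<longleftrightarrow> i < j"
  by (simp add: grid_def divide_less_cancel)

lemma grid_le [simp]: "grid N i \<le> grid N j \<longleftrightarrow> i \<le> j"
  by (simp add: grid_def divide_le_cancel)

lemma grid_eq [simp]: "grid N i = grid N j \<longleftrightarrow> i = j"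
  by (simp add: grid_def)

lemma grid_Suc: "grid N (Suc i) = grid N i + 1 / real (Suc N)"
  by (simp add: grid_def add_divide_distrib)

definition isym :: "nat \<Rightarrow> nat" where "isym i = 2 * i"
definition vsym :: "nat \<Rightarrow> nat \<Rightarrow> nat" where "vsym i j = 2 * prod_encode (i, j) + 1"

lemma sym_eq [simp]: "isym i = isym j \<longleftrightarrow> i = j" "vsym i j = vsym i' j' \<longleftrightarrow> i = i' \<and> j = j'"
    "isym i \<noteq> vsym k l" "vsym k l \<noteq> isym i"
  unfolding isym_def vsym_def by (simp_all, presburger+)

lemma sym_decode [simp]: "even (isym i)" "odd (vsym i j)" "isym i div 2 = i" "vsym i j div 2 = prod_encode (i, j)"
  unfolding isym_def vsym_def by simp_all

text \<open>The given graph lives on the grid points \<open>0, \<dots>, N - 1\<close> of \<open>[0,1]\<close>. All gaps are mapped increasingly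
  onto the last one; the additional arrows into the last two grid points are the end points of these
  branches. The branches and the additional arrows carry no entropy.\<close>

definition ext_graph :: "nat \<Rightarrow> (nat \<times> nat) set \<Rightarrow> (nat \<times> nat) set" where
  "ext_graph N r = r \<union> (\<lambda>i. (i, N)) ` {..N} \<union> (\<lambda>i. (Suc i, Suc N)) ` {..N}"

definition graph_map :: "nat \<Rightarrow> (nat \<times> nat) set \<Rightarrow> nat multi_map" where
  "graph_map N r = \<lparr>pts = grid N ` {..Suc N}, alph0 = isym ` {..N}, alph1 = {},
     alph2 = (\<lambda>(i, j). vsym i j) ` ext_graph N r,
     Dom = (\<lambda>a. if even a then {grid N (a div 2)..grid N (Suc (a div 2))} else {grid N (fst (prod_decode (a div 2)))}),
     Ran = (\<lambda>a. if even a then {grid N N..grid N (Suc N)} else {grid N (snd (prod_decode (a div 2)))}),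
     branch = (\<lambda>a x. x + (grid N N - grid N (a div 2)))\<rparr>"

locale weighted_graph =
  fixes N :: nat and r :: "(nat \<times> nat) set" and y :: "nat \<Rightarrow> real" and \<mu> :: real
  assumes N: "N \<ge> 1" and r: "r \<subseteq> {..<N} \<times> {..<N}" and y: "\<And>v. v < N \<Longrightarrow> y v > 0"
    and eigen: "\<And>v. v < N \<Longrightarrow> adj_apply r {..<N} y v = \<mu> * y v" and \<mu>: "\<mu> > 1"
begin

abbreviation "E \<equiv> ext_graph N r"
abbreviation "F \<equiv> graph_map N r"

lemma F_simps:
  "pts F = grid N ` {..Suc N}" "alph0 F = isym ` {..N}" "alph1 F = {}" "alph2 F = (\<lambda>(i, j). vsym i j) ` E"
  "Dom F (isym i) = {grid N i..grid N (Suc i)}" "Dom F (vsym i j) = {grid N i}"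
  "Ran F (isym i) = {grid N N..grid N (Suc N)}" "Ran F (vsym i j) = {grid N j}"
  "branch F (isym i) x = x + (grid N N - grid N i)"
  by (simp_all add: graph_map_def)

lemma isym_alph0: "isym i \<in> alph0 F \<longleftrightarrow> i \<le> N"
  by (auto simp: F_simps)

lemma vsym_alph0: "vsym i j \<notin> alph0 F"
  by (auto simp: F_simps)

lemma alph_eq: "alph F = isym ` {..N} \<union> (\<lambda>(i, j). vsym i j) ` E"
  by (simp add: alph_def F_simps)

lemma isym_alph: "isym i \<in> alph F \<longleftrightarrow> i \<le> N"
  by (auto simp: alph_eq)

lemma vsym_alph: "vsym i j \<in> alph F \<longleftrightarrow> (i, j) \<in> E"
  by (force simp: alph_eq)

lemma alph_sym_cases:
  assumes "a \<in> alph F"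
  obtains i where "a = isym i" "i \<le> N" | i j where "a = vsym i j" "(i, j) \<in> E"
  using assms by (auto simp: alph_eq)

lemma E_bounded: "(i, j) \<in> E \<Longrightarrow> i \<le> Suc N \<and> j \<le> Suc N"
  using r by (auto simp: ext_graph_def)

lemma finite_E: "finite E"
  using E_bounded by (intro finite_subset[of E "{..Suc N} \<times> {..Suc N}"]) auto

lemma Dom0_sym: "i \<le> N \<Longrightarrow> Dom0 F (isym i) = {grid N i<..<grid N (Suc i)}" "Dom0 F (vsym i j) = {grid N i}"
  by (simp_all add: Dom0_def isym_alph0 vsym_alph0 F_simps(5,6))

lemma Ran0_sym: "i \<le> N \<Longrightarrow> Ran0 F (isym i) = {grid N N<..<grid N (Suc N)}" "Ran0 F (vsym i j) = {grid N j}"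
  by (simp_all add: Ran0_def isym_alph0 vsym_alph0 F_simps(3,7,8))

lemma graph_sym: "i \<le> N \<Longrightarrow> graph_of F (isym i) = (\<lambda>x. (x, x + (grid N N - grid N i))) ` {grid N i..grid N (Suc i)}"
    "graph_of F (vsym i j) = {(grid N i, grid N j)}"
    "i \<le> N \<Longrightarrow> graph0_of F (isym i) = (\<lambda>x. (x, x + (grid N N - grid N i))) ` {grid N i<..<grid N (Suc i)}"
    "graph0_of F (vsym i j) = {(grid N i, grid N j)}"
  by (auto simp: graph_of_def graph0_of_def isym_alph0 vsym_alph0 Dom0_sym Ran0_sym F_simps(5-9))

lemma grid_gap: "grid N i < grid N k \<Longrightarrow> grid N k < grid N (Suc i) \<Longrightarrow> False"
  by simp

lemma interval_unique:
  assumes "grid N i < x" "x < grid N (Suc i)" "grid N j < x" "x < grid N (Suc j)"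
  shows "i = j"
proof -
  have "grid N i < grid N (Suc j)" "grid N j < grid N (Suc i)" using assms by linarith+
  then show ?thesis by simp
qed

lemma markov_F: "markov_multi_map F"
  unfolding markov_multi_map_def
proof (intro conjI)
  show "\<exists>(p :: nat \<Rightarrow> real) k. pts F = p ` {..k} \<and> strict_mono_on {..k} p \<and> p 0 = 0 \<and> p k = 1 \<and>
      (\<forall>a\<in>alph0 F. \<exists>i<k. Dom F a = {p i..p (Suc i)}) \<and> (\<forall>a\<in>alph1 F \<union> alph2 F. \<exists>i\<le>k. Dom F a = {p i})"
  proof (intro exI conjI)
    show "pts F = grid N ` {..Suc N}" by (rule F_simps)
    show "strict_mono_on {..Suc N} (grid N)" by (simp add: strict_mono_on_def)
    show "grid N 0 = 0" "grid N (Suc N) = 1" by (simp_all add: grid_def)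
    show "\<forall>a\<in>alph0 F. \<exists>i<Suc N. Dom F a = {grid N i..grid N (Suc i)}" by (auto simp: F_simps)
    show "\<forall>a\<in>alph1 F \<union> alph2 F. \<exists>i\<le>Suc N. Dom F a = {grid N i}" using E_bounded by (auto simp: F_simps)
  qed
  show "finite (alph F)" using finite_E by (simp add: alph_eq)
  show "alph0 F \<inter> alph1 F = {}" "alph0 F \<inter> alph2 F = {}" "alph1 F \<inter> alph2 F = {}" by (auto simp: F_simps)
  show "\<forall>a\<in>alph0 F. \<exists>u\<in>pts F. \<exists>v\<in>pts F. u < v \<and> Ran F a = {u..v}"
    by (auto simp: F_simps intro!: bexI[of _ "grid N N"] bexI[of _ "grid N (Suc N)"])
  show "\<forall>a\<in>alph1 F. \<exists>u\<in>pts F. \<exists>v\<in>pts F. u < v \<and> Ran F a = {u..v} \<and> Ran F a \<inter> pts F = {u, v}"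
    by (simp add: F_simps)
  show "\<forall>a\<in>alph2 F. \<exists>u\<in>pts F. Ran F a = {u}" using E_bounded by (auto simp: F_simps)
  show "\<forall>a\<in>alph0 F. \<exists>g. homeomorphism (Dom F a) (Ran F a) (branch F a) g"
  proof
    fix a assume "a \<in> alph0 F"
    then obtain i where a: "a = isym i" by (auto simp: F_simps)
    have "homeomorphism (Dom F a) (Ran F a) (branch F a) (\<lambda>x. x - (grid N N - grid N i))"
      unfolding a
    proof (rule homeomorphismI)
      show "continuous_on (Dom F (isym i)) (branch F (isym i))"
        using continuous_on_add[OF continuous_on_id continuous_on_const] by (simp add: F_simps)
      show "continuous_on (Ran F (isym i)) (\<lambda>x. x - (grid N N - grid N i))"
        by (intro continuous_intros)
      show "branch F (isym i) ` Dom F (isym i) \<subseteq> Ran F (isym i)" by (auto simp: F_simps grid_Suc)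
      show "(\<lambda>x. x - (grid N N - grid N i)) ` Ran F (isym i) \<subseteq> Dom F (isym i)" by (auto simp: F_simps grid_Suc)
    qed (auto simp: F_simps)
    then show "\<exists>g. homeomorphism (Dom F a) (Ran F a) (branch F a) g" by blast
  qed
  show "{0..1} \<subseteq> (\<Union>a\<in>alph F. Dom F a)"
  proof
    fix x :: real assume x: "x \<in> {0..1}"
    define M where "M = x * real (Suc N)"
    define k where "k = nat \<lfloor>M\<rfloor>"
    define i where "i = min N k"
    have "0 \<le> \<lfloor>M\<rfloor>" using x by (simp add: M_def)
    then have "real k = of_int \<lfloor>M\<rfloor>" by (simp add: k_def)
    then have fl: "real k \<le> M" "M < real k + 1" by linarith+
    have "M \<le> 1 * real (Suc N)" unfolding M_def using x by (intro mult_right_mono) auto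
    then have M1: "M \<le> real N + 1" by simp
    have "real i \<le> M" "M \<le> real i + 1" using fl M1 by (auto simp: i_def min_def)
    then have "real i \<le> x * real (Suc N)" "x * real (Suc N) \<le> real (Suc i)"
      unfolding M_def of_nat_Suc[of i] by (simp_all only: add.commute)
    then have "x \<in> Dom F (isym i)"
      by (simp add: F_simps grid_def divide_le_eq le_divide_eq del: of_nat_Suc)
    moreover have "isym i \<in> alph F" by (simp add: isym_alph i_def)
    ultimately show "x \<in> (\<Union>a\<in>alph F. Dom F a)" by blast
  qed
qed

lemma properly_parametrized_F: "properly_parametrized F"
  unfolding properly_parametrized_def
proof
  show "disjoint_family_on (graph0_of F) (alph F)"
    unfolding disjoint_family_on_def
  proof (intro ballI impI)
    fix a b assume ab: "a \<in> alph F" "b \<in> alph F" "a \<noteq> b"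
    have mixed: "graph0_of F (isym i) \<inter> graph0_of F (vsym k l) = {}" if "i \<le> N" for i k l
      using that grid_gap[of i k] by (auto simp: graph_sym)
    show "graph0_of F a \<inter> graph0_of F b = {}"
      using ab(1)
    proof (cases rule: alph_sym_cases)
      case (1 i)
      show ?thesis using ab(2)
      proof (cases rule: alph_sym_cases)
        case (1 j)
        then show ?thesis using \<open>a = isym i\<close> \<open>i \<le> N\<close> ab(3) interval_unique[of i _ j] by (auto simp: graph_sym)
      next
        case (2 k l)
        then show ?thesis using 1 mixed by simp
      qed
    next
      case (2 i j)
      show ?thesis using ab(2)
      proof (cases rule: alph_sym_cases)
        case (1 k)
        then show ?thesis using 2 mixed by (simp add: Int_commute)
      next
        case (2 k l)
        then show ?thesis using \<open>a = vsym i j\<close> ab(3) by (auto simp: graph_sym)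
      qed
    qed
  qed
  show "(\<Union>a\<in>alph F. graph0_of F a) = graph F"
  proof
    show "(\<Union>a\<in>alph F. graph0_of F a) \<subseteq> graph F"
      unfolding graph_def
    proof (rule UN_mono)
      fix a assume "a \<in> alph F"
      then show "graph0_of F a \<subseteq> graph_of F a" by (cases rule: alph_sym_cases) (auto simp: graph_sym)
    qed simp
    show "graph F \<subseteq> (\<Union>a\<in>alph F. graph0_of F a)"
    proof
      fix z assume "z \<in> graph F"
      then obtain a where a: "a \<in> alph F" "z \<in> graph_of F a" by (auto simp: graph_def)
      from a(1) show "z \<in> (\<Union>a\<in>alph F. graph0_of F a)"
      proof (cases rule: alph_sym_cases)
        case (1 i)
        then obtain x where x: "z = (x, x + (grid N N - grid N i))" "grid N i \<le> x" "x \<le> grid N (Suc i)"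
          using a(2) by (auto simp: graph_sym)
        consider "x = grid N i" | "x = grid N (Suc i)" | "grid N i < x" "x < grid N (Suc i)"
          using x(2,3) by fastforce
        then show ?thesis
        proof cases
          case 1
          then have "z \<in> graph0_of F (vsym i N)" using x by (simp add: graph_sym)
          moreover have "vsym i N \<in> alph F" using \<open>i \<le> N\<close> by (auto simp: vsym_alph ext_graph_def)
          ultimately show ?thesis by blast
        next
          case 2
          then have "z \<in> graph0_of F (vsym (Suc i) (Suc N))" using x by (simp add: graph_sym grid_Suc)
          moreover have "vsym (Suc i) (Suc N) \<in> alph F" using \<open>i \<le> N\<close> by (auto simp: vsym_alph ext_graph_def)
          ultimately show ?thesis by blast
        next
          case 3
          then have "z \<in> graph0_of F a" using x 1 by (auto simp: graph_sym)
          then show ?thesis using a(1) by blast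
        qed
      next
        case (2 i j)
        then have "z \<in> graph0_of F a" using a(2) by (simp add: graph_sym)
        then show ?thesis using a(1) by blast
      qed
    qed
  qed
qed

sublocale markov F
  by unfold_locales (rule markov_F properly_parametrized_F)+

lemma edges_isym: "(isym i, b) \<in> edges F \<longleftrightarrow> i \<le> N \<and> b = isym N"
proof (cases "i \<le> N \<and> b \<in> alph F")
  case True
  from True have "b \<in> alph F" by simp
  then show ?thesis
  proof (cases rule: alph_sym_cases)
    case (1 j)
    have "(isym i, b) \<in> edges F \<longleftrightarrow> {grid N j<..<grid N (Suc j)} \<subseteq> {grid N N<..<grid N (Suc N)}"
      using True 1 by (simp add: edges_iff Dom0_sym Ran0_sym isym_alph)
    also have "\<dots> \<longleftrightarrow> j = N" using 1 by (auto simp: greaterThanLessThan_subseteq_greaterThanLessThan)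
    finally show ?thesis using True 1 by simp
  next
    case (2 j k)
    then show ?thesis using True grid_gap[of N j] by (auto simp: edges_iff Dom0_sym Ran0_sym)
  qed
qed (auto simp: edges_iff isym_alph)

lemma edges_vsym: "(vsym i j, b) \<in> edges F \<longleftrightarrow> (i, j) \<in> E \<and> (\<exists>k. (j, k) \<in> E \<and> b = vsym j k)"
proof (cases "(i, j) \<in> E \<and> b \<in> alph F")
  case True
  from True have "b \<in> alph F" by simp
  then show ?thesis
  proof (cases rule: alph_sym_cases)
    case (1 l)
    have "infinite {grid N l<..<grid N (Suc l)}" by (simp add: infinite_Ioo_iff)
    then have "\<not> {grid N l<..<grid N (Suc l)} \<subseteq> {grid N j}" by (meson finite.simps finite_subset)
    then show ?thesis using 1 by (simp add: edges_iff Dom0_sym Ran0_sym)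
  next
    case (2 j' k)
    then show ?thesis using True by (auto simp: edges_iff Dom0_sym Ran0_sym vsym_alph)
  qed
qed (auto simp: edges_iff vsym_alph)

lemma adj_vsym:
  assumes "(i, j) \<in> E"
  shows "adj_apply (edges F) (alph F) z (vsym i j) = (\<Sum>k\<in>{k. (j, k) \<in> E}. z (vsym j k))"
proof -
  have "{b \<in> alph F. (vsym i j, b) \<in> edges F} = vsym j ` {k. (j, k) \<in> E}"
    using assms by (auto simp: edges_vsym vsym_alph)
  moreover have "inj_on (vsym j) {k. (j, k) \<in> E}" by (auto simp: inj_on_def)
  ultimately show ?thesis unfolding adj_apply_def by (simp add: sum.reindex)
qed

lemma adj_isym: "i \<le> N \<Longrightarrow> adj_apply (edges F) (alph F) z (isym i) = z (isym N)"
proof -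
  assume "i \<le> N"
  then have "{b \<in> alph F. (isym i, b) \<in> edges F} = {isym N}" by (auto simp: edges_isym isym_alph)
  then show ?thesis unfolding adj_apply_def by simp
qed

lemma finite_succ: "finite {k. (j, k) \<in> E}"
  by (rule finite_subset[of _ "{..Suc N}"]) (auto dest: E_bounded)

lemma succ_low: "j < N \<Longrightarrow> {k. (j, k) \<in> E} \<subseteq> {k. (j, k) \<in> r} \<union> {N, Suc N}"
  by (auto simp: ext_graph_def)

lemma succ_top: "{k. (N, k) \<in> E} \<subseteq> {N, Suc N}" "{k. (Suc N, k) \<in> E} \<subseteq> {Suc N}"
  using r by (auto simp: ext_graph_def)

lemma sum_r: "j < N \<Longrightarrow> (\<Sum>k\<in>{k. (j, k) \<in> r}. y k) = \<mu> * y j"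
proof -
  assume "j < N"
  moreover have "{k \<in> {..<N}. (j, k) \<in> r} = {k. (j, k) \<in> r}" using r by auto
  ultimately show ?thesis using eigen[of j] by (simp add: adj_apply_def)
qed

lemma supersolution:
  assumes \<mu>': "\<mu>' > \<mu>"
  shows "\<exists>z. \<forall>a\<in>alph F. z a > 0 \<and> adj_apply (edges F) (alph F) z a \<le> \<mu>' * z a"
proof -
  define m where "m = Min (y ` {..<N})"
  have ne: "{..<N} \<noteq> {}" using N by (metis lessThan_eq_iff lessThan_0 not_one_le_zero)
  have m: "m > 0" "\<And>j. j < N \<Longrightarrow> m \<le> y j"
    using ne y by (auto simp: m_def)
  define K where "K = \<mu>' / ((\<mu>' - \<mu>) * m)"
  have K: "K > 0" "K * ((\<mu>' - \<mu>) * m) = \<mu>'" using m \<mu>' \<mu> by (simp_all add: K_def)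
  define Y where "Y j = (if j < N then K * y j else if j = N then 1 else \<mu>' - 1)" for j
  have Ypos: "Y j > 0" for j using K y \<mu>' \<mu> by (simp add: Y_def)
  have Ysum: "(\<Sum>k\<in>{k. (j, k) \<in> E}. Y k) \<le> \<mu>' * Y j" if jS: "j \<le> Suc N" for j
  proof -
    have nn: "\<And>k. 0 \<le> Y k" using Ypos less_imp_le by blast
    consider "j < N" | "j = N" | "j = Suc N" using jS by linarith
    then show ?thesis
    proof cases
      case 1
      have fin: "finite {k. (j, k) \<in> r}" by (rule finite_subset[of _ "{..<N}"]) (use r in auto)
      have "(\<Sum>k\<in>{k. (j, k) \<in> E}. Y k) \<le> (\<Sum>k\<in>{k. (j, k) \<in> r} \<union> {N, Suc N}. Y k)"
        by (rule sum_mono2[OF _ succ_low[OF 1] nn]) (use fin in simp)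
      also have "\<dots> = (\<Sum>k\<in>{k. (j, k) \<in> r}. Y k) + (\<Sum>k\<in>{N, Suc N}. Y k)"
        using fin r by (intro sum.union_disjoint) auto
      also have "(\<Sum>k\<in>{k. (j, k) \<in> r}. Y k) = (\<Sum>k\<in>{k. (j, k) \<in> r}. K * y k)"
        using r by (intro sum.cong) (auto simp: Y_def)
      also have "\<dots> = K * (\<mu> * y j)" using sum_r[OF 1] by (simp flip: sum_distrib_left)
      also have "(\<Sum>k\<in>{N, Suc N}. Y k) = \<mu>'" by (simp add: Y_def)
      also have "\<mu>' = K * ((\<mu>' - \<mu>) * m)" using K by simp
      also have "\<dots> \<le> K * ((\<mu>' - \<mu>) * y j)" using K(1) \<mu>' m(2)[OF 1] by (intro mult_left_mono) auto
      also have "K * (\<mu> * y j) + K * ((\<mu>' - \<mu>) * y j) = \<mu>' * (K * y j)" by (simp add: algebra_simps)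
      finally show ?thesis using 1 by (simp add: Y_def)
    next
      case 2
      have "(\<Sum>k\<in>{k. (j, k) \<in> E}. Y k) \<le> (\<Sum>k\<in>{N, Suc N}. Y k)"
        unfolding 2 by (rule sum_mono2[OF _ succ_top(1) nn]) simp
      then show ?thesis using 2 by (simp add: Y_def)
    next
      case 3
      have "(\<Sum>k\<in>{k. (j, k) \<in> E}. Y k) \<le> (\<Sum>k\<in>{Suc N}. Y k)"
        unfolding 3 by (rule sum_mono2[OF _ succ_top(2) nn]) simp
      also have "\<dots> = 1 * Y j" using 3 by simp
      also have "\<dots> \<le> \<mu>' * Y j" using \<mu>' \<mu> nn by (intro mult_right_mono) auto
      finally show ?thesis .
    qed
  qed
  define z where "z a = (if even a then 1 else Y (snd (prod_decode (a div 2))))" for a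
  have z: "z (isym i) = 1" "z (vsym i j) = Y j" for i j by (simp_all add: z_def)
  have "z a > 0 \<and> adj_apply (edges F) (alph F) z a \<le> \<mu>' * z a" if "a \<in> alph F" for a
    using that
  proof (cases rule: alph_sym_cases)
    case (1 i)
    then show ?thesis using \<mu>' \<mu> by (simp add: z adj_isym)
  next
    case (2 i j)
    then show ?thesis using Ysum[of j] Ypos E_bounded[of i j] by (simp add: z adj_vsym)
  qed
  then show ?thesis by blast
qed

lemma eigenvalue_le:
  assumes z: "\<forall>a\<in>alph F. z a > 0 \<and> adj_apply (edges F) (alph F) z a \<le> l * z a"
  shows "\<mu> \<le> l"
proof -
  define x where "x a = (if odd a \<and> prod_decode (a div 2) \<in> r then y (snd (prod_decode (a div 2))) else 0)" for a
  have x: "x (isym i) = 0" "x (vsym i j) = (if (i, j) \<in> r then y j else 0)" for i j by (simp_all add: x_def)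
  have x0: "x a \<ge> 0" for a
    using y r unfolding x_def by (auto simp: case_prod_unfold less_imp_le subset_eq)
  have "adj_apply r {..<N} y 0 > 0" using eigen[of 0] y[of 0] \<mu> N by simp
  then have "{k\<in>{..<N}. (0, k) \<in> r} \<noteq> {}" unfolding adj_apply_def by (metis less_irrefl sum.empty)
  then obtain k where k: "(0, k) \<in> r" "k < N" by auto
  have rE: "r \<subseteq> E" by (auto simp: ext_graph_def)
  show ?thesis
  proof (rule subsolution_le_supersolution[OF finite_alph, where k = "vsym 0 k" and x = x and y = z])
    show "vsym 0 k \<in> alph F" using k rE by (auto simp: vsym_alph)
    show "x (vsym 0 k) > 0" using k y by (simp add: x)
    fix a assume a: "a \<in> alph F"
    have ge0: "0 \<le> adj_apply (edges F) (alph F) x a" using x0 by (intro adj_apply_nonneg)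
    show "\<mu> * x a \<le> adj_apply (edges F) (alph F) x a"
      using a
    proof (cases rule: alph_sym_cases)
      case (1 i)
      then show ?thesis using ge0 by (simp add: x)
    next
      case (2 i j)
      show ?thesis
      proof (cases "(i, j) \<in> r")
        case True
        then have j: "j < N" using r by auto
        have "\<mu> * x a = (\<Sum>k\<in>{k. (j, k) \<in> r}. y k)" using 2 True sum_r[OF j] by (simp add: x)
        also have "\<dots> = (\<Sum>k\<in>{k. (j, k) \<in> r}. x (vsym j k))" by (intro sum.cong) (auto simp: x)
        also have "\<dots> \<le> (\<Sum>k\<in>{k. (j, k) \<in> E}. x (vsym j k))"
          by (rule sum_mono2[OF finite_succ _ x0]) (use rE in blast)
        finally show ?thesis using adj_vsym[OF 2(2)] 2(1) by simp
      next
        case False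
        then show ?thesis using ge0 2 by (simp add: x)
      qed
    qed
  qed (use x0 z in auto)
qed

lemma positive_component_avoids_branches:
  assumes C: "positive_entropy_component F C"
  shows "C \<inter> alph0 F = {}"
proof (rule ccontr)
  assume "C \<inter> alph0 F \<noteq> {}"
  then obtain a where a: "a \<in> C" "a \<in> alph0 F" by blast
  have conn: "(a, b) \<in> (edges F \<inter> C \<times> C)\<^sup>*" if "b \<in> C" for b
    using C a that unfolding positive_entropy_component_def irreducible_component_def strongly_connected_def by blast
  have sub: "C \<subseteq> alph0 F"
  proof
    fix b assume "b \<in> C"
    from conn[OF this] a(2) show "b \<in> alph0 F"
    proof (induction rule: rtrancl_induct)
      case (step c d)
      then obtain i where "c = isym i" by (auto simp: F_simps)
      then show ?case using step by (auto simp: edges_isym isym_alph0)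
    qed
  qed
  have next_sym: "s (Suc n) = isym N" if "s \<in> sft_on F C" for s n
  proof -
    have "s n \<in> alph0 F" using that sub by (auto simp: sft_on_def)
    then obtain i where "s n = isym i" by (auto simp: F_simps)
    moreover have "(s n, s (Suc n)) \<in> edges F" using that by (simp add: sft_on_def sft_iff)
    ultimately show ?thesis by (simp add: edges_isym)
  qed
  have "sft_on F C \<subseteq> (\<lambda>a. case_nat a (\<lambda>_. isym N)) ` alph F"
  proof
    fix s assume s: "s \<in> sft_on F C"
    have "s = case_nat (s 0) (\<lambda>_. isym N)"
    proof
      fix n show "s n = case_nat (s 0) (\<lambda>_. isym N) n" using next_sym[OF s] by (cases n) auto
    qed
    moreover have "s 0 \<in> alph F" using s by (simp add: sft_on_def sft_def)
    ultimately show "s \<in> (\<lambda>a. case_nat a (\<lambda>_. isym N)) ` alph F" by (rule image_eqI)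
  qed
  then have fin: "finite (sft_on F C)" using finite_alph finite_subset by blast
  have S: "topspace (subshift_space F (sft_on F C)) = sft_on F C"
    by (rule subshift_topspace) (auto simp: sft_on_def)
  have "top_entropy (subshift_space F (sft_on F C)) shift \<le> 0"
    by (rule top_entropy_finite) (use S fin in \<open>auto simp: sft_on_def sft_iff shift_def\<close>)
  moreover have "0 < top_entropy (subshift_space F (sft_on F C)) shift"
    using C by (simp add: positive_entropy_component_def)
  ultimately show False by (meson leD)
qed

lemma positive_component_coding_word:
  assumes C: "positive_entropy_component F C"
  shows "\<exists>u. coding_word F C u"
proof -
  have Ca: "C \<noteq> {}" "C \<subseteq> alph F"
    using C unfolding positive_entropy_component_def irreducible_component_def strongly_connected_def by blast+
  then obtain c where c: "c \<in> C" "c \<in> alph F" by blast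
  have "is_singleton (seq_interval F s)" if s: "s \<in> sft_on F C" for s
  proof -
    have sn: "s n \<in> alph F" "s n \<notin> alph0 F" for n
      using s Ca positive_component_avoids_branches[OF C] by (auto simp: sft_on_def)
    obtain q where q: "Dom F (s 0) = {q}" using Dom_alph12[OF sn] by blast
    have "word_interval F (map s [0..<Suc n]) = {q}" if "n \<ge> 1" for n
    proof -
      have ne: "foldr (\<lambda>a S. branch_inv F a ` S) w {x} \<noteq> {}" for w :: "nat list" and x
        by (induction w) auto
      have sp: "map s [0..<n] = s 0 # map s [1..<n]" using that by (simp add: upt_conv_Cons)
      obtain q' where q': "Dom F (s n) = {q'}" using Dom_alph12[OF sn] by blast
      have "word_interval F (map s [0..<Suc n]) = branch_inv F (s 0) ` foldr (\<lambda>a S. branch_inv F a ` S) (map s [1..<n]) {q'}"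
        using q' by (simp add: word_interval_def sp)
      moreover have "branch_inv F (s 0) x = q" for x using sn(2)[of 0] q by (simp add: branch_inv_def)
      ultimately show ?thesis using ne[of "map s [1..<n]" q'] by auto
    qed
    then have "seq_interval F s = {q}" unfolding seq_interval_def by auto
    then show ?thesis by simp
  qed
  moreover have "[c] \<in> language_on F C" using c by (simp add: language_on_def language_def)
  ultimately show ?thesis unfolding coding_word_def by blast
qed

lemma graph_map_entropy: "class_F F" "top_entropy (trajectory_space F) shift = ereal (ln \<mu>)"
proof -
  obtain i l x where i: "i \<in> alph F" "l \<ge> 0" and x: "\<And>j. j \<in> scc_of (edges F) i \<Longrightarrow> x j > 0"
    "\<And>j. j \<in> scc_of (edges F) i \<Longrightarrow> adj_apply (edges F) (scc_of (edges F) i) x j = l * x j"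
    and super: "\<And>l'. l' > l \<Longrightarrow> \<exists>y. \<forall>j\<in>alph F. y j > 0 \<and> adj_apply (edges F) (alph F) y j \<le> l' * y j"
    using dominant_component[OF finite_alph alph_nonempty edges_subset] by metis
  have le: "\<mu> \<le> l"
  proof (rule dense_ge)
    fix l' assume "l < l'"
    from super[OF this] show "\<mu> \<le> l'" using eigenvalue_le by blast
  qed
  then have l: "l > 1" using \<mu> by simp
  have Cne: "C \<noteq> {}" if "positive_entropy_component F C" for C
    using that unfolding positive_entropy_component_def irreducible_component_def strongly_connected_def by blast
  have not_sub: "\<not> C \<subseteq> alph0 F" if "positive_entropy_component F C" for C
    using Cne[OF that] positive_component_avoids_branches[OF that] by blast
  show "class_F F"
    unfolding class_F_def
    using markov_F properly_parametrized_F positive_component_coding_word not_sub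
      component_entropy_pos(2)[OF i(1) refl x l] by blast
  have "ereal (ln l) \<le> top_entropy (trajectory_space F) shift"
    by (rule top_entropy_trajectories_ge[OF i(1) refl x l])
      (use not_sub component_entropy_pos(1)[OF i(1) refl x l] in blast)+
  moreover have "ereal (ln \<mu>) \<le> ereal (ln l)" using le \<mu> by simp
  moreover have "top_entropy (trajectory_space F) shift \<le> ereal (ln \<mu>)"
  proof (rule dense_ge)
    fix h assume h: "ereal (ln \<mu>) < h"
    show "top_entropy (trajectory_space F) shift \<le> h"
    proof (cases h)
      case (real c)
      define \<mu>' where "\<mu>' = exp c"
      have "exp (ln \<mu>) < exp c" using h real by simp
      then have \<mu>': "\<mu>' > \<mu>" using \<mu> by (simp add: \<mu>'_def)
      obtain z where z: "\<forall>a\<in>alph F. z a > 0 \<and> adj_apply (edges F) (alph F) z a \<le> \<mu>' * z a"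
        using supersolution[OF \<mu>'] by blast
      have "top_entropy (trajectory_space F) shift \<le> ereal (ln \<mu>')"
        by (rule top_entropy_trajectories_le[of z]) (use z \<mu> \<mu>' in auto)
      then show ?thesis by (simp add: real \<mu>'_def)
    qed (use h in auto)
  qed
  ultimately show "top_entropy (trajectory_space F) shift = ereal (ln \<mu>)" by (meson antisym order_trans)
qed

end

lemma perron_entropy_in_entropies_F:
  assumes "(q :: rat) > 0" "l > 1" "perron_number l"
  shows "of_rat q * ln l \<in> entropies_F"
proof -
  obtain a b :: int where ab: "quotient_of q = (a, b)" by (metis surj_pair)
  have b: "b > 0" "q = of_int a / of_int b"
    using quotient_of_denom_pos[OF ab] quotient_of_div[OF ab] by simp_all
  have a: "a > 0" using assms(1) b by (simp add: zero_less_divide_iff)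
  define m n where "m = 2 * nat a" and "n = 2 * nat b"
  have mn: "real m / real n = of_rat q" using a b by (simp add: m_def n_def of_rat_divide)
  have n: "n \<ge> 2" using b by (simp add: n_def)
  define \<mu> where "\<mu> = l powr (of_rat q)"
  have q: "(of_rat q :: real) > 0" using assms(1) by simp
  have \<mu>1: "\<mu> > 1" using assms(2) q by (simp add: \<mu>_def gr_one_powr)
  then have \<mu>0: "\<mu> > 0" by simp
  have ln\<mu>: "ln \<mu> = of_rat q * ln l" using assms(2) by (simp add: \<mu>_def ln_powr)
  have "\<mu> ^ n = l powr (real n * of_rat q)"
    using assms(2) by (simp add: \<mu>_def powr_powr flip: powr_realpow) (simp add: mult.commute)
  also have "real n * of_rat q = real m" using n by (simp flip: mn)
  also have "l powr real m = l ^ m" using assms(2) by (simp add: powr_realpow)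
  finally have \<mu>n: "\<mu> ^ n = l ^ m" .
  obtain S :: "int poly set" and x B where S: "finite S" "S \<noteq> {}" "\<And>p. p \<in> S \<Longrightarrow> x p > (0::real)"
    "\<And>p. p \<in> S \<Longrightarrow> (\<Sum>q\<in>S. real (B p q) * x q) = l * x p"
    by (rule lind_matrix[OF assms(3,2)]) blast
  have pow: "(\<Sum>q\<in>S. real (mat_power S B m p q) * x q) = \<mu> ^ n * x p" if "p \<in> S" for p
    unfolding \<mu>n by (rule mat_power_eigen[OF S(1,4) that])
  obtain V :: "(int poly + int poly \<times> int poly \<times> nat \<times> nat) set" and r0 y0
    where V: "finite V" "V \<noteq> {}" "r0 \<subseteq> V \<times> V" "\<And>v. v \<in> V \<Longrightarrow> y0 v > (0::real)"
      "\<And>v. v \<in> V \<Longrightarrow> adj_apply r0 V y0 v = \<mu> * y0 v"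
    by (rule subdivision_graph[OF S(1,2,3) pow n \<mu>0]) auto
  have "\<exists>(N :: nat) r y. N \<ge> 1 \<and> r \<subseteq> {..<N} \<times> {..<N} \<and>
    (\<forall>v<N. y v > (0::real)) \<and> (\<forall>v<N. adj_apply r {..<N} y v = \<mu> * y v)"
    by (rule graph_on_nat[OF V(1,2), of y0 r0]) (rule V(4,5), assumption)+
  then obtain N :: nat and r y where g: "N \<ge> 1" "r \<subseteq> {..<N} \<times> {..<N}"
    "\<forall>v<N. y v > (0::real)" "\<forall>v<N. adj_apply r {..<N} y v = \<mu> * y v"
    by (elim exE conjE) (rule that)
  interpret weighted_graph N r y \<mu>
    by unfold_locales (use g \<mu>1 in auto)
  have "of_rat q * ln l > 0" using q assms(2) by simp
  then show ?thesis
    unfolding entropies_F_def using graph_map_entropy ln\<mu> by auto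
qed

theorem theorem1p5:
  "entropies_F = {of_rat q * ln l | (q :: rat) (l :: real). q > 0 \<and> l > 1 \<and> perron_number l}"
  using entropies_F_subset perron_entropy_in_entropies_F by blast

end
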